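(* There is a robust, Turing-universal computational dynamical system $(f,\mathcal E,\mathcal D,\tau,\mathsf{T}_{\mathrm{univ}})$ in which $f:D^2\to D^2$ is a smooth map of the closed $2$-disk, the slowdown function is $\tau\equiv 1$, and $\mathcal E,\mathcal D$ have optimal complexity $\Theta(n)$ (i.e. $\mathcal E$ has input time complexity $\Theta(n)$ and $\mathcal D$ has output time complexity $\Theta(n)$).
   Context: A BSS$_{\mathsf C}$ machine is a Blum–Shub–Smale machine over $\mathbb R$ (a Turing-type machine with real-valued tape cells whose transition function is a semialgebraic function) all of whose finitely many machine constants are computable real numbers; a hybrid BSS$_{\mathsf C}$ machine has two tapes, one with entries in $\mathbb R$ and one with entries in a finite set $\mathbb Z_d$. Let $\mathsf T:S\to S$ be a Turing machine with configuration set $S$ (finite strings encoding tape contents, head position and internal state; $|s|$ is the length), and let $f:M\to M$ with $M\subseteq\mathbb R^k$. A tuple $(f,\mathcal E,\mathcal D,\tau,\mathsf T)$ is a computational dynamical system (CDS) with complexity $O(t(n))$ if: $\mathcal E:S\to M$ is computed by a hybrid BSS$_{\mathsf C}$ machine in time $O(t(|s|))$ (input time complexity); $\mathcal D:M\rightharpoonup S$ is a partial function computed by a hybrid BSS$_{\mathsf C}$ machine in time $O(t(|\mathcal D(x)|))$ (output time complexity); $\tau:M\rightharpoonup\mathbb Z_{\ge0}$ is defined exactly on the domain of $\mathcal D$, is constant on connected components of each $\mathcal D^{-1}(s)$, and is computed by a hybrid BSS$_{\mathsf C}$ machine in time $O(u(|\mathcal D(x)|))$ for some computable $u$; and, writing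 $C_s=\mathcal D^{-1}(s)$ and $f^\tau(x)=f^{\tau(x)}(x)$, one has $\mathcal E(s)\in C_s$ and $\mathcal D(f^\tau(C_s))=\{\mathsf T(s)\}$ for all $s\in S$. The CDS is robust if every $C_s$ is the closure of its interior and $\mathcal E(s)$ lies in the interior of $C_s$. It is Turing-universal if $\mathsf T$ is a universal Turing machine. *)

theory Defs
  imports "HOL-Analysis.Analysis"
begin

text \<open>A Turing machine has states 0..tm_nq-1 and tape symbols 0..tm_ns-1;
  symbol 0 is the blank, state 1 is the start state, state 0 is the halting state.
  tm_delta q a = (new state, written symbol, head move in {-1,0,1}).\<close>

record tm =
  tm_nq :: nat
  tm_ns :: nat
  tm_delta :: "nat \<Rightarrow> nat \<Rightarrow> nat \<times> nat \<times> int"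

text \<open>A configuration (q, L, R): state q, tape cells left of the head L (left to right),
  the head cell followed by the cells to its right R (an empty R means a blank head cell).\<close>

type_synonym tm_conf = "nat \<times> nat list \<times> nat list"

definition wf_tm :: "tm \<Rightarrow> bool" where
  "wf_tm M \<longleftrightarrow> tm_nq M \<ge> 2 \<and> tm_ns M \<ge> 2 \<and>
     (\<forall>q<tm_nq M. \<forall>a<tm_ns M. case tm_delta M q a of (q', b, m) \<Rightarrow>
        q' < tm_nq M \<and> b < tm_ns M \<and> m \<in> {-1, 0, 1})"

definition tm_configs :: "tm \<Rightarrow> tm_conf set" where
  "tm_configs M = {(q, L, R). q < tm_nq M \<and> set L \<subseteq> {..<tm_ns M} \<and> set R \<subseteq> {..<tm_ns M}}"

definition tm_step :: "tm \<Rightarrow> tm_conf \<Rightarrow> tm_conf" where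
  "tm_step M c = (case c of (q, L, R) \<Rightarrow>
     if q = 0 then c else
     (let a = (case R of [] \<Rightarrow> 0 | x # _ \<Rightarrow> x); R' = tl R in
      case tm_delta M q a of (q', b, m) \<Rightarrow>
        if m = 1 then (q', L @ [b], R')
        else if m = -1 then (if L = [] then (q', [], 0 # b # R') else (q', butlast L, last L # b # R'))
        else (q', L, b # R')))"

text \<open>Length |s| of a configuration string (tape cells plus the state/head marker).\<close>
definition tm_size :: "tm_conf \<Rightarrow> nat" where
  "tm_size c = (case c of (q, L, R) \<Rightarrow> length L + length R + 1)"

text \<open>The configuration as a finite string over nonzero symbols: tape symbols are shifted by one,
  and the head position and internal state are marked by the symbol Suc (tm_ns M) + q.\<close>
definition tm_enc :: "tm \<Rightarrow> tm_conf \<Rightarrow> nat list" where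
  "tm_enc M c = (case c of (q, L, R) \<Rightarrow> map Suc L @ [Suc (tm_ns M) + q] @ map Suc R)"

definition tm_start :: "nat list \<Rightarrow> tm_conf" where
  "tm_start w = (1, [], w)"

definition tm_halts :: "tm \<Rightarrow> tm_conf \<Rightarrow> bool" where
  "tm_halts M c \<longleftrightarrow> (\<exists>n. fst ((tm_step M ^^ n) c) = 0)"

definition tm_result :: "tm_conf \<Rightarrow> nat list" where
  "tm_result c = (case c of (q, L, R) \<Rightarrow> dropWhile (\<lambda>x. x = 0) (rev (dropWhile (\<lambda>x. x = 0) (rev (L @ R)))))"

definition tm_output :: "tm \<Rightarrow> tm_conf \<Rightarrow> nat list \<Rightarrow> bool" where
  "tm_output M c r \<longleftrightarrow> (\<exists>n. fst ((tm_step M ^^ n) c) = 0 \<and> tm_result ((tm_step M ^^ n) c) = r)"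

definition universal_tm :: "tm \<Rightarrow> bool" where
  "universal_tm U \<longleftrightarrow> wf_tm U \<and> tm_ns U \<ge> 3 \<and>
     (\<forall>M. wf_tm M \<and> tm_ns M = 3 \<longrightarrow>
        (\<exists>code. set code \<subseteq> {..<tm_ns U} \<and>
           (\<forall>w. set w \<subseteq> {1, 2} \<longrightarrow>
              (tm_halts M (tm_start w) \<longleftrightarrow> tm_halts U (tm_start (code @ w))) \<and>
              (\<forall>r. tm_output M (tm_start w) r \<longrightarrow> tm_output U (tm_start (code @ w)) r))))"

definition int_code :: "int \<Rightarrow> nat list" where
  "int_code z = (if z \<ge> 0 then replicate (nat z) 1 else 2 # replicate (nat (- z)) 1)"

definition computable_real :: "real \<Rightarrow> bool" where
  "computable_real x \<longleftrightarrow> (\<exists>M. wf_tm M \<and> tm_ns M \<ge> 3 \<and>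
     (\<forall>n. \<exists>z. tm_output M (tm_start (replicate n 1)) (int_code z) \<and>
            \<bar>real_of_int z / 2 ^ n - x\<bar> \<le> 1 / 2 ^ n))"

definition computable_nat_fun :: "(nat \<Rightarrow> nat) \<Rightarrow> bool" where
  "computable_nat_fun u \<longleftrightarrow> (\<exists>M. wf_tm M \<and>
     (\<forall>n. tm_output M (tm_start (replicate n 1)) (replicate (u n) 1)))"

datatype pexpr = PV nat | PC real | PAdd pexpr pexpr | PMul pexpr pexpr | PNeg pexpr

fun peval :: "pexpr \<Rightarrow> (nat \<Rightarrow> real) \<Rightarrow> real" where
  "peval (PV i) x = x i"
| "peval (PC c) x = c"
| "peval (PAdd p q) x = peval p x + peval q x"
| "peval (PMul p q) x = peval p x * peval q x"
| "peval (PNeg p) x = - peval p x"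

fun pvars :: "pexpr \<Rightarrow> nat set" where
  "pvars (PV i) = {i}"
| "pvars (PC c) = {}"
| "pvars (PAdd p q) = pvars p \<union> pvars q"
| "pvars (PMul p q) = pvars p \<union> pvars q"
| "pvars (PNeg p) = pvars p"

fun pconsts :: "pexpr \<Rightarrow> real set" where
  "pconsts (PV i) = {}"
| "pconsts (PC c) = {c}"
| "pconsts (PAdd p q) = pconsts p \<union> pconsts q"
| "pconsts (PMul p q) = pconsts p \<union> pconsts q"
| "pconsts (PNeg p) = pconsts p"

text \<open>Quantifier-free formulas built from polynomial sign conditions
  (they define exactly the semialgebraic sets).\<close>
datatype sform = FPos pexpr | FZero pexpr | FNot sform | FAnd sform sform | FOr sform sform

fun sholds :: "sform \<Rightarrow> (nat \<Rightarrow> real) \<Rightarrow> bool" where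
  "sholds (FPos p) x = (peval p x > 0)"
| "sholds (FZero p) x = (peval p x = 0)"
| "sholds (FNot f) x = (\<not> sholds f x)"
| "sholds (FAnd f g) x = (sholds f x \<and> sholds g x)"
| "sholds (FOr f g) x = (sholds f x \<or> sholds g x)"

fun svars :: "sform \<Rightarrow> nat set" where
  "svars (FPos p) = pvars p"
| "svars (FZero p) = pvars p"
| "svars (FNot f) = svars f"
| "svars (FAnd f g) = svars f \<union> svars g"
| "svars (FOr f g) = svars f \<union> svars g"

fun sconsts :: "sform \<Rightarrow> real set" where
  "sconsts (FPos p) = pconsts p"
| "sconsts (FZero p) = pconsts p"
| "sconsts (FNot f) = sconsts f"
| "sconsts (FAnd f g) = sconsts f \<union> sconsts g"
| "sconsts (FOr f g) = sconsts f \<union> sconsts g"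

text \<open>A branch of the transition function: a semialgebraic guard on the window of w real cells
  read by the real head (variables 0..w-1), a semialgebraic graph (variables 0..w-1 old
  window, w..2w-1 new window) of the function giving the new window contents, the new
  control state, the symbol written on the discrete tape, and the two head moves.\<close>
datatype branch = Branch (br_guard: sform) (br_graph: sform) (br_state: nat) (br_sym: nat)
  (br_rmove: int) (br_dmove: int)

record hbss =
  bss_nst :: nat
  bss_d :: nat
  bss_w :: nat
  bss_start :: nat
  bss_halt :: nat
  bss_rules :: "nat \<Rightarrow> nat \<Rightarrow> branch list"

record hconf =
  hc_state :: nat
  hc_rtape :: "int \<Rightarrow> real"
  hc_rhead :: int
  hc_dtape :: "int \<Rightarrow> nat"
  hc_dhead :: int

definition graph_env :: "nat \<Rightarrow> (nat \<Rightarrow> real) \<Rightarrow> real list \<Rightarrow> nat \<Rightarrow> real" where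
  "graph_env w x ys = (\<lambda>i. if i < w then x i else ys ! (i - w))"

definition wf_hbss :: "hbss \<Rightarrow> bool" where
  "wf_hbss P \<longleftrightarrow> bss_d P \<ge> 2 \<and> bss_w P \<ge> 1 \<and> bss_start P < bss_nst P \<and> bss_halt P < bss_nst P \<and>
     (\<forall>q<bss_nst P. \<forall>a<bss_d P. \<forall>br\<in>set (bss_rules P q a).
        br_state br < bss_nst P \<and> br_sym br < bss_d P \<and>
        br_rmove br \<in> {-1, 0, 1} \<and> br_dmove br \<in> {-1, 0, 1} \<and>
        svars (br_guard br) \<subseteq> {..<bss_w P} \<and> svars (br_graph br) \<subseteq> {..<2 * bss_w P} \<and>
        (\<forall>x. sholds (br_guard br) x \<longrightarrow>
           (\<exists>!ys. length ys = bss_w P \<and> sholds (br_graph br) (graph_env (bss_w P) x ys))) \<and>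
        (\<forall>c \<in> sconsts (br_guard br) \<union> sconsts (br_graph br). computable_real c))"

definition hbss_step :: "hbss \<Rightarrow> hconf \<Rightarrow> hconf" where
  "hbss_step P c =
    (let q = hc_state c; a = hc_dtape c (hc_dhead c); w = bss_w P; rh = hc_rhead c;
         x = (\<lambda>i. hc_rtape c (rh + int i)) in
     if q = bss_halt P \<or> q \<ge> bss_nst P \<or> a \<ge> bss_d P then c else
     (case find (\<lambda>br. sholds (br_guard br) x) (bss_rules P q a) of
        None \<Rightarrow> c
      | Some br \<Rightarrow>
          (let ys = (THE ys. length ys = w \<and> sholds (br_graph br) (graph_env w x ys)) in
           \<lparr> hc_state = br_state br,
             hc_rtape = (\<lambda>j. if rh \<le> j \<and> j < rh + int w then ys ! nat (j - rh) else hc_rtape c j),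
             hc_rhead = rh + br_rmove br,
             hc_dtape = (hc_dtape c)(hc_dhead c := br_sym br),
             hc_dhead = hc_dhead c + br_dmove br \<rparr>)))"

definition hbss_run :: "hbss \<Rightarrow> hconf \<Rightarrow> nat \<Rightarrow> hconf" where
  "hbss_run P c n = (hbss_step P ^^ n) c"

definition hbss_halts :: "hbss \<Rightarrow> hconf \<Rightarrow> bool" where
  "hbss_halts P c \<longleftrightarrow> (\<exists>n. hc_state (hbss_run P c n) = bss_halt P)"

definition hbss_time :: "hbss \<Rightarrow> hconf \<Rightarrow> nat" where
  "hbss_time P c = (LEAST n. hc_state (hbss_run P c n) = bss_halt P)"

definition hbss_final :: "hbss \<Rightarrow> hconf \<Rightarrow> hconf" where
  "hbss_final P c = hbss_run P c (hbss_time P c)"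

definition init_disc :: "hbss \<Rightarrow> nat list \<Rightarrow> hconf" where
  "init_disc P s = \<lparr> hc_state = bss_start P, hc_rtape = (\<lambda>_. 0), hc_rhead = 0,
     hc_dtape = (\<lambda>j. if 0 \<le> j \<and> j < int (length s) then s ! nat j else 0), hc_dhead = 0 \<rparr>"

definition init_real :: "hbss \<Rightarrow> real list \<Rightarrow> hconf" where
  "init_real P xs = \<lparr> hc_state = bss_start P,
     hc_rtape = (\<lambda>j. if 0 \<le> j \<and> j < int (length xs) then xs ! nat j else 0), hc_rhead = 0,
     hc_dtape = (\<lambda>_. 0), hc_dhead = 0 \<rparr>"

definition out_real :: "nat \<Rightarrow> hconf \<Rightarrow> real list" where
  "out_real k c = map (\<lambda>i. hc_rtape c (int i)) [0..<k]"

definition out_disc_is :: "hconf \<Rightarrow> nat list \<Rightarrow> bool" where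
  "out_disc_is c s \<longleftrightarrow> 0 \<notin> set s \<and> (\<forall>i<length s. hc_dtape c (int i) = s ! i) \<and>
     hc_dtape c (int (length s)) = 0"

text \<open>Points of the phase space are vectors; crd gives their coordinates in R^k.\<close>

definition computes_encoding :: "hbss \<Rightarrow> ('p \<Rightarrow> real list) \<Rightarrow> tm \<Rightarrow> (tm_conf \<Rightarrow> 'p) \<Rightarrow> bool" where
  "computes_encoding P crd T E \<longleftrightarrow> (\<forall>s\<in>tm_configs T.
     hbss_halts P (init_disc P (tm_enc T s)) \<and>
     out_real (length (crd (E s))) (hbss_final P (init_disc P (tm_enc T s))) = crd (E s))"

definition computes_decoding :: "hbss \<Rightarrow> ('p \<Rightarrow> real list) \<Rightarrow> 'p set \<Rightarrow> tm \<Rightarrow> ('p \<Rightarrow> tm_conf option) \<Rightarrow> bool" where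
  "computes_decoding P crd M T D \<longleftrightarrow> (\<forall>x\<in>M. case D x of
      None \<Rightarrow> \<not> hbss_halts P (init_real P (crd x))
    | Some s \<Rightarrow> hbss_halts P (init_real P (crd x)) \<and>
        out_disc_is (hbss_final P (init_real P (crd x))) (tm_enc T s))"

definition computes_slowdown :: "hbss \<Rightarrow> ('p \<Rightarrow> real list) \<Rightarrow> 'p set \<Rightarrow> ('p \<Rightarrow> nat option) \<Rightarrow> bool" where
  "computes_slowdown P crd M \<tau> \<longleftrightarrow> (\<forall>x\<in>M. case \<tau> x of
      None \<Rightarrow> \<not> hbss_halts P (init_real P (crd x))
    | Some n \<Rightarrow> hbss_halts P (init_real P (crd x)) \<and>
        out_real 1 (hbss_final P (init_real P (crd x))) = [real n])"

definition code_set :: "'p set \<Rightarrow> ('p \<Rightarrow> tm_conf option) \<Rightarrow> tm_conf \<Rightarrow> 'p set" where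
  "code_set M D s = {x \<in> M. D x = Some s}"

definition is_CDS ::
  "('p::topological_space \<Rightarrow> real list) \<Rightarrow> 'p set \<Rightarrow> ('p \<Rightarrow> 'p) \<Rightarrow> (tm_conf \<Rightarrow> 'p) \<Rightarrow>
   ('p \<Rightarrow> tm_conf option) \<Rightarrow> ('p \<Rightarrow> nat option) \<Rightarrow> tm \<Rightarrow> (nat \<Rightarrow> nat) \<Rightarrow> bool" where
  "is_CDS crd M f E D \<tau> T t \<longleftrightarrow>
     wf_tm T \<and> f ` M \<subseteq> M \<and> E ` tm_configs T \<subseteq> M \<and>
     (\<forall>x\<in>M. \<forall>s. D x = Some s \<longrightarrow> s \<in> tm_configs T) \<and>
     (\<exists>P. wf_hbss P \<and> computes_encoding P crd T E \<and>
        (\<exists>C. \<forall>s\<in>tm_configs T. hbss_time P (init_disc P (tm_enc T s)) \<le> C * t (tm_size s) + C)) \<and>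
     (\<exists>P. wf_hbss P \<and> computes_decoding P crd M T D \<and>
        (\<exists>C. \<forall>x\<in>M. \<forall>s. D x = Some s \<longrightarrow> hbss_time P (init_real P (crd x)) \<le> C * t (tm_size s) + C)) \<and>
     (\<forall>x\<in>M. \<tau> x = None \<longleftrightarrow> D x = None) \<and>
     (\<forall>s. \<forall>x\<in>code_set M D s. \<forall>y\<in>code_set M D s.
        connected_component (code_set M D s) x y \<longrightarrow> \<tau> x = \<tau> y) \<and>
     (\<exists>u P. computable_nat_fun u \<and> wf_hbss P \<and> computes_slowdown P crd M \<tau> \<and>
        (\<exists>C. \<forall>x\<in>M. \<forall>s. D x = Some s \<longrightarrow> hbss_time P (init_real P (crd x)) \<le> C * u (tm_size s) + C)) \<and>
     (\<forall>s\<in>tm_configs T. E s \<in> code_set M D s \<and>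
        (\<lambda>x. D ((f ^^ the (\<tau> x)) x)) ` code_set M D s = {Some (tm_step T s)})"

definition robust_CDS :: "'p::topological_space set \<Rightarrow> (tm_conf \<Rightarrow> 'p) \<Rightarrow> ('p \<Rightarrow> tm_conf option) \<Rightarrow> tm \<Rightarrow> bool" where
  "robust_CDS M E D T \<longleftrightarrow> (\<forall>s\<in>tm_configs T.
     code_set M D s = closure (interior (code_set M D s)) \<and> E s \<in> interior (code_set M D s))"

definition encoding_time_lower_linear :: "('p \<Rightarrow> real list) \<Rightarrow> tm \<Rightarrow> (tm_conf \<Rightarrow> 'p) \<Rightarrow> bool" where
  "encoding_time_lower_linear crd T E \<longleftrightarrow> (\<forall>P. wf_hbss P \<and> computes_encoding P crd T E \<longrightarrow>
     (\<exists>c>0. \<exists>N. \<forall>n\<ge>N. (\<exists>s\<in>tm_configs T. tm_size s = n) \<longrightarrow>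
        (\<exists>s\<in>tm_configs T. tm_size s = n \<and> real (hbss_time P (init_disc P (tm_enc T s))) \<ge> c * real n)))"

definition decoding_time_lower_linear :: "('p \<Rightarrow> real list) \<Rightarrow> 'p set \<Rightarrow> tm \<Rightarrow> ('p \<Rightarrow> tm_conf option) \<Rightarrow> bool" where
  "decoding_time_lower_linear crd M T D \<longleftrightarrow> (\<forall>P. wf_hbss P \<and> computes_decoding P crd M T D \<longrightarrow>
     (\<exists>c>0. \<exists>N. \<forall>n\<ge>N. (\<exists>x\<in>M. \<exists>s. D x = Some s \<and> tm_size s = n) \<longrightarrow>
        (\<exists>x\<in>M. \<exists>s. D x = Some s \<and> tm_size s = n \<and> real (hbss_time P (init_real P (crd x))) \<ge> c * real n)))"

fun pd :: "('a::real_normed_vector \<Rightarrow> 'b::real_normed_vector) \<Rightarrow> 'a list \<Rightarrow> 'a \<Rightarrow> 'b" where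
  "pd h [] = h"
| "pd h (v # vs) = (\<lambda>x. vector_derivative (\<lambda>t. pd h vs (x + t *\<^sub>R v)) (at 0))"

definition smooth_on :: "'a::real_normed_vector set \<Rightarrow> ('a \<Rightarrow> 'b::real_normed_vector) \<Rightarrow> bool" where
  "smooth_on U h \<longleftrightarrow> open U \<and> (\<forall>vs. continuous_on U (pd h vs) \<and>
     (\<forall>v. \<forall>x\<in>U. (\<lambda>t. pd h vs (x + t *\<^sub>R v)) differentiable (at (0::real))))"

definition smooth_disk_map :: "(real^2 \<Rightarrow> real^2) \<Rightarrow> bool" where
  "smooth_disk_map f \<longleftrightarrow> f ` cball 0 1 \<subseteq> cball 0 1 \<and>
     (\<exists>U g. cball 0 1 \<subseteq> U \<and> smooth_on U g \<and> (\<forall>x\<in>cball 0 1. g x = f x))"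

definition vec2_coords :: "real^2 \<Rightarrow> real list" where
  "vec2_coords x = [x $ 1, x $ 2]"

end

(*
The universal machine is explicit: simulated tape, program and state occupy three tracks of one
tape, and its head never has to compare distant cells.

A configuration (q, L, R) becomes the point of the plane whose coordinates are the radix B
expansions of the stacks q # rev L and R (top digit first), and its code set is a box around that
point whose sides shrink with the lengths of the stacks. A machine step pops and pushes a bounded
number of digits, so it is affine on each of the finitely many regions fixed by the state and the
two top digits, and it maps boxes into boxes. The regions are a positive distance apart, hence
multiplying the affine maps by products of bump functions in one variable and adding up gives a
smooth map of the disk that performs one step per iteration.

Encoding and decoding push and pop digits by affine register operations, which takes linear time.
Conversely a machine has to read the last input symbol, or to write every output symbol, in order
to be correct, which takes linear time as well.
*)

theory Submission
  imports Defs
begin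

subsection \<open>Turing machines on two-way infinite tapes\<close>

text \<open>The constants serve two competing demands. Decoding is exact: the decoder must halt on
  the boxes and nowhere else, so the windows that accept different digits must be disjoint. The map
  is smooth, so its weights need room between the windows to fall to zero. A digit is accepted when
  the remainder lies in [-1/4, 1/2]; a bump is 1 there and vanishes outside the open interval from
  -3/8 to 5/8, whose integer translates are disjoint. The radix \<open>4 * max_digit + 4\<close>
  keeps all stacks, also after a push, inside these intervals.

  The state sits on the left stack so that each datum selecting an affine piece depends on a single
  coordinate. The map is then a finite sum of products of functions of one variable, a class closed
  under differentiation.

  Two requirements shape the machines. A universal machine receives the word \<open>w\<close> and
  returns the result without recoding, so the data symbols with empty tracks must be the symbols 0,
  1, 2, and no trace of the program may survive halting. A machine constant must be a computable
  real, that is, come with a Turing machine approximating it; formulas without constants avoid this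
  obligation.\<close>

definition fstep :: "('q \<Rightarrow> 's \<Rightarrow> 'q \<times> 's \<times> int) \<Rightarrow>
    'q \<Rightarrow> 'q \<times> (int \<Rightarrow> 's) \<times> int \<Rightarrow> 'q \<times>
    (int \<Rightarrow> 's) \<times> int" where
  "fstep \<delta> h c = (case c of (q, t, i) \<Rightarrow>
     if q = h then c else (case \<delta> q (t i) of (q', b, m) \<Rightarrow> (q', t(i := b), i +
         m)))"

definition cell :: "nat list \<Rightarrow> nat list \<Rightarrow> int \<Rightarrow> nat" where
  "cell L R k = (if 0 \<le> k + int (length L) \<and> k < int (length R)
     then (L @ R) ! nat (k + int (length L)) else 0)"

text \<open>The head position \<open>i\<close> is free because a list configuration fixes its tape
  only up to translation: a left move at the left end prepends a cell and shifts all
  indices.\<close>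

definition fconf :: "tm_conf \<Rightarrow> nat \<times> (int \<Rightarrow> nat) \<times> int
    \<Rightarrow> bool" where
  "fconf c d = (case c of (q, L, R) \<Rightarrow> case d of (q', t, i) \<Rightarrow> q' = q \<and>
      (\<forall>j. t j = cell L R (j - i)))"

lemma cell_head: "(case R of [] \<Rightarrow> 0 | x # _ \<Rightarrow> x) = cell L R 0"
  by (cases R) (auto simp: cell_def nth_append)

lemma cell_alt: "cell L R k =
   (if 0 \<le> k then (if nat k < length R then R ! nat k else 0)
    else if nat (- k) \<le> length L then L ! (length L - nat (- k)) else 0)"
proof -
  have "nat (k + int (length L)) = length L + nat k" if "0 \<le> k" using that by simp
  moreover have "nat (k + int (length L)) = length L - nat (- k)" if "\<not> 0 \<le> k" using that
      by simp
  ultimately show ?thesis by (auto simp: cell_def nth_append)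
qed

lemma cell_stay: "cell L (b # tl R) k = ((cell L R)(0 := b)) k"
  by (cases "k = 0"; cases R) (auto simp: cell_alt nth_Cons')

lemma cell_right: "cell (L @ [b]) R k = cell L (b # R) (k + 1)"
  by (auto simp: cell_def algebra_simps)

lemma cell_left: "cell L (c # R) (k::int) = cell (L @ [c]) R (k - 1)"
  by (auto simp: cell_def algebra_simps)

text \<open>Cells outside the lists count as blank, so a prepended blank is invisible. Hence the
  list model behaves like a two-way infinite tape.\<close>

lemma cell_left_blank: "cell [] (0 # R) (k::int) = cell [] R (k - 1)"
  by (auto simp: cell_def nth_Cons' nat_diff_distrib)

lemma fconf_step:
  assumes M: "wf_tm M" and c: "c \<in> tm_configs M" and r: "fconf c d"
  shows "fconf (tm_step M c) (fstep (tm_delta M) 0 d)" and "tm_step M c \<in> tm_configs M"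
proof -
  obtain q L R where c': "c = (q, L, R)" by (cases c)
  obtain t i where d: "d = (q, t, i)" and t: "\<And>j. t j = cell L R (j - i)"
    using r by (auto simp: fconf_def c' split: prod.splits)
  define a where "a = cell L R 0"
  have a_eq: "(case R of [] \<Rightarrow> 0 | x # _ \<Rightarrow> x) = a" by (simp add: a_def
      cell_head)
  have q: "q < tm_nq M" and LR: "set L \<subseteq> {..<tm_ns M}" "set R \<subseteq> {..<tm_ns M}"
    using c by (auto simp: c' tm_configs_def)
  have ns: "0 < tm_ns M" using M by (auto simp: wf_tm_def)
  have a: "a < tm_ns M" using LR ns by (cases R) (auto simp: a_eq[symmetric])
  obtain q' b m where \<delta>: "tm_delta M q a = (q', b, m)" by (cases "tm_delta M q a")
  have "case tm_delta M q a of (q', b, m) \<Rightarrow> q' < tm_nq M \<and> b < tm_ns M \<and> m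
      \<in> {-1, 0, 1}"
    by (rule M[unfolded wf_tm_def, THEN conjunct2, THEN conjunct2, rule_format, OF q a])
  then have ok: "q' < tm_nq M" "b < tm_ns M" "m \<in> {-1, 0, 1}"
    unfolding \<delta> by simp_all
  have tlR: "set (tl R) \<subseteq> {..<tm_ns M}" using LR by (cases R) auto
  have lastL: "L \<noteq> [] \<Longrightarrow> last L < tm_ns M" using LR by (auto dest:
      last_in_set)
  have blL: "set (butlast L) \<subseteq> {..<tm_ns M}" using LR by (auto dest: in_set_butlastD)
  have ti: "t i = a" by (simp add: t a_def)
  show "tm_step M c \<in> tm_configs M"
    using q LR ns a ok tlR lastL blL
    by (auto simp: tm_step_def c' a_eq Let_def \<delta> tm_configs_def)
  have upd: "(t(i := b)) j = cell L (b # tl R) (j - i)" for j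
    using cell_stay[of L b R "j - i"] by (auto simp: t)
  show "fconf (tm_step M c) (fstep (tm_delta M) 0 d)"
  proof (cases "q = 0")
    case True
    then show ?thesis using r by (simp add: tm_step_def c' fstep_def d)
  next
    case False
    have d': "fstep (tm_delta M) 0 d = (q', t(i := b), i + m)"
      using False by (simp add: fstep_def d ti \<delta>)
    obtain L' R' where c'': "tm_step M c = (q', L', R')"
      and LR': "\<And>k. cell L' R' k = cell L (b # tl R) (k + m)"
    proof -
      consider "m = 1" | "m = 0" | "m = -1" "L = []" | "m = -1" "L \<noteq> []" using ok by auto
      then show thesis
      proof cases
        case 1
        show thesis by (rule that[of "L @ [b]" "tl R"])
            (use False 1 in \<open>simp_all add: tm_step_def c' a_eq Let_def \<delta>
                cell_right\<close>)
      next
        case 2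
        show thesis by (rule that[of L "b # tl R"])
            (use False 2 in \<open>simp_all add: tm_step_def c' a_eq Let_def \<delta>\<close>)
      next
        case 3
        show thesis by (rule that[of "[]" "0 # b # tl R"])
            (use False 3 in \<open>simp_all add: tm_step_def c' a_eq Let_def \<delta>
                cell_left_blank\<close>)
      next
        case 4
        show thesis by (rule that[of "butlast L" "last L # b # tl R"])
            (use False 4 in \<open>simp_all add: tm_step_def c' a_eq Let_def \<delta>
                cell_left\<close>)
      qed
    qed
    show ?thesis unfolding c'' d' fconf_def
      using upd by (simp add: LR' algebra_simps del: fun_upd_apply)
  qed
qed

lemma fconf_run:
  assumes M: "wf_tm M" and c: "c \<in> tm_configs M" and r: "fconf c d"
  shows "fconf ((tm_step M ^^ n) c) ((fstep (tm_delta M) 0 ^^ n) d) \<and> (tm_step M ^^ n) c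
      \<in> tm_configs M"
  by (induction n) (auto simp: c r intro: fconf_step[OF M])

section \<open>Results of halted tapes, independent of the head position\<close>

definition strip :: "nat list \<Rightarrow> nat list" where
  "strip W = dropWhile (\<lambda>x. x = 0) (rev (dropWhile (\<lambda>x. x = 0) (rev W)))"

lemma dropWhile_replicate: "dropWhile (\<lambda>x. x = 0) (replicate a 0 @ W) = dropWhile
    (\<lambda>x. x = (0::nat)) W"
  by (induction a) auto

lemma strip_pad: "strip (replicate a 0 @ W @ replicate b 0) = strip W"
proof (cases "\<forall>x\<in>set W. x = 0")
  case True
  have "strip W' = []" if "set W' \<subseteq> insert 0 (set W)" for W'
  proof -
    have "dropWhile (\<lambda>x. x = 0) (rev W') = []"
      unfolding dropWhile_eq_Nil_conv using True that by auto
    then show ?thesis unfolding strip_def by (simp only: rev.simps dropWhile.simps)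
  qed
  moreover have "set (replicate a 0 @ W @ replicate b 0) \<subseteq> insert 0 (set W)" by auto
  ultimately show ?thesis by (metis subset_insertI)
next
  case False
  then obtain x where "x \<in> set (rev W)" "x \<noteq> 0" by auto
  then have "dropWhile (\<lambda>x. x = 0) (rev W @ replicate a 0) = dropWhile (\<lambda>x. x = 0)
      (rev W) @ replicate a 0"
    by (intro dropWhile_append1)
  then show ?thesis by (simp add: strip_def dropWhile_replicate)
qed

lemma strip_shift_nonneg:
  assumes eq: "\<And>j. cell [] W j = cell [] V (j + int o')"
  shows "strip W = strip V"
proof -
  \<comment> \<open>Both words are padded to this common length; \<open>o'\<close> blanks in front
    of \<open>W\<close> align it with \<open>V\<close>.\<close>
  define n where "n = o' + length W + length V"
  have "replicate o' 0 @ W @ replicate (n - o' - length W) 0 = replicate 0 0 @ V @ replicate (n -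
      length V) 0"
  proof (rule nth_equalityI)
    show "length (replicate o' 0 @ W @ replicate (n - o' - length W) 0) =
        length (replicate 0 0 @ V @ replicate (n - length V) 0)"
      by (simp add: n_def)
    fix i assume i: "i < length (replicate o' 0 @ W @ replicate (n - o' - length W) 0)"
    have "(replicate o' 0 @ W @ replicate (n - o' - length W) 0) ! i = cell [] W (int i - int o')"
      using i by (auto simp: nth_append cell_def n_def nat_diff_distrib)
    also have "\<dots> = cell [] V (int i)" by (simp add: eq)
    also have "\<dots> = (replicate 0 0 @ V @ replicate (n - length V) 0) ! i"
      using i by (auto simp: nth_append cell_def n_def)
    finally show "(replicate o' 0 @ W @ replicate (n - o' - length W) 0) ! i =
      (replicate 0 0 @ V @ replicate (n - length V) 0) ! i" .
  qed
  then show ?thesis by (metis strip_pad)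
qed

lemma strip_shift:
  assumes eq: "\<And>j. cell [] W j = cell [] V (j + z)"
  shows "strip W = strip V"
proof (cases "z \<ge> 0")
  case True
  then show ?thesis using eq strip_shift_nonneg[of W V "nat z"] by simp
next
  case False
  have "cell [] V j = cell [] W (j + int (nat (- z)))" for j
    using eq[of "j - z"] False by simp
  then show ?thesis using strip_shift_nonneg[of V W "nat (- z)"] by simp
qed

text \<open>Blanks are trimmed at both ends, so translated tapes have the same result. The universal
  machine may therefore halt with its head anywhere.\<close>

lemma tm_result_fconf:
  assumes "fconf c (q, t, i)" "fconf c' (q', t, i')"
  shows "tm_result c = tm_result c'"
proof -
  obtain L R L' R' where c: "c = (q, L, R)" "c' = (q', L', R')"
    using assms by (auto simp: fconf_def split: prod.splits)
  have *: "cell L R k = cell [] (L @ R) (k + int (length L))" for L R k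
    by (auto simp: cell_def)
  have "cell [] (L @ R) j = cell [] (L' @ R') (j + (i - int (length L) - i' + int (length L')))"
      for j
  proof -
    have "cell [] (L @ R) j = cell L R (j - int (length L))" by (simp add: *[of L R])
    also have "\<dots> = t (j - int (length L) + i)" using assms(1) by (simp add: fconf_def c)
    also have "\<dots> = cell L' R' (j - int (length L) + i - i')" using assms(2) by (simp add:
        fconf_def c)
    also have "\<dots> = cell [] (L' @ R') (j + (i - int (length L) - i' + int (length L')))"
      by (simp add: *[of L' R'] algebra_simps)
    finally show ?thesis .
  qed
  from strip_shift[OF this] show ?thesis by (simp add: tm_result_def c strip_def)
qed

text \<open>Prescribing the first numbers puts the halting and start states at 0 and 1 and the three
  data symbols at 0, 1, 2, as the definition of universality demands.\<close>

lemma ex_numbering: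
  assumes "distinct (xs :: 'a::finite list)"
  shows "\<exists>h :: 'a \<Rightarrow> nat. inj h \<and> range h = {..<CARD('a)} \<and>
      (\<forall>i<length xs. h (xs ! i) = i)"
proof -
  obtain ys where ys: "set ys = - set xs" "distinct ys" using finite_distinct_list[of "- set xs"]
      by auto
  define zs where "zs = xs @ ys"
  have zs: "distinct zs" "set zs = UNIV" using assms ys by (auto simp: zs_def)
  have len: "length zs = CARD('a)" using zs distinct_card by fastforce
  have b: "bij_betw (nth zs) {..<length zs} UNIV" using bij_betw_nth[OF zs(1)] zs(2) by blast
  define h where "h = inv_into {..<length zs} (nth zs)"
  have bh: "bij_betw h UNIV {..<length zs}" unfolding h_def using b by (rule bij_betw_inv_into)
  have "h (xs ! i) = i" if "i < length xs" for i
  proof -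
    have "xs ! i = zs ! i" "i < length zs" using that by (auto simp: zs_def nth_append)
    then show ?thesis unfolding h_def using b by (simp add: bij_betw_def inv_into_f_f)
  qed
  then show ?thesis using bh len by (auto simp: bij_betw_def)
qed

definition num_tm :: "('q \<Rightarrow> nat) \<Rightarrow> ('s \<Rightarrow> nat) \<Rightarrow>
    ('q::finite \<Rightarrow> 's::finite \<Rightarrow> 'q \<times> 's \<times> int) \<Rightarrow>
    tm" where
  "num_tm hq hs \<delta> = \<lparr>tm_nq = CARD('q), tm_ns = CARD('s),
     tm_delta = (\<lambda>q a. case \<delta> (inv hq q) (inv hs a) of (q', b, m) \<Rightarrow> (hq
         q', hs b, m))\<rparr>"

lemma num_tm_step:
  assumes "inj hq" "inj hs" "hq h = 0"
  shows "fstep (tm_delta (num_tm hq hs \<delta>)) 0 (hq q, hs \<circ> t, i) =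
    (case fstep \<delta> h (q, t, i) of (q', t', i') \<Rightarrow> (hq q', hs \<circ> t', i'))"
proof -
  have z: "hq q = 0 \<longleftrightarrow> q = h" using assms by (metis inj_eq)
  obtain q' b m where \<delta>: "\<delta> q (t i) = (q', b, m)" by (cases "\<delta> q (t i)")
  show ?thesis using assms by (auto simp: fstep_def z num_tm_def \<delta> inv_f_f fun_eq_iff)
qed

lemma num_tm_run:
  assumes "inj hq" "inj hs" "hq h = 0"
  shows "(fstep (tm_delta (num_tm hq hs \<delta>)) 0 ^^ n) (hq q, hs \<circ> t, i) =
    (case (fstep \<delta> h ^^ n) (q, t, i) of (q', t', i') \<Rightarrow> (hq q', hs \<circ> t',
        i'))"
  by (induction n) (simp_all add: num_tm_step[OF assms, unfolded comp_def] comp_def split: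
      prod.splits)

subsection \<open>The universal machine\<close>

text \<open>A cell carries a symbol of the simulated tape, a program symbol and a mark. The
    program is a
  list of entries Key a, One (q times), Val b m or Hlt b, One (q' times), one for each transition
  (q, a) to (q', b, m). It occupies the cells immediately to the left of the simulated head and is
  shifted along with it. The current state q is stored in unary, as a run of q + 1 marks.

  A cycle reads the symbol a under the head (GoR, GoL), slides the marks along the program until
  they cover exactly the key part of an entry, which is a comparison local to each cell (Cmp0, Cmp,
  Back), erases them (Er), marks the value part of the entry in place (Fw, Cp), writes b (GoH),
  shifts the program by m (LW, ShL, ShR) and slides the marks back to the program start (Fnd, Fnd2,
  SL, SR, SE). On Hlt b the symbol b is written and the program is erased (HGo, HEr).\<close>

datatype dat = D0 | D1 | D2
datatype mv = MvL | MvS | MvR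
datatype psym = Blank | One | Key dat | Val dat mv | Hlt dat
datatype ust = Halt | GoR | GoL dat | Cmp0 dat | Cmp dat bool | Back dat | Er dat mv | Fw dat mv
  | Cp dat mv | GoH dat mv | LW | ShL "psym \<times> bool" | ShR "psym \<times> bool" | Fnd | Fnd2
  | SL | SR | SE | HGo dat | HEr

lemma UNIV_dat: "UNIV = {D0, D1, D2}" using dat.exhaust by auto
lemma UNIV_mv: "UNIV = {MvL, MvS, MvR}" using mv.exhaust by auto

instance dat :: finite by standard (simp add: UNIV_dat)
instance mv :: finite by standard (simp add: UNIV_mv)

instance psym :: finite
proof
  have "UNIV \<subseteq> {Blank, One} \<union> range Key \<union> range (case_prod Val) \<union>
      range Hlt"
  proof
    fix x show "x \<in> {Blank, One} \<union> range Key \<union> range (case_prod Val) \<union>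
        range Hlt" by (cases x) auto
  qed
  then show "finite (UNIV :: psym set)" by (rule finite_subset) simp
qed

instance ust :: finite
proof
  have "(UNIV :: ust set) \<subseteq> {Halt, GoR, LW, Fnd, Fnd2, SL, SR, SE, HEr} \<union> range
      GoL \<union> range Cmp0 \<union>
      range (case_prod Cmp) \<union> range Back \<union> range (case_prod Er) \<union> range
          (case_prod Fw) \<union>
      range (case_prod Cp) \<union> range (case_prod GoH) \<union> range ShL \<union> range ShR
          \<union> range HGo" (is "_ \<subseteq> ?S")
  proof
    fix x show "x \<in> ?S" by (cases x) auto
  qed
  then show "finite (UNIV :: ust set)" by (rule finite_subset) simp
qed

fun udelta :: "ust \<Rightarrow> dat \<times> psym \<times> bool \<Rightarrow> ust \<times> (dat
    \<times> psym \<times> bool) \<times> int" where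
  "udelta Halt x = (Halt, x, 0)"
| "udelta GoR (d, P, k) = (if P = Blank then (GoL d, (d, P, k), -1) else (GoR, (d, P, k), 1))"
| "udelta (GoL a) (d, P, k) = (if P = Blank then (Cmp0 a, (d, P, k), 1) else (GoL a, (d, P, k),
    -1))"
| "udelta (Cmp0 a) (d, P, k) = (Cmp a (P = Key a), (d, P, False), 1)"
| "udelta (Cmp a ok) (d, P, k) =
    (if k then (Cmp a (ok \<and> P = One), (d, P, k), 1)
     else case P of
         Val b m \<Rightarrow> if ok then (Er b m, (d, P, k), -1) else (Back a, (d, P, True), -1)
       | Hlt b \<Rightarrow> if ok then (HGo b, (d, P, k), 1) else (Back a, (d, P, True), -1)
       | _ \<Rightarrow> (Back a, (d, P, True), -1))"
| "udelta (Back a) (d, P, k) = (if k then (Back a, (d, P, k), -1) else (Cmp0 a, (d, P, k), 1))"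
| "udelta (Er b m) (d, P, k) = (if k then (Er b m, (d, P, False), -1) else (Fw b m, (d, P, k), 1))"
| "udelta (Fw b m) (d, P, k) = (if P = One then (Fw b m, (d, P, k), 1) else (Cp b m, (d, P, True),
    1))"
| "udelta (Cp b m) (d, P, k) = (if P = One then (Cp b m, (d, P, True), 1) else (GoH b m, (d, P,
    k), 0))"
| "udelta (GoH b m) (d, P, k) = (if P = Blank
     then ((case m of MvL \<Rightarrow> ShL (Blank, False) | MvS \<Rightarrow> Fnd | MvR
         \<Rightarrow> LW), (b, P, k), -1)
     else (GoH b m, (d, P, k), 1))"
| "udelta LW (d, P, k) = (if P = Blank then (ShR (P, k), (d, P, k), 1) else (LW, (d, P, k), -1))"
| "udelta (ShL c) (d, P, k) = (if P = Blank then (Fnd2, (d, c), 0) else (ShL (P, k), (d, c), -1))"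
| "udelta (ShR c) (d, P, k) = (if P = Blank then (Fnd, (d, c), 0) else (ShR (P, k), (d, c), 1))"
| "udelta Fnd (d, P, k) = (if k then (SL, (d, P, k), -1) else (Fnd, (d, P, k), -1))"
| "udelta Fnd2 (d, P, k) = (if k then (SL, (d, P, k), -1) else (Fnd2, (d, P, k), 1))"
| "udelta SL (d, P, k) = (if k then (SL, (d, P, k), -1)
     else if P = Blank then (GoR, (d, P, k), 1) else (SR, (d, P, True), 1))"
| "udelta SR (d, P, k) = (if k then (SR, (d, P, k), 1) else (SE, (d, P, k), -1))"
| "udelta SE (d, P, k) = (SL, (d, P, False), -1)"
| "udelta (HGo b) (d, P, k) = (if P = Blank then (HEr, (b, P, k), -1) else (HGo b, (d, P, k), 1))"
| "udelta HEr (d, P, k) = (if P = Blank then (Halt, (d, P, k), 0) else (HEr, (d, Blank, False),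
    -1))"

section \<open>Runs and sweeps of the universal machine\<close>

definition ureach :: "ust \<times> (int \<Rightarrow> dat \<times> psym \<times> bool) \<times>
    int \<Rightarrow> ust \<times> (int \<Rightarrow> dat \<times> psym \<times> bool) \<times>
    int \<Rightarrow> bool" where
  "ureach c c' \<longleftrightarrow> (\<exists>n. (fstep udelta Halt ^^ n) c = c')"

definition layers :: "(int \<Rightarrow> dat) \<Rightarrow> (int \<Rightarrow> psym \<times> bool)
    \<Rightarrow> int \<Rightarrow> dat \<times> psym \<times> bool" where
  "layers t u = (\<lambda>i. (t i, u i))"

text \<open>State q is the case \<open>k = q + 1\<close>: the additional mark covers the
  \<open>Key\<close> symbol of an entry and keeps the run nonempty, so that it can be found
  again.\<close>

definition ctrl_track :: "(int \<Rightarrow> psym) \<Rightarrow> int \<Rightarrow> int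
    \<Rightarrow> int \<Rightarrow> psym \<times> bool" where
  "ctrl_track P m k = (\<lambda>i. (P i, m \<le> i \<and> i < m + k))"

lemma ureach_refl: "ureach c c"
  unfolding ureach_def by (rule exI[of _ 0]) simp

lemma ureach_trans [trans]:
  assumes "ureach a b" "ureach b c"
  shows "ureach a c"
proof -
  obtain n m where "(fstep udelta Halt ^^ n) a = b" "(fstep udelta Halt ^^ m) b = c"
    using assms unfolding ureach_def by blast
  then have "(fstep udelta Halt ^^ (m + n)) a = c" by (simp add: funpow_add)
  then show ?thesis unfolding ureach_def by blast
qed

lemma ureach_step:
  assumes "ureach (fstep udelta Halt c) c'"
  shows "ureach c c'"
proof -
  obtain n where "(fstep udelta Halt ^^ n) (fstep udelta Halt c) = c'" using assms unfolding
      ureach_def by blast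
  then have "(fstep udelta Halt ^^ Suc n) c = c'" by (simp add: funpow_swap1)
  then show ?thesis unfolding ureach_def by blast
qed

lemma ustep:
  assumes "q \<noteq> Halt" "udelta q (t i, u i) = (q', (t i, x), m)" "u(i := x) = w" "i + m = e"
  shows "ureach (q, layers t u, i) (q', layers t w, e)"
proof -
  have "fstep udelta Halt (q, layers t u, i) = (q', layers t w, e)"
    using assms(1,2) unfolding assms(3,4)[symmetric] by (auto simp: fstep_def layers_def fun_eq_iff)
  then show ?thesis using ureach_step ureach_refl by simp
qed

lemma ustep_write:
  assumes "q \<noteq> Halt" "udelta q (t i, u i) = (q', (b, u i), m)" "i + m = e"
  shows "ureach (q, layers t u, i) (q', layers (t(i := b)) u, e)"
proof -
  have "fstep udelta Halt (q, layers t u, i) = (q', layers (t(i := b)) u, e)"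
    using assms by (auto simp: fstep_def layers_def fun_eq_iff)
  then show ?thesis using ureach_step ureach_refl by simp
qed

text \<open>The state \<open>s j\<close> may vary with the cell. This covers scans that accumulate a
  condition (\<open>Cmp\<close>) as well as shifts, where the state carries the content of the
  preceding cell (\<open>ShR\<close>).\<close>

lemma usweep_right:
  assumes step: "\<And>j. i \<le> j \<Longrightarrow> j < e \<Longrightarrow> s j \<noteq> Halt
      \<and> udelta (s j) (t j, u j) = (s (j + 1), (t j, v j), 1)"
    and ends: "i \<le> e" "s i = a" "s e = b" and w: "(\<lambda>j. if i \<le> j \<and> j < e then
        v j else u j) = w"
  shows "ureach (a, layers t u, i) (b, layers t w, e)"
proof -
  have "ureach (s i, layers t u, i) (s j, layers t (\<lambda>l. if i \<le> l \<and> l < j then v l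
      else u l), j)" if "i \<le> j" "j \<le> e" for j
    using that
  proof (induction j rule: int_ge_induct)
    case base
    have "(\<lambda>l. if i \<le> l \<and> l < i then v l else u l) = u" by (rule ext) auto
    then show ?case by (simp add: ureach_refl)
  next
    case (step j)
    have "ureach (s i, layers t u, i) (s j, layers t (\<lambda>l. if i \<le> l \<and> l < j then v
        l else u l), j)"
      using step by simp
    also have "ureach \<dots> (s (j + 1), layers t (\<lambda>l. if i \<le> l \<and> l < j + 1 then
        v l else u l), j + 1)"
      by (rule ustep[where x = "v j" and m = 1])
        (use step assms(1)[of j] in \<open>auto simp: fun_eq_iff\<close>)
    finally show ?case .
  qed
  from this[of e] show ?thesis using ends w by simp
qed

lemma usweep_left:
  assumes step: "\<And>j. e < j \<Longrightarrow> j \<le> i \<Longrightarrow> s j \<noteq> Halt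
      \<and> udelta (s j) (t j, u j) = (s (j - 1), (t j, v j), -1)"
    and ends: "e \<le> i" "s i = a" "s e = b" and w: "(\<lambda>j. if e < j \<and> j \<le> i then
        v j else u j) = w"
  shows "ureach (a, layers t u, i) (b, layers t w, e)"
proof -
  have "ureach (s i, layers t u, i) (s j, layers t (\<lambda>l. if j < l \<and> l \<le> i then v l
      else u l), j)" if "j \<le> i" "e \<le> j" for j
    using that
  proof (induction j rule: int_le_induct)
    case base
    have "(\<lambda>l. if i < l \<and> l \<le> i then v l else u l) = u" by (rule ext) auto
    then show ?case by (simp add: ureach_refl)
  next
    case (step j)
    have "ureach (s i, layers t u, i) (s j, layers t (\<lambda>l. if j < l \<and> l \<le> i then v
        l else u l), j)"
      using step by simp
    also have "ureach \<dots> (s (j - 1), layers t (\<lambda>l. if j - 1 < l \<and> l \<le> i then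
        v l else u l), j - 1)"
      by (rule ustep[where x = "v j" and m = "-1"])
        (use step assms(1)[of j] in \<open>auto simp: fun_eq_iff\<close>)
    finally show ?case .
  qed
  from this[of e] show ?thesis using ends w by simp
qed

section \<open>One simulated step: comparing, copying, shifting, rewinding\<close>

fun isval :: "psym \<Rightarrow> bool" where
  "isval (Val b m) = True" | "isval (Hlt b) = True" | "isval _ = False"

text \<open>Removing the first mark on the way is half of sliding the run by one cell. On a
  mismatch, \<open>slide_fail\<close> supplies the other half, a new mark at
  \<open>m + k\<close>.\<close>

lemma compare_run:
  assumes k: "k \<ge> 1"
  shows "ureach (Cmp0 a, layers t (ctrl_track P m k), m)
    (Cmp a (P m = Key a \<and> (\<forall>l. m < l \<and> l < m + k \<longrightarrow> P l = One)),
        layers t (ctrl_track P (m + 1) (k - 1)), m + k)"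
proof -
  have "ureach (Cmp0 a, layers t (ctrl_track P m k), m) (Cmp a (P m = Key a), layers t (ctrl_track
      P (m + 1) (k - 1)), m + 1)"
    by (rule ustep) (auto simp: ctrl_track_def fun_eq_iff)
  also have "ureach \<dots> (Cmp a (P m = Key a \<and> (\<forall>l. m < l \<and> l < m + k
      \<longrightarrow> P l = One)),
      layers t (ctrl_track P (m + 1) (k - 1)), m + k)"
  proof (rule usweep_right[where s = "\<lambda>j. Cmp a (P m = Key a \<and> (\<forall>l. m < l
      \<and> l < j \<longrightarrow> P l = One))"
        and v = "ctrl_track P (m + 1) (k - 1)"])
    fix j assume j: "m + 1 \<le> j" "j < m + k"
    have "(\<forall>l. m < l \<and> l < j + 1 \<longrightarrow> P l = One) \<longleftrightarrow>
        (\<forall>l. m < l \<and> l < j \<longrightarrow> P l = One) \<and> P j = One"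
      using j by (smt (verit))
    then show "Cmp a (P m = Key a \<and> (\<forall>l. m < l \<and> l < j \<longrightarrow> P l =
        One)) \<noteq> Halt \<and>
         udelta (Cmp a (P m = Key a \<and> (\<forall>l. m < l \<and> l < j \<longrightarrow> P l =
             One))) (t j, ctrl_track P (m + 1) (k - 1) j) =
         (Cmp a (P m = Key a \<and> (\<forall>l. m < l \<and> l < j + 1 \<longrightarrow> P l =
             One)), (t j, ctrl_track P (m + 1) (k - 1) j), 1)"
      using j by (auto simp: ctrl_track_def)
  qed (use k in auto)
  finally show ?thesis .
qed

text \<open>The cell behind the run must be tested too: the key of a larger state with the same
  symbol begins with the same \<open>k\<close> program symbols.\<close>

lemma slide_fail:
  assumes k: "k \<ge> 1" and no: "\<not> (P m = Key a \<and> (\<forall>l. m < l \<and> l < m + k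
      \<longrightarrow> P l = One) \<and> isval (P (m + k)))"
  shows "ureach (Cmp0 a, layers t (ctrl_track P m k), m) (Cmp0 a, layers t (ctrl_track P (m + 1)
      k), m + 1)"
proof -
  note compare_run[OF k, of a t P m]
  also have "ureach (Cmp a (P m = Key a \<and> (\<forall>l. m < l \<and> l < m + k
      \<longrightarrow> P l = One)), layers t (ctrl_track P (m + 1) (k - 1)), m + k)
      (Back a, layers t (ctrl_track P (m + 1) k), m + k - 1)"
    by (rule ustep[where x = "(P (m + k), True)" and m = "-1"])
      (use k no in \<open>auto simp: ctrl_track_def fun_eq_iff split: psym.split\<close>)
  also have "ureach \<dots> (Back a, layers t (ctrl_track P (m + 1) k), m)"
    by (rule usweep_left[where s = "\<lambda>_. Back a" and v = "ctrl_track P (m + 1) k"])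
      (use k in \<open>auto simp: ctrl_track_def fun_eq_iff\<close>)
  also have "ureach \<dots> (Cmp0 a, layers t (ctrl_track P (m + 1) k), m + 1)"
    by (rule ustep) (auto simp: ctrl_track_def fun_eq_iff)
  finally show ?thesis .
qed

lemma slide_search:
  assumes k: "k \<ge> 1"
    and no: "\<And>m. p \<le> m \<Longrightarrow> m < e \<Longrightarrow>
      \<not> (P m = Key a \<and> (\<forall>l. m < l \<and> l < m + k \<longrightarrow> P l = One)
          \<and> isval (P (m + k)))"
    and e: "p \<le> e"
  shows "ureach (Cmp0 a, layers t (ctrl_track P p k), p) (Cmp0 a, layers t (ctrl_track P e k), e)"
proof -
  have "ureach (Cmp0 a, layers t (ctrl_track P p k), p) (Cmp0 a, layers t (ctrl_track P j k), j)"
      if "p \<le> j" "j \<le> e" for j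
    using that
  proof (induction j rule: int_ge_induct)
    case (step j)
    then have "ureach (Cmp0 a, layers t (ctrl_track P p k), p) (Cmp0 a, layers t (ctrl_track P j
        k), j)" by simp
    also have "ureach \<dots> (Cmp0 a, layers t (ctrl_track P (j + 1) k), j + 1)"
      by (rule slide_fail) (use step k no in auto)
    finally show ?case .
  qed (rule ureach_refl)
  from this[of e] e show ?thesis by simp
qed

text \<open>Induction on the distance to the program start. One round adds a mark in front and
  removes the last one, which moves a run of any length with finitely many states.\<close>

lemma slide_back:
  assumes P: "P (p - 1) = Blank" "\<And>i. p \<le> i \<Longrightarrow> i < p + N \<Longrightarrow>
      P i \<noteq> Blank"
    and k: "k \<ge> 1" and m: "p \<le> m" "m \<le> p + N"
  shows "ureach (SL, layers t (ctrl_track P m k), m - 1) (GoR, layers t (ctrl_track P p k), p)"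
  using m
proof (induction m rule: int_ge_induct)
  case base
  show ?case
    by (rule ustep) (use P in \<open>auto simp: ctrl_track_def fun_eq_iff\<close>)
next
  case (step m)
  have "ureach (SL, layers t (ctrl_track P (m + 1) k), m + 1 - 1) (SR, layers t (ctrl_track P m (k
      + 1)), m + 1)"
    by (rule ustep[where x = "(P m, True)" and m = 1])
      (use P(2)[of m] step k in \<open>auto simp: ctrl_track_def fun_eq_iff\<close>)
  also have "ureach \<dots> (SR, layers t (ctrl_track P m (k + 1)), m + k + 1)"
    by (rule usweep_right[where s = "\<lambda>_. SR" and v = "ctrl_track P m (k + 1)"])
      (use k in \<open>auto simp: ctrl_track_def fun_eq_iff\<close>)
  also have "ureach \<dots> (SE, layers t (ctrl_track P m (k + 1)), m + k)"
    by (rule ustep) (auto simp: ctrl_track_def fun_eq_iff)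
  also have "ureach \<dots> (SL, layers t (ctrl_track P m k), m + k - 1)"
    by (rule ustep) (use k in \<open>auto simp: ctrl_track_def fun_eq_iff\<close>)
  also have "ureach \<dots> (SL, layers t (ctrl_track P m k), m - 1)"
    by (rule usweep_left[where s = "\<lambda>_. SL" and v = "ctrl_track P m k"])
      (use k in \<open>auto simp: ctrl_track_def fun_eq_iff\<close>)
  also have "ureach \<dots> (GoR, layers t (ctrl_track P p k), p)" using step by simp
  finally show ?case .
qed

fun int_of_mv :: "mv \<Rightarrow> int" where
  "int_of_mv MvL = -1" | "int_of_mv MvS = 0" | "int_of_mv MvR = 1"

text \<open>One step is already taken on the left-hand side, so that every simulated step visibly
  costs a step; divergence is transferred this way.\<close>

lemma ustart:
  assumes nb: "\<And>i. P i = Blank \<longleftrightarrow> \<not> (p \<le> i \<and> i < h)" and ph: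
      "p < h"
    and k: "k \<ge> 1" and e: "p \<le> e"
    and match: "P e = Key (t h)" "\<And>l. e < l \<Longrightarrow> l < e + k \<Longrightarrow> P l
        = One"
    and no: "\<And>m. p \<le> m \<Longrightarrow> m < e \<Longrightarrow>
      \<not> (P m = Key (t h) \<and> (\<forall>l. m < l \<and> l < m + k \<longrightarrow> P l =
          One) \<and> isval (P (m + k)))"
  shows "ureach (fstep udelta Halt (GoR, layers t (ctrl_track P p k), p)) (Cmp (t h) True, layers
      t (ctrl_track P (e + 1) (k - 1)), e + k)"
proof -
  let ?u = "ctrl_track P p k"
  have "P p \<noteq> Blank" using nb ph by simp
  then have "fstep udelta Halt (GoR, layers t ?u, p) = (GoR, layers t ?u, p + 1)"
    by (auto simp: fstep_def layers_def ctrl_track_def fun_eq_iff)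
  also have "ureach \<dots> (GoR, layers t ?u, h)"
    by (rule usweep_right[where s = "\<lambda>_. GoR" and v = ?u]) (use nb ph in \<open>auto simp:
        ctrl_track_def\<close>)
  also have "ureach \<dots> (GoL (t h), layers t ?u, h - 1)"
    by (rule ustep) (use nb in \<open>auto simp: ctrl_track_def fun_eq_iff\<close>)
  also have "ureach \<dots> (GoL (t h), layers t ?u, p - 1)"
    by (rule usweep_left[where s = "\<lambda>_. GoL (t h)" and v = ?u]) (use nb ph in \<open>auto
        simp: ctrl_track_def\<close>)
  also have "ureach \<dots> (Cmp0 (t h), layers t ?u, p)"
    by (rule ustep) (use nb in \<open>auto simp: ctrl_track_def fun_eq_iff\<close>)
  also have "ureach \<dots> (Cmp0 (t h), layers t (ctrl_track P e k), e)"
    by (rule slide_search) (use k no e in auto)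
  also note compare_run[OF k, of "t h" t P e]
  also have "(P e = Key (t h) \<and> (\<forall>l. e < l \<and> l < e + k \<longrightarrow> P l =
      One)) = True"
    using match by auto
  finally show ?thesis .
qed

text \<open>The head move of a halting transition is dropped, since results do not depend on the
  head. After the erasure only the simulated tape is left.\<close>

lemma uhalt:
  assumes nb: "\<And>i. P i = Blank \<longleftrightarrow> \<not> (p \<le> i \<and> i < h)"
    and k: "k \<ge> 1" and e: "p \<le> e" and V: "P (e + k) = Hlt b"
  shows "ureach (Cmp a True, layers t (ctrl_track P (e + 1) (k - 1)), e + k) (Halt, layers (t(h :=
      b)) (\<lambda>_. (Blank, False)), p - 1)"
proof -
  let ?u = "ctrl_track P (e + 1) (k - 1)"
  have eh: "e + k < h" using nb[of "e + k"] V by auto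
  have "ureach (Cmp a True, layers t ?u, e + k) (HGo b, layers t ?u, e + k + 1)"
    by (rule ustep) (use V in \<open>auto simp: ctrl_track_def fun_eq_iff\<close>)
  also have "ureach \<dots> (HGo b, layers t ?u, h)"
    by (rule usweep_right[where s = "\<lambda>_. HGo b" and v = ?u]) (use nb eh e k in \<open>auto
        simp: ctrl_track_def\<close>)
  also have "ureach \<dots> (HEr, layers (t(h := b)) ?u, h - 1)"
    by (rule ustep_write) (use nb in \<open>auto simp: ctrl_track_def\<close>)
  also have "ureach \<dots> (HEr, layers (t(h := b)) (\<lambda>_. (Blank, False)), p - 1)"
    by (rule usweep_left[where s = "\<lambda>_. HEr" and v = "\<lambda>_. (Blank, False)"])
      (use nb eh e k in \<open>auto simp: ctrl_track_def fun_eq_iff\<close>)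
  also have "ureach \<dots> (Halt, layers (t(h := b)) (\<lambda>_. (Blank, False)), p - 1)"
    by (rule ustep) auto
  finally show ?thesis .
qed

text \<open>The control state of a fixed machine cannot hold the new state q', which is unbounded.
  Instead the run is recreated over the value symbol and the \<open>One\<close>s behind it, which
  gives \<open>k' = q' + 1\<close> marks.\<close>

lemma ucopy:
  assumes nb: "\<And>i. P i = Blank \<longleftrightarrow> \<not> (p \<le> i \<and> i < h)"
    and k: "k \<ge> 1" "k' \<ge> 1" and e: "p \<le> e" "P e = Key a" and V: "P (e + k) = Val b mv"
    and run: "\<And>l. e < l \<Longrightarrow> l < e + k \<Longrightarrow> P l = One"
    and run': "\<And>l. e + k < l \<Longrightarrow> l < e + k + k' \<Longrightarrow> P l = One" "P
        (e + k + k') \<noteq> One"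
  shows "ureach (Cmp a True, layers t (ctrl_track P (e + 1) (k - 1)), e + k)
    ((case mv of MvL \<Rightarrow> ShL (Blank, False) | MvS \<Rightarrow> Fnd | MvR \<Rightarrow>
        LW),
      layers (t(h := b)) (ctrl_track P (e + k) k'), h - 1)" and "e + k + k' \<le> h"
proof -
  have "P (e + k + k' - 1) \<noteq> Blank"
    using V run'(1)[of "e + k + k' - 1"] k by (cases "k' = 1") auto
  then show eh: "e + k + k' \<le> h" using nb[of "e + k + k' - 1"] by auto
  let ?u = "ctrl_track P (e + 1) (k - 1)"
  let ?w = "ctrl_track P (e + k) k'"
  have "ureach (Cmp a True, layers t ?u, e + k) (Er b mv, layers t ?u, e + k - 1)"
    by (rule ustep) (use V in \<open>auto simp: ctrl_track_def fun_eq_iff\<close>)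
  also have "ureach \<dots> (Er b mv, layers t (ctrl_track P (e + k) 0), e)"
    by (rule usweep_left[where s = "\<lambda>_. Er b mv" and v = "ctrl_track P (e + k) 0"])
      (use k in \<open>auto simp: ctrl_track_def fun_eq_iff\<close>)
  also have "ureach \<dots> (Fw b mv, layers t (ctrl_track P (e + k) 0), e + 1)"
    by (rule ustep) (auto simp: ctrl_track_def fun_eq_iff)
  also have "ureach \<dots> (Fw b mv, layers t (ctrl_track P (e + k) 0), e + k)"
    by (rule usweep_right[where s = "\<lambda>_. Fw b mv" and v = "ctrl_track P (e + k) 0"])
      (use k run in \<open>auto simp: ctrl_track_def fun_eq_iff\<close>)
  also have "ureach \<dots> (Cp b mv, layers t (ctrl_track P (e + k) 1), e + k + 1)"
    by (rule ustep) (use V in \<open>auto simp: ctrl_track_def fun_eq_iff\<close>)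
  also have "ureach \<dots> (Cp b mv, layers t ?w, e + k + k')"
    by (rule usweep_right[where s = "\<lambda>_. Cp b mv" and v = "ctrl_track P (e + k) k'"])
      (use k run' in \<open>auto simp: ctrl_track_def fun_eq_iff\<close>)
  also have "ureach \<dots> (GoH b mv, layers t ?w, e + k + k')"
    by (rule ustep) (use run' in \<open>auto simp: ctrl_track_def fun_eq_iff\<close>)
  also have "ureach \<dots> (GoH b mv, layers t ?w, h)"
    by (rule usweep_right[where s = "\<lambda>_. GoH b mv" and v = ?w])
      (use nb eh e k in \<open>auto simp: ctrl_track_def\<close>)
  also have "ureach \<dots> ((case mv of MvL \<Rightarrow> ShL (Blank, False) | MvS \<Rightarrow>
      Fnd | MvR \<Rightarrow> LW),
      layers (t(h := b)) ?w, h - 1)"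
    by (rule ustep_write) (use nb in \<open>auto simp: ctrl_track_def\<close>)
  finally show "ureach (Cmp a True, layers t ?u, e + k) \<dots>" .
qed

lemma urewind:
  assumes nb: "\<And>i. P i = Blank \<longleftrightarrow> \<not> (p \<le> i \<and> i < h)"
    and k: "k \<ge> 1" and m: "p \<le> m" "m + k \<le> h" and j: "m - 1 \<le> j" "j < m + k"
  shows "ureach (SL, layers t (ctrl_track P m k), j) (GoR, layers t (ctrl_track P p k), p)"
proof -
  have "ureach (SL, layers t (ctrl_track P m k), j) (SL, layers t (ctrl_track P m k), m - 1)"
    by (rule usweep_left[where s = "\<lambda>_. SL" and v = "ctrl_track P m k"])
      (use k j in \<open>auto simp: ctrl_track_def fun_eq_iff\<close>)
  also have "ureach \<dots> (GoR, layers t (ctrl_track P p k), p)"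
    by (rule slide_back[where N = "h - p"]) (use assms in auto)
  finally show ?thesis .
qed

lemma urewind_right:
  assumes nb: "\<And>i. P i = Blank \<longleftrightarrow> \<not> (p \<le> i \<and> i < h)"
    and k: "k \<ge> 1" and m: "p \<le> m" "m + k \<le> h" and j: "m + k - 1 \<le> j"
  shows "ureach (Fnd, layers t (ctrl_track P m k), j) (GoR, layers t (ctrl_track P p k), p)"
proof -
  have "ureach (Fnd, layers t (ctrl_track P m k), j) (Fnd, layers t (ctrl_track P m k), m + k - 1)"
    by (rule usweep_left[where s = "\<lambda>_. Fnd" and v = "ctrl_track P m k"])
      (use k j in \<open>auto simp: ctrl_track_def fun_eq_iff\<close>)
  also have "ureach \<dots> (SL, layers t (ctrl_track P m k), m + k - 2)"
    by (rule ustep) (use k in \<open>auto simp: ctrl_track_def fun_eq_iff\<close>)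
  also have "ureach \<dots> (GoR, layers t (ctrl_track P p k), p)"
    by (rule urewind[OF nb k m]) (use k in auto)
  finally show ?thesis .
qed

lemma urewind_left:
  assumes nb: "\<And>i. P i = Blank \<longleftrightarrow> \<not> (p \<le> i \<and> i < h)"
    and k: "k \<ge> 1" and m: "p \<le> m" "m + k \<le> h"
  shows "ureach (Fnd2, layers t (ctrl_track P m k), p) (GoR, layers t (ctrl_track P p k), p)"
proof -
  have "ureach (Fnd2, layers t (ctrl_track P m k), p) (Fnd2, layers t (ctrl_track P m k), m)"
    by (rule usweep_right[where s = "\<lambda>_. Fnd2" and v = "ctrl_track P m k"])
      (use k m in \<open>auto simp: ctrl_track_def fun_eq_iff\<close>)
  also have "ureach \<dots> (SL, layers t (ctrl_track P m k), m - 1)"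
    by (rule ustep) (use k in \<open>auto simp: ctrl_track_def fun_eq_iff\<close>)
  also have "ureach \<dots> (GoR, layers t (ctrl_track P p k), p)"
    by (rule urewind[OF nb k m]) (use k in auto)
  finally show ?thesis .
qed

text \<open>A shift carries program symbol and mark of a cell together. After a left shift the
  machine stands left of the marks and searches to the right (\<open>Fnd2\<close>); in the other
  cases it stands right of their beginning and searches to the left (\<open>Fnd\<close>).\<close>

lemma umove:
  assumes nb: "\<And>i. P i = Blank \<longleftrightarrow> \<not> (p \<le> i \<and> i < h)" and ph:
      "p < h"
    and k: "k \<ge> 1" and m: "p \<le> m" "m + k \<le> h"
  shows "ureach ((case mv of MvL \<Rightarrow> ShL (Blank, False) | MvS \<Rightarrow> Fnd | MvR
      \<Rightarrow> LW), layers t (ctrl_track P m k), h - 1)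
    (GoR, layers t (ctrl_track (\<lambda>i. P (i - int_of_mv mv)) (p + int_of_mv mv) k), p +
        int_of_mv mv)"
proof (cases mv)
  case MvS
  then show ?thesis using urewind_right[OF nb k m, of "h - 1" t] m by simp
next
  case MvL
  let ?u = "ctrl_track P m k"
  let ?P = "\<lambda>i. P (i + 1)"
  have nb': "?P i = Blank \<longleftrightarrow> \<not> (p - 1 \<le> i \<and> i < h - 1)" for i
      using nb[of "i + 1"] by auto
  have uh: "?u h = (Blank, False)" using nb[of h] m by (simp add: ctrl_track_def)
  have "ureach (ShL (Blank, False), layers t ?u, h - 1)
      (ShL (?u p), layers t (\<lambda>j. if p - 1 < j \<and> j \<le> h - 1 then ?u (j + 1) else ?u
          j), p - 1)"
    by (rule usweep_left[where s = "\<lambda>j. ShL (?u (j + 1))" and v = "\<lambda>j. ?u (j + 1)"])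
      (use ph nb uh in \<open>auto simp: ctrl_track_def\<close>)
  also have "ureach \<dots> (Fnd2, layers t (ctrl_track ?P (m - 1) k), p - 1)"
  proof (rule ustep[where x = "?u p" and m = 0])
    show "(\<lambda>j. if p - 1 < j \<and> j \<le> h - 1 then ?u (j + 1) else ?u j)(p - 1 := ?u p)
        = ctrl_track ?P (m - 1) k"
    proof
      fix j
      have "P j = Blank" "P (j + 1) = Blank" if "j < p - 1 \<or> h - 1 < j"
        using that nb[of j] nb[of "j + 1"] by auto
      then show "((\<lambda>j. if p - 1 < j \<and> j \<le> h - 1 then ?u (j + 1) else ?u j)(p - 1
          := ?u p)) j = ctrl_track ?P (m - 1) k j"
        using m by (auto simp: ctrl_track_def)
    qed
  qed (use nb[of "p - 1"] in \<open>auto simp: ctrl_track_def\<close>)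
  also have "ureach \<dots> (GoR, layers t (ctrl_track ?P (p - 1) k), p - 1)"
    by (rule urewind_left[OF nb' k]) (use m in auto)
  finally show ?thesis using MvL by simp
next
  case MvR
  let ?u = "ctrl_track P m k"
  let ?P = "\<lambda>i. P (i - 1)"
  have nb': "?P i = Blank \<longleftrightarrow> \<not> (p + 1 \<le> i \<and> i < h + 1)" for i
      using nb[of "i - 1"] by auto
  have up: "?u (p - 1) = (Blank, False)" using nb[of "p - 1"] m by (simp add: ctrl_track_def)
  have "ureach (LW, layers t ?u, h - 1) (LW, layers t ?u, p - 1)"
    by (rule usweep_left[where s = "\<lambda>_. LW" and v = ?u]) (use nb ph in \<open>auto simp:
        ctrl_track_def\<close>)
  also have "ureach \<dots> (ShR (?u (p - 1)), layers t ?u, p)"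
    by (rule ustep) (use nb in \<open>auto simp: ctrl_track_def fun_eq_iff\<close>)
  also have "ureach \<dots> (ShR (?u (h - 1)), layers t (\<lambda>j. if p \<le> j \<and> j < h
      then ?u (j - 1) else ?u j), h)"
    by (rule usweep_right[where s = "\<lambda>j. ShR (?u (j - 1))" and v = "\<lambda>j. ?u (j -
        1)"])
      (use ph nb in \<open>auto simp: ctrl_track_def\<close>)
  also have "ureach \<dots> (Fnd, layers t (ctrl_track ?P (m + 1) k), h)"
  proof (rule ustep[where x = "?u (h - 1)" and m = 0])
    show "(\<lambda>j. if p \<le> j \<and> j < h then ?u (j - 1) else ?u j)(h := ?u (h - 1)) =
        ctrl_track ?P (m + 1) k"
    proof
      fix j
      have "P j = Blank" "P (j - 1) = Blank" if "j < p \<or> h < j"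
        using that nb[of j] nb[of "j - 1"] by auto
      then show "((\<lambda>j. if p \<le> j \<and> j < h then ?u (j - 1) else ?u j)(h := ?u (h -
          1))) j = ctrl_track ?P (m + 1) k j"
        using m by (auto simp: ctrl_track_def)
    qed
  qed (use nb[of h] in \<open>auto simp: ctrl_track_def\<close>)
  also have "ureach \<dots> (GoR, layers t (ctrl_track ?P (p + 1) k), p + 1)"
    by (rule urewind_right[OF nb' k]) (use m in auto)
  finally show ?thesis using MvR by simp
qed

section \<open>The program of a simulated machine and matches in it\<close>

fun nat_of_dat :: "dat \<Rightarrow> nat" where "nat_of_dat D0 = 0" | "nat_of_dat D1 = 1" |
    "nat_of_dat D2 = 2"

definition dat_of :: "nat \<Rightarrow> dat" where "dat_of n = (if n = 0 then D0 else if n = 1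
    then D1 else D2)"

definition mv_of :: "int \<Rightarrow> mv" where "mv_of m = (if m = 1 then MvR else if m = -1 then
    MvL else MvS)"

lemma nat_of_dat_of: "n < 3 \<Longrightarrow> nat_of_dat (dat_of n) = n" by (auto simp: dat_of_def)

lemma int_of_mv_of: "m \<in> {-1, 0, 1} \<Longrightarrow> int_of_mv (mv_of m) = m" by (auto simp:
    mv_of_def)

text \<open>Halting transitions are flagged by \<open>Hlt\<close>, so state 0 is never looked up and
  \<open>prog\<close> lists only the states from 1 on.\<close>

definition entry :: "tm \<Rightarrow> nat \<times> dat \<Rightarrow> psym list" where
  "entry M = (\<lambda>(q, a). case tm_delta M q (nat_of_dat a) of (q', b, m) \<Rightarrow>
     Key a # replicate q One @ (if q' = 0 then Hlt (dat_of b) else Val (dat_of b) (mv_of m)) #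
         replicate q' One)"

definition prog :: "tm \<Rightarrow> psym list" where
  "prog M = concat (map (entry M) (List.product [1..<tm_nq M] [D0, D1, D2]))"

text \<open>The condition that stops the sliding, stated for the program list. The bounds are
  explicit because \<open>!\<close> is unspecified beyond the end of a list.\<close>

definition lmatch :: "psym list \<Rightarrow> nat \<Rightarrow> dat \<Rightarrow> nat
    \<Rightarrow> bool" where
  "lmatch X q a d \<longleftrightarrow> d < length X \<and> X ! d = Key a \<and>
     (\<forall>l. d < l \<and> l \<le> d + q \<longrightarrow> l < length X \<and> X ! l = One)
         \<and>
     d + q + 1 < length X \<and> isval (X ! (d + q + 1))"

lemma lmatch_append:
  assumes "length E \<le> d"
  shows "lmatch (E @ X) q a d \<longleftrightarrow> lmatch X q a (d - length E)"
proof -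
  obtain d' where d: "d = length E + d'" using assms le_Suc_ex by blast
  have "(\<forall>l. d < l \<and> l \<le> d + q \<longrightarrow> l < length (E @ X) \<and> (E @
      X) ! l = One) \<longleftrightarrow>
    (\<forall>l. d' < l \<and> l \<le> d' + q \<longrightarrow> l < length X \<and> X ! l = One)"
        (is "?A = ?B")
  proof
    assume A: ?A
    show ?B
    proof (intro allI impI)
      fix l assume "d' < l \<and> l \<le> d' + q"
      then show "l < length X \<and> X ! l = One" using A[rule_format, of "length E + l"] by (simp
          add: d)
    qed
  next
    assume B: ?B
    show ?A
    proof (intro allI impI)
      fix l assume l: "d < l \<and> l \<le> d + q"
      then obtain l' where l': "l = length E + l'" using d le_Suc_ex[of "length E" l] by auto
      then show "l < length (E @ X) \<and> (E @ X) ! l = One"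
        using B[rule_format, of l'] l by (simp add: d nth_append)
    qed
  qed
  then show ?thesis by (auto simp: lmatch_def d nth_append)
qed

text \<open>A match begins with a \<open>Key\<close>, hence at the start of an entry, and its
  \<open>One\<close>s must end exactly at the value symbol, hence their number is the state of that
  entry.\<close>

lemma no_lmatch_entry:
  assumes v: "isval v" and ne: "(q', a') \<noteq> (q, a)"
    and d: "d < length (Key a' # replicate q' One @ v # replicate r One)"
  shows "\<not> lmatch ((Key a' # replicate q' One @ v # replicate r One) @ X) q a d"
proof
  let ?E = "(Key a' # replicate q' One @ v # replicate r One) @ X"
  assume m: "lmatch ?E q a d"
  have key: "?E ! d = Key a" and ones: "\<And>l. d < l \<Longrightarrow> l \<le> d + q
      \<Longrightarrow> ?E ! l = One"
    and val: "isval (?E ! (d + q + 1))" using m by (auto simp: lmatch_def)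
  have vne: "v \<noteq> One" "v \<noteq> Key a" using v by auto
  show False
  proof (cases d)
    case 0
    then have "a' = a" using key by simp
    then have "q' < q \<or> q < q'" using ne by auto
    then show False
    proof
      assume "q' < q"
      then show False using ones[of "Suc q'"] 0 vne by (simp add: nth_append)
    next
      assume "q < q'"
      then show False using val 0 by (simp add: nth_append)
    qed
  next
    case (Suc d')
    then have "?E ! d = v \<or> ?E ! d = One" using d by (auto simp: nth_append nth_Cons')
    then show False using key vne by auto
  qed
qed

lemma entry_form:
  "\<exists>v r. entry M (q, a) = Key a # replicate q One @ v # replicate r One \<and> isval v"
  by (auto simp: entry_def split: prod.splits)

lemma entry_starts: "concat (map (entry M) es) = [] \<or> (\<exists>a s. concat (map (entry M) es)
    = Key a # s)"
  by (cases es) (auto simp: entry_def split: prod.splits)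

text \<open>Only positions before the entry matter, since the marks slide from left to right. A
  \<open>Key\<close> or the end after the entry delimits the \<open>One\<close>s of the new
  state.\<close>

lemma find_entry:
  assumes "(q, a) \<in> set es"
  shows "\<exists>pre suf. concat (map (entry M) es) = pre @ entry M (q, a) @ suf \<and>
    (suf = [] \<or> (\<exists>a' s. suf = Key a' # s)) \<and>
    (\<forall>d<length pre. \<not> lmatch (concat (map (entry M) es)) q a d)"
  using assms
proof (induction es)
  case (Cons e es)
  show ?case
  proof (cases "e = (q, a)")
    case True
    then show ?thesis
      by (intro exI[of _ "[]"] exI[of _ "concat (map (entry M) es)"]) (use entry_starts in auto)
  next
    case False
    then have "(q, a) \<in> set es" using Cons.prems by auto
    from Cons.IH[OF this] obtain pre suf where IH: "concat (map (entry M) es) = pre @ entry M (q,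
        a) @ suf"
      "suf = [] \<or> (\<exists>a' s. suf = Key a' # s)"
      "\<And>d. d < length pre \<Longrightarrow> \<not> lmatch (concat (map (entry M) es)) q a d"
      by blast
    obtain q' a' where e: "e = (q', a')" by (cases e)
    obtain v r where E: "entry M e = Key a' # replicate q' One @ v # replicate r One" "isval v"
      using entry_form[of M q' a'] e by auto
    have "\<not> lmatch (entry M e @ concat (map (entry M) es)) q a d" if d: "d < length (entry M
        e @ pre)" for d
    proof (cases "d < length (entry M e)")
      case True
      then show ?thesis using no_lmatch_entry[OF E(2)] False e unfolding E(1) by blast
    next
      case False
      then show ?thesis using IH(3)[of "d - length (entry M e)"] d by (simp add: lmatch_append)
    qed
    then show ?thesis
      by (intro exI[of _ "entry M e @ pre"] exI[of _ suf]) (use IH in auto)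
  qed
qed simp

section \<open>Simulation of runs and universality\<close>

definition prog_at :: "tm \<Rightarrow> int \<Rightarrow> int \<Rightarrow> psym" where
  "prog_at M h i = (if h - int (length (prog M)) \<le> i \<and> i < h
     then prog M ! nat (i - (h - int (length (prog M)))) else Blank)"

definition uconf :: "tm \<Rightarrow> nat \<times> (int \<Rightarrow> nat) \<times> int
    \<Rightarrow> ust \<times> (int \<Rightarrow> dat \<times> psym \<times> bool) \<times> int"
    where
  "uconf M = (\<lambda>(q, t, h). (GoR, layers (\<lambda>i. dat_of (t i)) (ctrl_track (prog_at M
      h) (h - int (length (prog M))) (int q + 1)),
     h - int (length (prog M))))"

lemma prog_nonblank: "Blank \<notin> set (prog M)"
  by (auto simp: prog_def entry_def split: prod.splits if_splits)

lemma prog_at_blank: "prog_at M h i = Blank \<longleftrightarrow> \<not> (h - int (length (prog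
    M)) \<le> i \<and> i < h)"
proof -
  have "prog M ! nat (i - (h - int (length (prog M)))) \<in> set (prog M)"
    if "h - int (length (prog M)) \<le> i \<and> i < h" using that by auto
  then show ?thesis using prog_nonblank[of M] by (auto simp: prog_at_def)
qed

lemma prog_at_shift: "prog_at M h (i - d) = prog_at M (h + d) i"
  by (auto simp: prog_at_def algebra_simps)

lemma sim_step:
  assumes M: "wf_tm M" "tm_ns M = 3" and q: "1 \<le> q" "q < tm_nq M" and t: "\<And>j. t j < 3"
    and s: "fstep (tm_delta M) 0 (q, t, h) = (q', t', h')"
  shows "q' \<noteq> 0 \<Longrightarrow> ureach (fstep udelta Halt (uconf M (q, t, h))) (uconf M
      (q', t', h'))"
    and "q' = 0 \<Longrightarrow> \<exists>i. ureach (uconf M (q, t, h)) (Halt, layers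
        (\<lambda>i. dat_of (t' i)) (\<lambda>_. (Blank, False)), i)"
proof -
  let ?T = "\<lambda>i. dat_of (t i)"
  define a where "a = dat_of (t h)"
  have dna: "nat_of_dat a = t h" using t by (simp add: a_def nat_of_dat_of)
  obtain b m where \<delta>: "tm_delta M q (t h) = (q', b, m)" and t': "t' = t(h := b)" and h':
      "h' = h + m"
    using s q by (auto simp: fstep_def split: prod.splits)
  have "case tm_delta M q (t h) of (q', b, m) \<Rightarrow> q' < tm_nq M \<and> b < tm_ns M \<and>
      m \<in> {-1, 0, 1}"
    by (rule M(1)[unfolded wf_tm_def, THEN conjunct2, THEN conjunct2, rule_format, OF q(2)])
      (use t M(2) in auto)
  then have ok: "b < 3" "m \<in> {-1, 0, 1}" using M(2) unfolding \<delta> by simp_all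
  define v where "v = (if q' = 0 then Hlt (dat_of b) else Val (dat_of b) (mv_of m))"
  have E: "entry M (q, a) = Key a # replicate q One @ v # replicate q' One"
    by (simp add: entry_def dna \<delta> v_def)
  have isv: "isval v" by (simp add: v_def)
  have "(q, a) \<in> set (List.product [1..<tm_nq M] [D0, D1, D2])" using q by (cases a) auto
  from find_entry[OF this, of M] obtain pre suf where
    pr: "prog M = pre @ entry M (q, a) @ suf" and suf: "suf = [] \<or> (\<exists>a' s. suf = Key
        a' # s)"
    and first: "\<And>d. d < length pre \<Longrightarrow> \<not> lmatch (prog M) q a d"
    unfolding prog_def by blast
  define N where "N = int (length (prog M))"
  define p where "p = h - N"
  define e where "e = p + int (length pre)"
  define P where "P = prog_at M h"
  have N: "N = int (length pre) + int q + 2 + int q' + int (length suf)"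
    by (simp add: N_def pr E)
  have P: "P i = (if p \<le> i \<and> i < h then prog M ! nat (i - p) else Blank)" for i
    by (simp add: P_def prog_at_def p_def N_def)
  have Pe: "P (e + int j) = (entry M (q, a) @ suf) ! j" if "j < length (entry M (q, a) @ suf)" for j
  proof -
    have "nat (e + int j - p) = length pre + j" by (simp add: e_def)
    then show ?thesis using that unfolding P by (simp add: e_def p_def pr nth_append N_def)
  qed
  have nb: "P i = Blank \<longleftrightarrow> \<not> (p \<le> i \<and> i < h)" for i
    unfolding P_def p_def N_def by (rule prog_at_blank)
  have X: "entry M (q, a) @ suf = Key a # replicate q One @ v # replicate q' One @ suf"
    by (simp add: E)
  have "(entry M (q, a) @ suf) ! 0 = Key a" unfolding X by simp
  then have P0: "P e = Key a" using Pe[of 0] unfolding X by simp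
  have P1: "P l = One" if "e < l" "l < e + (int q + 1)" for l
  proof -
    define j where "j = nat (l - e - 1)"
    have j: "j < q" "e + int (Suc j) = l" using that by (auto simp: j_def)
    have "P (e + int (Suc j)) = (entry M (q, a) @ suf) ! Suc j"
      by (rule Pe) (use j(1) X in simp)
    also have "\<dots> = One" unfolding X using j(1) by (simp add: nth_append)
    finally show ?thesis unfolding j(2) .
  qed
  have P2: "P (e + (int q + 1)) = v"
  proof -
    have "P (e + int (Suc q)) = (entry M (q, a) @ suf) ! Suc q" by (rule Pe) (use X in simp)
    also have "\<dots> = v" unfolding X by (simp add: nth_append)
    finally show ?thesis by (simp add: algebra_simps)
  qed
  have P3: "P l = One" if "e + (int q + 1) < l" "l < e + (int q + 1) + (int q' + 1)" for l
  proof -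
    define j where "j = nat (l - e - int q - 2)"
    have j: "j < q'" "e + int (Suc q + Suc j) = l" using that by (auto simp: j_def)
    have "P (e + int (Suc q + Suc j)) = (entry M (q, a) @ suf) ! (Suc q + Suc j)"
      by (rule Pe) (use j(1) X in simp)
    also have "\<dots> = One" unfolding X using j(1) by (simp add: nth_append)
    finally show ?thesis unfolding j(2) .
  qed
  \<comment> \<open>Here the copying of marks stops: the next cell holds the \<open>Key\<close> of
    the following entry, or it is the simulated head cell, whose program track is blank.\<close>
  have P4: "P (e + (int q + 1) + (int q' + 1)) \<noteq> One"
  proof (cases suf)
    case Nil
    then have "e + (int q + 1) + (int q' + 1) = h" using N by (simp add: e_def p_def)
    then show ?thesis using nb[of h] by auto
  next
    case (Cons c cs)
    then obtain a' where c: "c = Key a'" using suf by auto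
    have "P (e + int (length (entry M (q, a)))) = (entry M (q, a) @ suf) ! length (entry M (q, a))"
      by (rule Pe) (simp add: Cons)
    also have "\<dots> = c" by (simp add: Cons)
    also have "e + int (length (entry M (q, a))) = e + (int q + 1) + (int q' + 1)" by (simp add: E)
    finally show ?thesis using c by simp
  qed
  have ph: "p < h" using N by (simp add: p_def)
  have pe: "p \<le> e" by (simp add: e_def)
  \<comment> \<open>A match on the tape before \<open>e\<close> would be a match in the list before
    \<open>length pre\<close>. Its cells are nonblank, hence inside the program, which yields the
    bounds in \<open>lmatch\<close>.\<close>
  have no: "\<not> (P m = Key (?T h) \<and> (\<forall>l. m < l \<and> l < m + (int q + 1)
      \<longrightarrow> P l = One) \<and> isval (P (m + (int q + 1))))"
    if m: "p \<le> m" "m < e" for m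
  proof
    assume A: "P m = Key (?T h) \<and> (\<forall>l. m < l \<and> l < m + (int q + 1)
        \<longrightarrow> P l = One) \<and> isval (P (m + (int q + 1)))"
    obtain d where d: "m = p + int d" using m(1) by (metis zle_iff_zadd)
    have d': "d < length pre" using m d by (simp add: e_def)
    have Pj: "j < length (prog M) \<and> prog M ! j = P (p + int j)" if "P (p + int j) \<noteq>
        Blank" for j
      using that by (auto simp: P p_def N_def split: if_splits)
    have iv: "isval (P (p + int (d + q + 1)))" using A d by (simp add: algebra_simps)
    then have "P (p + int (d + q + 1)) \<noteq> Blank" by auto
    note last = Pj[OF this]
    have "lmatch (prog M) q a d"
      unfolding lmatch_def
    proof (intro conjI allI impI)
      show "d < length (prog M)" "prog M ! d = Key a" using Pj[of d] A d by (auto simp: a_def)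
      show "d + q + 1 < length (prog M)" "isval (prog M ! (d + q + 1))"
        using last iv by simp_all
      fix l assume "d < l \<and> l \<le> d + q"
      then have "P (p + int l) = One" using A d by auto
      then show "l < length (prog M)" "prog M ! l = One" using Pj[of l] by auto
    qed
    then show False using first d' by blast
  qed
  have st: "ureach (fstep udelta Halt (uconf M (q, t, h)))
      (Cmp a True, layers ?T (ctrl_track P (e + 1) (int q + 1 - 1)), e + (int q + 1))"
    using ustart[where P = P and p = p and h = h and k = "int q + 1" and e = e and t = ?T, OF nb
        ph _ pe]
      P0 P1 no unfolding uconf_def a_def P_def p_def N_def by simp
  have T': "(\<lambda>i. dat_of (t' i)) = ?T(h := dat_of b)" by (auto simp: t')
  show "ureach (fstep udelta Halt (uconf M (q, t, h))) (uconf M (q', t', h'))" if q': "q' \<noteq>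
      0"
  proof -
    have V: "P (e + (int q + 1)) = Val (dat_of b) (mv_of m)" using P2 q' by (simp add: v_def)
    have k: "int q + 1 \<ge> 1" "int q' + 1 \<ge> 1" by auto
    have eh: "e + (int q + 1) + (int q' + 1) \<le> h"
      by (rule ucopy(2)[OF nb k pe P0 V]) (use P1 P3 P4 in auto)
    note st
    also have "ureach (Cmp a True, layers ?T (ctrl_track P (e + 1) (int q + 1 - 1)), e + (int q +
        1))
      ((case mv_of m of MvL \<Rightarrow> ShL (Blank, False) | MvS \<Rightarrow> Fnd | MvR
          \<Rightarrow> LW),
        layers (?T(h := dat_of b)) (ctrl_track P (e + (int q + 1)) (int q' + 1)), h - 1)"
      by (rule ucopy(1)[OF nb k pe P0 V]) (use P1 P3 P4 in auto)
    also have "ureach \<dots> (GoR, layers (?T(h := dat_of b)) (ctrl_track (\<lambda>i. P (i -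
        int_of_mv (mv_of m))) (p + int_of_mv (mv_of m)) (int q' + 1)), p + int_of_mv (mv_of m))"
      by (rule umove[OF nb ph k(2)]) (use eh pe in auto)
    finally have "ureach (fstep udelta Halt (uconf M (q, t, h)))
      (GoR, layers (?T(h := dat_of b)) (ctrl_track (\<lambda>i. P (i - int_of_mv (mv_of m))) (p +
          int_of_mv (mv_of m)) (int q' + 1)), p + int_of_mv (mv_of m))" .
    moreover have "int_of_mv (mv_of m) = m" using ok by (simp add: int_of_mv_of)
    ultimately show ?thesis
      unfolding uconf_def by (simp add: T'[symmetric] P_def prog_at_shift h' p_def N_def
          algebra_simps)
  qed
  show "\<exists>i. ureach (uconf M (q, t, h)) (Halt, layers (\<lambda>i. dat_of (t' i))
      (\<lambda>_. (Blank, False)), i)" if q': "q' = 0"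
  proof -
    have V: "P (e + (int q + 1)) = Hlt (dat_of b)" using P2 q' by (simp add: v_def)
    note ureach_step[OF st]
    also have "ureach (Cmp a True, layers ?T (ctrl_track P (e + 1) (int q + 1 - 1)), e + (int q +
        1))
        (Halt, layers (?T(h := dat_of b)) (\<lambda>_. (Blank, False)), p - 1)"
      by (rule uhalt[OF nb _ pe V]) simp
    finally show ?thesis unfolding T' by blast
  qed
qed

lemma cell_less:
  assumes "set L \<subseteq> {..<n}" "set R \<subseteq> {..<n}" "0 < n"
  shows "cell L R k < n"
proof (cases "0 \<le> k + int (length L) \<and> k < int (length R)")
  case True
  then have "(L @ R) ! nat (k + int (length L)) \<in> set (L @ R)" by (intro nth_mem) auto
  then have "(L @ R) ! nat (k + int (length L)) < n" using assms(1,2) by auto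
  then show ?thesis using True by (simp add: cell_def)
qed (use assms(3) in \<open>auto simp: cell_def\<close>)

lemma fstep_halt: "fst c = h \<Longrightarrow> (fstep \<delta> h ^^ n) c = c"
  by (induction n) (auto simp: fstep_def split: prod.splits)

lemma fstep_halt_mono:
  assumes "fst ((fstep \<delta> h ^^ n) c) = h" "n \<le> m"
  shows "(fstep \<delta> h ^^ m) c = (fstep \<delta> h ^^ n) c"
proof -
  have "(fstep \<delta> h ^^ m) c = (fstep \<delta> h ^^ (m - n)) ((fstep \<delta> h ^^ n) c)"
    using assms(2) by (metis comp_apply funpow_add le_add_diff_inverse2)
  then show ?thesis using fstep_halt[OF assms(1)] by simp
qed

text \<open>The bound k \<ge> n holds because every simulated step takes at least one step; it
    transfers
  divergence.\<close>

lemma sim_run: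
  assumes M: "wf_tm M" "tm_ns M = 3" and w: "set w \<subseteq> {..<3}"
    and t0: "t0 = (\<lambda>j. cell [] w (j - h0))"
    and run: "(fstep (tm_delta M) 0 ^^ n) (1, t0, h0) = (q, t, h)"
  shows "if q \<noteq> 0 then \<exists>k\<ge>n. (fstep udelta Halt ^^ k) (uconf M (1, t0, h0)) =
      uconf M (q, t, h)
    else \<exists>k i. (fstep udelta Halt ^^ k) (uconf M (1, t0, h0)) = (Halt, layers (\<lambda>i.
        dat_of (t i)) (\<lambda>_. (Blank, False)), i)"
  using run
proof (induction n arbitrary: q t h)
  case 0
  then show ?case by (auto intro: exI[of _ 0])
next
  case (Suc n)
  obtain q1 t1 h1 where c1: "(fstep (tm_delta M) 0 ^^ n) (1, t0, h0) = (q1, t1, h1)"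
    by (metis prod_cases3)
  have s: "fstep (tm_delta M) 0 (q1, t1, h1) = (q, t, h)" using Suc.prems c1 by simp
  show ?case
  proof (cases "q1 = 0")
    case True
    then show ?thesis using Suc.IH[OF c1] s by (auto simp: fstep_def)
  next
    case False
    \<comment> \<open>\<open>sim_step\<close> needs symbols below 3 on the whole tape; this holds
      since the tape belongs to a reachable configuration.\<close>
    have sc: "tm_start w \<in> tm_configs M"
      using M w by (auto simp: tm_start_def tm_configs_def wf_tm_def)
    have "fconf (tm_start w) (1, t0, h0)" by (simp add: fconf_def tm_start_def t0)
    from fconf_run[OF M(1) sc this, of n] obtain c where
      c: "fconf c (q1, t1, h1)" "c \<in> tm_configs M" unfolding c1 by blast
    then obtain L R where LR: "c = (q1, L, R)" by (cases c) (auto simp: fconf_def)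
    have q1: "q1 < tm_nq M" and LRs: "set L \<subseteq> {..<3}" "set R \<subseteq> {..<3}"
      using c(2) M(2) by (auto simp: LR tm_configs_def)
    have t1: "t1 j < 3" for j using c(1) cell_less[OF LRs] by (simp add: LR fconf_def)
    obtain k where k: "k \<ge> n" "(fstep udelta Halt ^^ k) (uconf M (1, t0, h0)) = uconf M (q1,
        t1, h1)"
      using Suc.IH[OF c1] False by auto
    have "1 \<le> q1" using False by simp
    note sim = sim_step[OF M this q1 t1 s]
    show ?thesis
    proof (cases "q = 0")
      case True
      obtain m i where "(fstep udelta Halt ^^ m) (uconf M (q1, t1, h1)) = (Halt, layers
          (\<lambda>i. dat_of (t i)) (\<lambda>_. (Blank, False)), i)"
        using sim(2)[OF True] unfolding ureach_def by blast
      then have "(fstep udelta Halt ^^ (m + k)) (uconf M (1, t0, h0)) = (Halt, layers (\<lambda>i.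
          dat_of (t i)) (\<lambda>_. (Blank, False)), i)"
        using k by (simp add: funpow_add)
      then show ?thesis using True by auto
    next
      case False
      obtain m where "(fstep udelta Halt ^^ m) (fstep udelta Halt (uconf M (q1, t1, h1))) = uconf
          M (q, t, h)"
        using sim(1)[OF False] unfolding ureach_def by blast
      then have "(fstep udelta Halt ^^ (m + Suc k)) (uconf M (1, t0, h0)) = uconf M (q, t, h)"
        using k(2) by (simp only: funpow_add funpow.simps comp_apply)
      moreover have "Suc n \<le> m + Suc k" using k by simp
      ultimately show ?thesis using False by (auto intro: exI[of _ "m + Suc k"])
    qed
  qed
qed

lemma tm_run_fconf:
  assumes "wf_tm M" "set w \<subseteq> {..<tm_ns M}"
    and "(fstep (tm_delta M) 0 ^^ n) (1, \<lambda>j. cell [] w (j - h), h) = (q, t, i)"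
  shows "fconf ((tm_step M ^^ n) (tm_start w)) (q, t, i)"
    and "(tm_step M ^^ n) (tm_start w) \<in> tm_configs M"
    and "fst ((tm_step M ^^ n) (tm_start w)) = q"
proof -
  have sc: "tm_start w \<in> tm_configs M"
    using assms by (auto simp: tm_start_def tm_configs_def wf_tm_def)
  have "fconf (tm_start w) (1, \<lambda>j. cell [] w (j - h), h)" by (simp add: fconf_def
      tm_start_def)
  from fconf_run[OF assms(1) sc this, of n]
  show "fconf ((tm_step M ^^ n) (tm_start w)) (q, t, i)" "(tm_step M ^^ n) (tm_start w) \<in>
      tm_configs M"
    using assms by auto
  then show "fst ((tm_step M ^^ n) (tm_start w)) = q"
    by (auto simp: fconf_def split: prod.splits)
qed

text \<open>The start state 1 is stored as two marks, and these have to lie on program cells in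
  order to be part of the code word.\<close>

lemma prog_length:
  assumes "wf_tm M"
  shows "length (prog M) \<ge> 2"
proof -
  have "tm_nq M \<ge> 2" using assms by (simp add: wf_tm_def)
  then have "[1..<tm_nq M] = 1 # [2..<tm_nq M]" by (simp add: upt_conv_Cons numeral_2_eq_2)
  then have "prog M = entry M (1, D0) @ concat (map (entry M) (tl (List.product [1..<tm_nq M] [D0,
      D1, D2])))"
    by (simp add: prog_def)
  moreover obtain v r where "entry M (1, D0) = Key D0 # replicate 1 One @ v # replicate r One"
    using entry_form by blast
  ultimately show ?thesis by simp
qed

theorem ex_universal_tm: "\<exists>U. universal_tm U"
proof -
  obtain hq :: "ust \<Rightarrow> nat" where hq: "inj hq" "range hq = {..<CARD(ust)}" "hq Halt =
      0" "hq GoR = 1"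
    using ex_numbering[of "[Halt, GoR]"] by (auto simp: All_less_Suc)
  obtain hs :: "dat \<times> psym \<times> bool \<Rightarrow> nat" where hs: "inj hs" "range hs =
      {..<CARD(dat \<times> psym \<times> bool)}"
    and hsn: "hs (D0, Blank, False) = 0" "hs (D1, Blank, False) = 1" "hs (D2, Blank, False) = 2"
    using ex_numbering[of "[(D0, Blank, False), (D1, Blank, False), (D2, Blank, False)]"]
    by (auto simp: All_less_Suc numeral_2_eq_2)
  define U where "U = num_tm hq hs udelta"
  have hq_less: "hq q < CARD(ust)" for q using hq(2) by blast
  have hs_less: "hs x < CARD(dat \<times> psym \<times> bool)" for x using hs(2) by blast
  have Uq: "tm_nq U = CARD(ust)" and Us: "tm_ns U = CARD(dat \<times> psym \<times> bool)" by
      (auto simp: U_def num_tm_def)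
  have n2: "tm_nq U \<ge> 2" using hq_less[of GoR] hq(4) Uq by simp
  have n3: "tm_ns U \<ge> 3" using hs_less[of "(D2, Blank, False)"] hsn(3) Us by simp
  have mv: "snd (snd (udelta q x)) \<in> {-1, 0, 1}" for q x
    by (cases "(q, x)" rule: udelta.cases) (auto split: psym.splits)
  have "case tm_delta U q a of (q', b, m) \<Rightarrow> q' < tm_nq U \<and> b < tm_ns U \<and> m
      \<in> {-1, 0, 1}" for q a
  proof -
    obtain q' b m where c: "udelta (inv hq q) (inv hs a) = (q', b, m)" by (metis prod_cases3)
    have "m \<in> {-1, 0, 1}" using mv[of "inv hq q" "inv hs a"] by (simp only: c snd_conv)
    then show ?thesis using hq_less hs_less by (simp add: U_def num_tm_def c)
  qed
  then have wfU: "wf_tm U" unfolding wf_tm_def using n2 n3 by simp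
  have dat_of: "hs (dat_of n, Blank, False) = n" if "n < 3" for n
    using that hsn by (auto simp: dat_of_def)
  have main: "\<exists>code. set code \<subseteq> {..<tm_ns U} \<and>
      (\<forall>w. set w \<subseteq> {1, 2} \<longrightarrow>
         (tm_halts M (tm_start w) \<longleftrightarrow> tm_halts U (tm_start (code @ w))) \<and>
         (\<forall>r. tm_output M (tm_start w) r \<longrightarrow> tm_output U (tm_start (code @
             w)) r))"
    if M: "wf_tm M" "tm_ns M = 3" for M
  proof -
    define N where "N = length (prog M)"
    \<comment> \<open>The input begins right behind the program and the run begins in
      \<open>GoR\<close> at cell 0. This is \<open>uconf\<close> with simulated head at N and the
      two marks of state 1.\<close>
    define code where "code = map (\<lambda>i. hs (D0, prog M ! i, i < 2)) [0..<N]"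
    have code: "set code \<subseteq> {..<tm_ns U}" using hs_less Us by (auto simp: code_def)
    have "(tm_halts M (tm_start w) \<longleftrightarrow> tm_halts U (tm_start (code @ w))) \<and>
         (\<forall>r. tm_output M (tm_start w) r \<longrightarrow> tm_output U (tm_start (code @
             w)) r)"
      if w: "set w \<subseteq> {1, 2}" for w
    proof -
      define t0 where "t0 = (\<lambda>j. cell [] w (j - int N))"
      define u0 where "u0 = uconf M (1, t0, int N)"
      have w3: "set w \<subseteq> {..<3}" using w by auto
      have wU: "set (code @ w) \<subseteq> {..<tm_ns U}" using code w n3 by auto
      have c3: "cell [] w j < 3" for j by (rule cell_less) (use w in auto)
      obtain tu where tu: "u0 = (GoR, tu, 0)" "tu = layers (\<lambda>i. dat_of (t0 i)) (ctrl_track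
          (prog_at M (int N)) 0 2)"
        by (auto simp: u0_def uconf_def N_def)
      have init: "hs (tu j) = cell [] (code @ w) (j - 0)" for j
      proof (cases "0 \<le> j \<and> j < int N")
        case True
        then have "t0 j = 0" by (simp add: t0_def cell_def)
        then show ?thesis using True prog_length[OF M(1)]
          by (auto simp: tu layers_def ctrl_track_def prog_at_def N_def[symmetric] dat_of_def
              cell_def code_def nth_append
              intro!: arg_cong[where f = hs])
      next
        case False
        then have "tu j = (dat_of (t0 j), Blank, False)"
          using prog_length[OF M(1)] by (auto simp: tu layers_def ctrl_track_def prog_at_def N_def)
        moreover have "t0 j < 3" by (simp add: t0_def c3)
        moreover have "cell [] (code @ w) j = t0 j"
          using False by (auto simp: t0_def cell_def nth_append code_def nat_diff_distrib)
        ultimately show ?thesis by (simp add: dat_of)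
      qed
      have Urun: "(fstep (tm_delta U) 0 ^^ n) (1, \<lambda>j. cell [] (code @ w) (j - 0), 0) =
          (case (fstep udelta Halt ^^ n) u0 of (q', t', i') \<Rightarrow> (hq q', hs \<circ> t',
              i'))" for n
        using num_tm_run[OF hq(1) hs(1) hq(3), where q = GoR and t = tu and i = 0 and n = n and
            \<delta> = udelta]
        by (simp add: U_def[symmetric] hq(4) tu(1) init comp_def)
      have Ustate: "fst ((tm_step U ^^ n) (tm_start (code @ w))) = hq (fst ((fstep udelta Halt ^^
          n) u0))" for n
      proof -
        obtain q t i where c: "(fstep udelta Halt ^^ n) u0 = (q, t, i)" by (metis prod_cases3)
        from tm_run_fconf(3)[OF wfU wU Urun[of n, unfolded c prod.case]] show ?thesis by (simp
            add: c)
      qed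
      have Uhalt: "fst ((tm_step U ^^ n) (tm_start (code @ w))) = 0 \<longleftrightarrow> fst
          ((fstep udelta Halt ^^ n) u0) = Halt" for n
        unfolding Ustate using hq(1,3) by (metis inj_eq)
      have Mset: "set w \<subseteq> {..<tm_ns M}" using w3 M(2) by simp
      have out: "tm_output U (tm_start (code @ w)) (tm_result ((tm_step M ^^ n) (tm_start w)))"
        if "fst ((tm_step M ^^ n) (tm_start w)) = 0" for n
      proof -
        obtain q t h where c: "(fstep (tm_delta M) 0 ^^ n) (1, t0, int N) = (q, t, h)" by (metis
            prod_cases3)
        note Mr = tm_run_fconf[OF M(1) Mset c[unfolded t0_def]]
        have q0: "q = 0" using Mr(3) that by simp
        obtain k i where k: "(fstep udelta Halt ^^ k) u0 = (Halt, layers (\<lambda>i. dat_of (t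
            i)) (\<lambda>_. (Blank, False)), i)"
          using sim_run[OF M w3 t0_def c] q0 by (auto simp: u0_def)
        have t3: "t j < 3" for j
          using Mr(1,2) M(2) by (auto simp: fconf_def tm_configs_def intro!: cell_less)
        have "hs \<circ> layers (\<lambda>i. dat_of (t i)) (\<lambda>_. (Blank, False)) = t" by
            (rule ext) (simp add: layers_def dat_of t3)
        then have "fconf ((tm_step U ^^ k) (tm_start (code @ w))) (0, t, i)"
          using tm_run_fconf(1)[OF wfU wU Urun[of k, unfolded k prod.case]] hq(3) by simp
        then have "tm_result ((tm_step M ^^ n) (tm_start w)) = tm_result ((tm_step U ^^ k)
            (tm_start (code @ w)))"
          by (rule tm_result_fconf[OF Mr(1)])
        moreover have "fst ((tm_step U ^^ k) (tm_start (code @ w))) = 0" by (simp add: Uhalt k)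
        ultimately show ?thesis unfolding tm_output_def by metis
      qed
      \<comment> \<open>If M diverged, U would be in a configuration \<open>uconf\<close>, thus not
        in \<open>Halt\<close>, at arbitrarily late times; but a halted configuration stays
        fixed.\<close>
      have "tm_halts M (tm_start w)" if hU: "tm_halts U (tm_start (code @ w))"
      proof (rule ccontr)
        assume nh: "\<not> tm_halts M (tm_start w)"
        obtain n where n: "fst ((fstep udelta Halt ^^ n) u0) = Halt"
          using hU unfolding tm_halts_def Uhalt by blast
        obtain q t h where c: "(fstep (tm_delta M) 0 ^^ n) (1, t0, int N) = (q, t, h)" by (metis
            prod_cases3)
        have "q \<noteq> 0" using nh tm_run_fconf(3)[OF M(1) Mset c[unfolded t0_def]] by (auto
            simp: tm_halts_def)
        then obtain k where "k \<ge> n" "(fstep udelta Halt ^^ k) u0 = uconf M (q, t, h)"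
          using sim_run[OF M w3 t0_def c] by (auto simp: u0_def)
        then have "fst (uconf M (q, t, h)) = Halt" using fstep_halt_mono[OF n] n by metis
        then show False by (simp add: uconf_def)
      qed
      moreover have "tm_halts U (tm_start (code @ w))" if "tm_halts M (tm_start w)"
        using that out unfolding tm_halts_def tm_output_def by blast
      moreover have "tm_output U (tm_start (code @ w)) r" if "tm_output M (tm_start w) r" for r
        using that out unfolding tm_output_def[of M] by blast
      ultimately show ?thesis by blast
    qed
    then show ?thesis using code by blast
  qed
  show ?thesis unfolding universal_tm_def using wfU n3 main by blast
qed

subsection \<open>Smooth functions\<close>

text \<open>Being infinitely differentiable as a greatest fixed point; closure properties then
  become coinductions.\<close>

coinductive smooth1 :: "(real \<Rightarrow> real) \<Rightarrow> bool" where
  "(\<And>x. (f has_real_derivative f' x) (at x)) \<Longrightarrow> smooth1 f' \<Longrightarrow>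
      smooth1 f"

inductive_set gen :: "(real \<Rightarrow> real) set \<Rightarrow> (real \<Rightarrow> real) set"
    for G where
  gen_base: "g \<in> G \<Longrightarrow> g \<in> gen G"
| gen_add: "f \<in> gen G \<Longrightarrow> g \<in> gen G \<Longrightarrow> (\<lambda>x. f x + g
    x) \<in> gen G"
| gen_mult: "f \<in> gen G \<Longrightarrow> g \<in> gen G \<Longrightarrow> (\<lambda>x. f x * g
    x) \<in> gen G"

text \<open>Coinduction up to sums and products: by the product rule the generated set is closed
  under differentiation as soon as it contains the derivatives of its generators.\<close>

lemma smooth1_gen:
  assumes G: "\<And>g. g \<in> G \<Longrightarrow> \<exists>g'\<in>gen G. \<forall>x. (g
      has_real_derivative g' x) (at x)"
    and f: "f \<in> gen G"
  shows "smooth1 f"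
proof -
  have D: "\<exists>f'\<in>gen G. \<forall>x. (f has_real_derivative f' x) (at x)" if "f \<in> gen
      G" for f
    using that
  proof induction
    case (gen_add f g)
    then obtain f' g' where "f' \<in> gen G" "\<forall>x. (f has_real_derivative f' x) (at x)"
      "g' \<in> gen G" "\<forall>x. (g has_real_derivative g' x) (at x)" by blast
    then show ?case by (intro bexI[of _ "\<lambda>x. f' x + g' x"]) (auto intro: DERIV_add
        gen.intros)
  next
    case (gen_mult f g)
    then obtain f' g' where *: "f' \<in> gen G" "\<And>x. (f has_real_derivative f' x) (at x)"
      "g' \<in> gen G" "\<And>x. (g has_real_derivative g' x) (at x)" by blast
    show ?case
      by (rule bexI[of _ "\<lambda>x. f' x * g x + g' x * f x"])
        (use * gen_mult in \<open>auto intro!: DERIV_mult gen.gen_add gen.gen_mult\<close>)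
  qed (use G in blast)
  show ?thesis using f
  proof (coinduction arbitrary: f)
    case smooth1
    then show ?case using D by blast
  qed
qed

lemma smooth1D: "smooth1 f \<Longrightarrow> \<exists>f'. smooth1 f' \<and> (\<forall>x. (f
    has_real_derivative f' x) (at x))"
  by (erule smooth1.cases) blast

lemma smooth1_gen_smooth:
  assumes "f \<in> gen (Collect smooth1)"
  shows "smooth1 f"
proof (rule smooth1_gen[OF _ assms])
  fix g assume "g \<in> Collect smooth1"
  then obtain g' where "smooth1 g'" "\<forall>x. (g has_real_derivative g' x) (at x)" using
      smooth1D by blast
  then show "\<exists>g'\<in>gen (Collect smooth1). \<forall>x. (g has_real_derivative g' x) (at x)"
    using gen_base by blast
qed

lemma smooth1_add: "smooth1 f \<Longrightarrow> smooth1 g \<Longrightarrow> smooth1 (\<lambda>x. f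
    x + g x)"
  by (intro smooth1_gen_smooth gen_add gen_base) auto

lemma smooth1_mult: "smooth1 f \<Longrightarrow> smooth1 g \<Longrightarrow> smooth1 (\<lambda>x.
    f x * g x)"
  by (intro smooth1_gen_smooth gen_mult gen_base) auto

lemma smooth1_const: "smooth1 (\<lambda>x. c)"
proof (coinduction arbitrary: c)
  case smooth1
  show ?case by (intro exI[of _ "\<lambda>x. c"] exI[of _ "\<lambda>x. 0"]) auto
qed

lemma smooth1_ident: "smooth1 (\<lambda>x. x)"
  by (rule smooth1.intros[OF DERIV_ident smooth1_const])

lemma smooth1_affine: "smooth1 (\<lambda>x. a * x + b)"
  by (intro smooth1_add smooth1_mult smooth1_const smooth1_ident)

lemma smooth1_compose:
  assumes "smooth1 f" "smooth1 g"
  shows "smooth1 (\<lambda>x. f (g x))"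
proof -
  \<comment> \<open>The chain rule yields a composite times a smooth function, so both kinds serve
    as generators.\<close>
  define G where "G = {\<lambda>x. a (g x) |a. smooth1 a} \<union> Collect smooth1"
  show ?thesis
  proof (rule smooth1_gen[where G = G])
    fix h assume "h \<in> G"
    then consider a where "h = (\<lambda>x. a (g x))" "smooth1 a" | "smooth1 h" unfolding G_def by
        blast
    then show "\<exists>h'\<in>gen G. \<forall>x. (h has_real_derivative h' x) (at x)"
    proof cases
      case 1
      obtain a' where a': "smooth1 a'" "\<And>x. (a has_real_derivative a' x) (at x)"
        using smooth1D[OF 1(2)] by blast
      obtain g' where g': "smooth1 g'" "\<And>x. (g has_real_derivative g' x) (at x)"
        using smooth1D[OF assms(2)] by blast
      have "(\<lambda>x. a' (g x) * g' x) \<in> gen G"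
        using a' g' by (intro gen_mult gen_base) (auto simp: G_def)
      moreover have "(h has_real_derivative a' (g x) * g' x) (at x)" for x
        unfolding 1(1) using DERIV_chain2[OF a'(2) g'(2)] .
      ultimately show ?thesis by (intro bexI[of _ "\<lambda>x. a' (g x) * g' x"] allI)
    next
      case 2
      then show ?thesis using smooth1D[OF 2] by (auto intro: gen_base simp: G_def)
    qed
  qed (use assms in \<open>auto intro!: gen_base simp: G_def\<close>)
qed

lemma smooth1_affine_compose: "smooth1 f \<Longrightarrow> smooth1 (\<lambda>x. f (a * x + b))"
  by (rule smooth1_compose[OF _ smooth1_affine])

section \<open>Bump functions\<close>

definition flat :: "nat \<Rightarrow> real \<Rightarrow> real" where
  "flat n x = (if x > 0 then inverse x ^ n * exp (- inverse x) else 0)"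

text \<open>The powers of \<open>inverse x\<close> are included so that the family is closed under
  differentiation up to linear combinations.\<close>

lemma flat_deriv:
  "(flat n has_real_derivative flat (n + 2) x - real n * flat (n + 1) x) (at x)"
proof -
  consider "x > 0" | "x < 0" | "x = 0" by linarith
  then show ?thesis
  proof cases
    case 1
    have "((\<lambda>x. inverse x ^ n * exp (- inverse x)) has_real_derivative flat (n + 2) x -
        real n * flat (n + 1) x) (at x)"
      using 1 by (auto intro!: derivative_eq_intros simp: flat_def field_simps power2_eq_square)
        (cases n; simp add: field_simps)
    then show ?thesis
      by (rule DERIV_cong_ev[THEN iffD1, rotated -1, OF _ refl])
        (use 1 eventually_nhds_in_open[of "{0<..}" x] in \<open>auto simp: flat_def elim!:
            eventually_mono\<close>)
  next
    case 2
    have "((\<lambda>x. 0) has_real_derivative flat (n + 2) x - real n * flat (n + 1) x) (at x)"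
      using 2 by (simp add: flat_def)
    then show ?thesis
      by (rule DERIV_cong_ev[THEN iffD1, rotated -1, OF _ refl])
        (use 2 eventually_nhds_in_open[of "{..<0}" x] in \<open>auto simp: flat_def elim!:
            eventually_mono\<close>)
  next
    case 3
    \<comment> \<open>With u = 1 / h the right difference quotient at 0 becomes u^(n+1) / exp
      u.\<close>
    have "((\<lambda>u. u ^ (n + 1) / exp u) \<longlongrightarrow> 0) (at_top :: real filter)"
      by (rule tendsto_power_div_exp_0)
    then have "((\<lambda>h. inverse h ^ (n + 1) / exp (inverse h)) \<longlongrightarrow> 0)
        (at_right (0::real))"
      by (rule filterlim_compose) (rule filterlim_inverse_at_top_right)
    moreover have "\<forall>\<^sub>F h in at_right (0::real). inverse h ^ (n + 1) / exp (inverse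
        h) = flat n h / h"
      using eventually_at_right_less[of 0]
      by eventually_elim (simp add: flat_def exp_minus field_simps)
    ultimately have R: "((\<lambda>h. flat n h / h) \<longlongrightarrow> 0) (at_right 0)"
      by (rule Lim_transform_eventually)
    have "\<forall>\<^sub>F h in at_left (0::real). 0 = flat n h / h"
      unfolding eventually_at_filter by (auto simp: flat_def)
    then have L: "((\<lambda>h. flat n h / h) \<longlongrightarrow> 0) (at_left 0)"
      by (rule Lim_transform_eventually[OF tendsto_const])
    have "((\<lambda>h. flat n h / h) \<longlongrightarrow> 0) (at 0)" using L R by (rule
        filterlim_split_at)
    then show ?thesis using 3 by (simp add: has_field_derivative_iff flat_def)
  qed
qed

lemma smooth1_flat: "smooth1 (flat n)"
proof -
  define G where "G = range flat \<union> range (\<lambda>c x. c)"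
  have c: "(\<lambda>x. c) \<in> gen G" for c by (rule gen_base) (auto simp: G_def)
  have f: "flat n \<in> gen G" for n by (rule gen_base) (auto simp: G_def)
  show ?thesis
  proof (rule smooth1_gen[where G = G])
    fix g assume "g \<in> G"
    then consider n where "g = flat n" | k where "g = (\<lambda>x. k)" by (auto simp: G_def)
    then show "\<exists>g'\<in>gen G. \<forall>x. (g has_real_derivative g' x) (at x)"
    proof cases
      case 1
      have "(\<lambda>x. flat (n + 2) x + (- real n) * flat (n + 1) x) \<in> gen G"
        by (intro gen_add gen_mult f c)
      then show ?thesis using flat_deriv[of n] 1 by (intro bexI) auto
    next
      case 2
      then show ?thesis by (intro bexI[of _ "\<lambda>x. 0"]) (auto intro: c)
    qed
  qed (rule f)
qed

lemma flat0_nonneg: "0 \<le> flat 0 x"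
  by (simp add: flat_def)

lemma flat0_mono: "x \<le> y \<Longrightarrow> flat 0 x \<le> flat 0 y"
  by (auto simp: flat_def le_imp_inverse_le)

text \<open>Nesting the flat function gives a smooth step without a quotient.\<close>

definition sstep :: "real \<Rightarrow> real" where
  "sstep t = inverse (flat 0 (flat 0 1)) * flat 0 (flat 0 1 - flat 0 (1 - t))"

lemma smooth1_sstep: "smooth1 sstep"
proof -
  have "smooth1 (\<lambda>t. flat 0 1 + (-1) * flat 0 (-1 * t + 1))"
    by (rule smooth1_add[OF smooth1_const smooth1_mult[OF smooth1_const smooth1_affine_compose[OF
        smooth1_flat]]])
  from smooth1_mult[OF smooth1_const smooth1_compose[OF smooth1_flat this], of "inverse (flat 0
      (flat 0 1))" 0]
  show ?thesis by (simp add: sstep_def[abs_def])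
qed

lemma sstep_eq_0: "t \<le> 0 \<Longrightarrow> sstep t = 0"
  using flat0_mono[of 1 "1 - t"] by (simp add: sstep_def) (simp add: flat_def)

lemma sstep_eq_1: "1 \<le> t \<Longrightarrow> sstep t = 1"
proof -
  assume "1 \<le> t"
  then have "flat 0 (1 - t) = 0" by (simp add: flat_def)
  moreover have "flat 0 (flat 0 1) \<noteq> 0" by (simp add: flat_def)
  ultimately show ?thesis by (simp add: sstep_def)
qed

lemma sstep_nonneg: "0 \<le> sstep t"
  by (simp add: sstep_def flat0_nonneg)

lemma sstep_le_1: "sstep t \<le> 1"
proof -
  have "flat 0 (flat 0 1 - flat 0 (1 - t)) \<le> flat 0 (flat 0 1)"
    by (rule flat0_mono) (simp add: flat0_nonneg)
  moreover have "0 < flat 0 (flat 0 1)" by (simp add: flat_def)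
  ultimately show ?thesis by (simp add: sstep_def field_simps)
qed

text \<open>The factor 8 makes each flank 1/8 wide: the function rises between -3/8 and -1/4 and
  falls between 1/2 and 5/8.\<close>

definition bump :: "real \<Rightarrow> real" where
  "bump t = sstep (8 * t + 3) * sstep (- 8 * t + 5)"

lemma smooth1_bump: "smooth1 bump"
  unfolding bump_def[abs_def] by (rule smooth1_mult; rule smooth1_affine_compose; rule
      smooth1_sstep)

lemma bump_eq_1: "-1/4 \<le> t \<Longrightarrow> t \<le> 1/2 \<Longrightarrow> bump t = 1"
  by (simp add: bump_def sstep_eq_1)

lemma bump_nonzeroD: "bump t \<noteq> 0 \<Longrightarrow> -3/8 < t \<and> t < 5/8"
proof (rule ccontr)
  assume "bump t \<noteq> 0" "\<not> (-3/8 < t \<and> t < 5/8)"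
  then show False using sstep_eq_0[of "8 * t + 3"] sstep_eq_0[of "- 8 * t + 5"]
    by (auto simp: bump_def)
qed

lemma bump_nonneg: "0 \<le> bump t"
  by (simp add: bump_def sstep_nonneg)

lemma bump_le_1: "bump t \<le> 1"
  by (simp add: bump_def sstep_nonneg sstep_le_1 mult_le_one)

section \<open>Smooth maps of the plane built from functions of one variable\<close>

inductive_set sep :: "(real^2 \<Rightarrow> real^2) set" where
  sep_base: "smooth1 G \<Longrightarrow> smooth1 H \<Longrightarrow> (\<lambda>x. (G (x $ 1) * H
      (x $ 2)) *\<^sub>R e) \<in> sep"
| sep_add: "f \<in> sep \<Longrightarrow> g \<in> sep \<Longrightarrow> (\<lambda>x. f x + g x)
    \<in> sep"

lemma sep_sum: "finite I \<Longrightarrow> (\<And>i. i \<in> I \<Longrightarrow> f i \<in> sep)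
    \<Longrightarrow> (\<lambda>x. \<Sum>i\<in>I. f i x) \<in> sep"
proof (induction I rule: finite_induct)
  case empty
  show ?case using sep_base[OF smooth1_const[of 0] smooth1_const[of 0]] by simp
next
  case (insert i I)
  then show ?case using sep_add[of "f i" "\<lambda>x. \<Sum>i\<in>I. f i x"] by simp
qed

lemma smooth1_continuous: "smooth1 f \<Longrightarrow> isCont f x"
  using smooth1D DERIV_isCont by blast

lemma sep_continuous: "f \<in> sep \<Longrightarrow> continuous_on UNIV f"
proof (induction rule: sep.induct)
  case (sep_base G H e)
  have *: "continuous_on UNIV (\<lambda>x::real^2. F (x $ i))" if "smooth1 F" for F i
  proof (rule continuous_on_compose2[of UNIV F UNIV "\<lambda>x. x $ i"])
    show "continuous_on UNIV F" using smooth1_continuous[OF that] by (simp add: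
        continuous_at_imp_continuous_on)
    show "continuous_on UNIV (\<lambda>x::real^2. x $ i)" by (intro continuous_intros)
  qed simp
  show ?case
    by (intro continuous_on_scaleR continuous_on_mult continuous_on_const * sep_base)
next
  case (sep_add f g)
  then show ?case by (intro continuous_on_add)
qed

text \<open>The directional derivative of a product of this form is a sum of two such products.
  Hence iterated derivatives stay in the class, and their continuity reduces to that of functions of
  one variable.\<close>

lemma sep_derivative:
  assumes "f \<in> sep"
  shows "\<exists>f'\<in>sep. \<forall>x. ((\<lambda>t. f (x + t *\<^sub>R v))
      has_vector_derivative f' x) (at 0)"
  using assms
proof (induction rule: sep.induct)
  case (sep_base G H e)
  obtain G' where G': "smooth1 G'" "\<And>x. (G has_real_derivative G' x) (at x)"
    using smooth1D[OF sep_base(1)] by blast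
  obtain H' where H': "smooth1 H'" "\<And>x. (H has_real_derivative H' x) (at x)"
    using smooth1D[OF sep_base(2)] by blast
  let ?f' = "\<lambda>x. ((v $ 1 * G' (x $ 1)) * H (x $ 2)) *\<^sub>R e + (G (x $ 1) * (v $ 2 * H'
      (x $ 2))) *\<^sub>R e"
  have "?f' \<in> sep"
    by (intro sep.intros smooth1_mult smooth1_const sep_base G' H')
  moreover have "((\<lambda>t. (G ((x + t *\<^sub>R v) $ 1) * H ((x + t *\<^sub>R v) $ 2))
      *\<^sub>R e) has_vector_derivative ?f' x) (at 0)" for x
  proof -
    have l: "((\<lambda>t. x $ i + t * v $ i) has_real_derivative v $ i) (at 0)" for i
      by (auto intro!: derivative_eq_intros)
    have "((\<lambda>t. G (x $ 1 + t * v $ 1)) has_real_derivative G' (x $ 1) * v $ 1) (at 0)"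
      using DERIV_chain2[OF _ l, of G _ 1] G'(2)[of "x $ 1"] by simp
    moreover have "((\<lambda>t. H (x $ 2 + t * v $ 2)) has_real_derivative H' (x $ 2) * v $ 2)
        (at 0)"
      using DERIV_chain2[OF _ l, of H _ 2] H'(2)[of "x $ 2"] by simp
    ultimately have "((\<lambda>t. G (x $ 1 + t * v $ 1) * H (x $ 2 + t * v $ 2))
        has_real_derivative
        v $ 1 * G' (x $ 1) * H (x $ 2) + G (x $ 1) * (v $ 2 * H' (x $ 2))) (at 0)"
      by (auto intro!: derivative_eq_intros)
    from has_vector_derivative_scaleR[OF this has_vector_derivative_const[of e]]
    show ?thesis by (simp add: scaleR_add_left)
  qed
  ultimately show ?case by (intro bexI[of _ ?f'] allI)
next
  case (sep_add f g)
  then obtain f' g' where *: "f' \<in> sep" "\<And>x. ((\<lambda>t. f (x + t *\<^sub>R v))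
      has_vector_derivative f' x) (at 0)"
    "g' \<in> sep" "\<And>x. ((\<lambda>t. g (x + t *\<^sub>R v)) has_vector_derivative g' x) (at
        0)" by blast
  show ?case
    by (rule bexI[of _ "\<lambda>x. f' x + g' x"]) (use * in \<open>auto intro!:
        has_vector_derivative_add sep.intros\<close>)
qed

lemma sep_pd: "f \<in> sep \<Longrightarrow> pd f vs \<in> sep"
proof (induction vs)
  case (Cons v vs)
  then obtain g where g: "g \<in> sep" "\<And>x. ((\<lambda>t. pd f vs (x + t *\<^sub>R v))
      has_vector_derivative g x) (at 0)"
    using sep_derivative by blast
  then have "pd f (v # vs) = g" by (auto simp: fun_eq_iff intro: vector_derivative_at)
  then show ?case using g by simp
qed simp

lemma sep_smooth: "f \<in> sep \<Longrightarrow> smooth_on UNIV f"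
  unfolding smooth_on_def
  using sep_pd sep_continuous sep_derivative differentiableI_vector by (metis open_UNIV)

subsection \<open>Stacks of digits encoded by real intervals\<close>

text \<open>Radix B expansions, top digit first. Popping from a point of the interval of a stack
  leaves a remainder between -1/4 and 1/2, so the top digit can be read off; see
      \<open>pop_ok\<close> below.\<close>

fun stk :: "nat \<Rightarrow> nat list \<Rightarrow> real set" where
  "stk B [] = {t. -1/4 \<le> real B * t \<and> real B * t \<le> 1/4}"
| "stk B (d # ds) = {t. real B * t - real d \<in> stk B ds}"

fun ctr :: "nat \<Rightarrow> nat list \<Rightarrow> real" where
  "ctr B [] = 0"
| "ctr B (d # ds) = (ctr B ds + real d) / real B"

text \<open>A push is affine with slope 1 / B, so every digit divides the width by B. The width
  stays positive, which is what robustness needs.\<close>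

lemma stk_interval:
  assumes "B > 0"
  shows "stk B ds = {ctr B ds - 1 / (4 * real B ^ (length ds + 1)) .. ctr B ds + 1 / (4 * real B ^
      (length ds + 1))}"
proof (induction ds)
  case Nil
  then show ?case using assms by (auto simp: field_simps)
next
  case (Cons d ds)
  define w where "w = 1 / (4 * real B ^ (length ds + 1))"
  have w: "1 / (4 * real B ^ (length (d # ds) + 1)) = w / real B" by (simp add: w_def)
  have e: "ctr B (d # ds) - w / real B = (ctr B ds + real d - w) / real B"
    "ctr B (d # ds) + w / real B = (ctr B ds + real d + w) / real B"
    by (simp_all add: diff_divide_distrib add_divide_distrib)
  have "ctr B ds - w \<le> real B * t - real d \<longleftrightarrow> ctr B (d # ds) - w / real B
      \<le> t"
    "real B * t - real d \<le> ctr B ds + w \<longleftrightarrow> t \<le> ctr B (d # ds) + w /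
        real B" for t
    unfolding e using assms by (auto simp: pos_divide_le_eq pos_le_divide_eq algebra_simps)
  then show ?case using Cons unfolding w w_def[symmetric] by auto
qed

lemma stk_push: "B > 0 \<Longrightarrow> t \<in> stk B ds \<Longrightarrow> (t + real d) / real B
    \<in> stk B (d # ds)"
  by simp

text \<open>The bounds survive a push: a digit and a remainder of at most K and 1/2 give at most (K
  + 1/2) / B, while digits from 1 on keep nonempty stacks positive.\<close>

lemma stk_bounds:
  assumes B: "B \<ge> 4 * K + 4" and ds: "set ds \<subseteq> {1..K}" and t: "t \<in> stk B ds"
  shows "-1/4 \<le> t \<and> t \<le> 1/2"
  using ds t
proof (induction ds arbitrary: t)
  case Nil
  have B4: "real B \<ge> 4" using B by simp
  moreover have "-1/4 \<le> real B * t" "real B * t \<le> 1/4" using Nil by auto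
  ultimately have "real B * t \<le> real B * (1/2)" "real B * (-1/4) \<le> real B * t" by linarith+
  moreover have "0 < real B" using B4 by linarith
  ultimately show ?case by (simp only: mult_le_cancel_left_pos)
next
  case (Cons d ds)
  have "real (4 * K + 4) \<le> real B" using B by (simp only: of_nat_le_iff)
  then have B4: "real B \<ge> 4 * real K + 4" by simp
  have d: "1 \<le> real d" "real d \<le> real K" using Cons by auto
  have "-1/4 \<le> real B * t - real d \<and> real B * t - real d \<le> 1/2"
    by (rule Cons.IH) (use Cons.prems in auto)
  then have "real B * (-1/4) \<le> real B * t" "real B * t \<le> real B * (1/2)" using d B4 by
      linarith+
  moreover have "0 < real B" using B4 by linarith
  ultimately show ?case by (simp only: mult_le_cancel_left_pos)
qed

text \<open>The window for the remainder has length 3/4, so at most one digit fits. For digits from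
  1 on \<open>B * t\<close> is at least 3/4, away from the values up to 1/4 of the empty
  stack.\<close>

definition pop_ok :: "nat \<Rightarrow> nat \<Rightarrow> real \<Rightarrow> bool" where
  "pop_ok B d t \<longleftrightarrow> -1/4 \<le> real B * t - real d \<and> real B * t - real d
      \<le> 1/2"

lemma stk_pop_ok:
  assumes "B \<ge> 4 * K + 4" "set (d # ds) \<subseteq> {1..K}" "t \<in> stk B (d # ds)"
  shows "pop_ok B d t"
  using stk_bounds[OF assms(1), of ds "real B * t - real d"] assms(2,3) by (simp add: pop_ok_def)

lemma pop_ok_unique: "pop_ok B d t \<Longrightarrow> pop_ok B e t \<Longrightarrow> d = e"
  unfolding pop_ok_def by linarith

lemma pop_ok_nonempty: "pop_ok B d t \<Longrightarrow> 1 \<le> d \<Longrightarrow> t \<notin> stk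
    B []"
  by (auto simp: pop_ok_def)

lemma stk_unique:
  assumes "B \<ge> 4 * K + 4" "set ds \<subseteq> {1..K}" "set es \<subseteq> {1..K}" "t \<in> stk
      B ds" "t \<in> stk B es"
  shows "ds = es"
  using assms(2-)
proof (induction ds arbitrary: es t)
  case Nil
  show ?case
  proof (cases es)
    case (Cons e es')
    then have "pop_ok B e t" "1 \<le> e" using stk_pop_ok[OF assms(1)] Nil by auto
    then show ?thesis using pop_ok_nonempty Nil by blast
  qed simp
next
  case (Cons d ds)
  have d: "pop_ok B d t" "1 \<le> d" using stk_pop_ok[OF assms(1) Cons.prems(1,3)] Cons.prems by
      auto
  show ?case
  proof (cases es)
    case Nil
    then show ?thesis using pop_ok_nonempty[OF d] Cons.prems by blast
  next
    case (Cons e es')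
    then have "pop_ok B e t" using stk_pop_ok[OF assms(1)] Cons.prems by blast
    then have e: "d = e" using pop_ok_unique d by blast
    show ?thesis using Cons.IH[of es' "real B * t - real d"] Cons.prems Cons e by auto
  qed
qed

subsection \<open>Register machines without constants\<close>

text \<open>A machine whose real head never moves works on a window of four registers. The last one
  holds 1, obtained as the positive solution of y * y = y; multiplication by natural numbers is
  repeated addition and divisions are put on the other side of the defining equation. Hence no
  machine constants occur at all.\<close>

datatype upd = Keep | Zero | Unit | Pop nat | Push nat

datatype guard = GTrue | GDig nat nat | GEnd nat

datatype spec = Spec guard upd upd upd upd nat nat int

text \<open>The base case is \<open>p - p\<close>, a zero that mentions no constant.\<close>

fun pmul :: "nat \<Rightarrow> pexpr \<Rightarrow> pexpr" where
  "pmul 0 p = PAdd p (PNeg p)"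
| "pmul (Suc n) p = PAdd p (pmul n p)"

definition psub :: "pexpr \<Rightarrow> pexpr \<Rightarrow> pexpr" where
  "psub p q = PAdd p (PNeg q)"

lemma peval_pmul [simp]: "peval (pmul n p) x = real n * peval p x"
  by (induction n) (auto simp: algebra_simps)

lemma pvars_pmul [simp]: "pvars (pmul n p) = pvars p"
  by (induction n) auto

lemma pconsts_pmul [simp]: "pconsts (pmul n p) = pconsts p"
  by (induction n) auto

lemma psub_simps [simp]:
  "peval (psub p q) x = peval p x - peval q x"
  "pvars (psub p q) = pvars p \<union> pvars q"
  "pconsts (psub p q) = pconsts p \<union> pconsts q"
  by (auto simp: psub_def)

text \<open>\<open>PV (4 + i)\<close> is the new content of register \<open>i\<close>, since the
  graph variables list the old window of four cells first.\<close>

fun uform :: "nat \<Rightarrow> upd \<Rightarrow> nat \<Rightarrow> sform" where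
  "uform B Keep i = FZero (psub (PV (4 + i)) (PV i))"
| "uform B Zero i = FZero (PV (4 + i))"
| "uform B Unit i = FAnd (FPos (PV (4 + i))) (FZero (psub (PMul (PV (4 + i)) (PV (4 + i))) (PV (4
    + i))))"
| "uform B (Pop d) i = FZero (psub (PV (4 + i)) (psub (pmul B (PV i)) (pmul d (PV 3))))"
| "uform B (Push d) i = FZero (psub (pmul B (PV (4 + i))) (PAdd (PV i) (pmul d (PV 3))))"

fun uval :: "nat \<Rightarrow> upd \<Rightarrow> nat \<Rightarrow> (nat \<Rightarrow> real)
    \<Rightarrow> real" where
  "uval B Keep i x = x i"
| "uval B Zero i x = 0"
| "uval B Unit i x = 1"
| "uval B (Pop d) i x = real B * x i - real d * x 3"
| "uval B (Push d) i x = (x i + real d * x 3) / real B"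

lemma sholds_uform:
  assumes "B > 0" "i < 4"
  shows "sholds (uform B u i) (graph_env 4 x ys) \<longleftrightarrow> ys ! i = uval B u i x"
proof (cases u)
  case Unit
  have "y > 0 \<and> y * y - y = 0 \<longleftrightarrow> y = (1::real)" for y
    by (auto simp: algebra_simps)
  then show ?thesis using assms Unit by (simp add: graph_env_def)
qed (use assms in \<open>auto simp: graph_env_def field_simps\<close>)

text \<open>The unit register \<open>PV 3\<close> stands for 1, and the fractions 1/4 and 1/2 are
  cleared by multiplication. These tests are correct only after that register has been set;
  \<open>GTrue\<close> is correct always.\<close>

fun gform :: "nat \<Rightarrow> guard \<Rightarrow> sform" where
  "gform B GTrue = FNot (FPos (psub (PV 0) (PV 0)))"
| "gform B (GDig i d) =
    (let e = psub (pmul B (PV i)) (pmul d (PV 3)) in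
     FAnd (FNot (FPos (psub (PNeg (PV 3)) (pmul 4 e)))) (FNot (FPos (psub (pmul 2 e) (PV 3)))))"
| "gform B (GEnd i) =
    (let e = pmul 4 (pmul B (PV i)) in
     FAnd (FNot (FPos (psub (PNeg (PV 3)) e))) (FNot (FPos (psub e (PV 3)))))"

type_synonym regs = "real \<times> real \<times> real \<times> real"

definition rg :: "regs \<Rightarrow> nat \<Rightarrow> real" where
  "rg v i = (case v of (x, y, z, u) \<Rightarrow> if i = 0 then x else if i = 1 then y else if i =
      2 then z
     else if i = 3 then u else 0)"

lemma rg_simps [simp]:
  "rg (x, y, z, u) 0 = x" "rg (x, y, z, u) (Suc 0) = y" "rg (x, y, z, u) 2 = z" "rg (x, y, z, u) 3
      = u"
  "rg (0, 0, 0, 0) i = 0"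
  by (auto simp: rg_def)

fun gval :: "nat \<Rightarrow> guard \<Rightarrow> (nat \<Rightarrow> real) \<Rightarrow> bool"
    where
  "gval B GTrue x = True"
| "gval B (GDig i d) x = pop_ok B d (x i)"
| "gval B (GEnd i) x = (x i \<in> stk B [])"

lemma sholds_gform: "g = GTrue \<or> x 3 = 1 \<Longrightarrow> sholds (gform B g) x
    \<longleftrightarrow> gval B g x"
  by (cases g) (auto simp: Let_def pop_ok_def)

fun sgd :: "spec \<Rightarrow> guard" where "sgd (Spec g _ _ _ _ _ _ _) = g"

fun mkbr :: "nat \<Rightarrow> spec \<Rightarrow> branch" where
  "mkbr B (Spec g a b c d s y m) = Branch (gform B g)
     (FAnd (FAnd (uform B a 0) (uform B b 1)) (FAnd (uform B c 2) (uform B d 3))) s y 0 m"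

definition mach :: "nat \<Rightarrow> nat \<Rightarrow> nat \<Rightarrow> nat \<Rightarrow> (nat
    \<Rightarrow> nat \<Rightarrow> spec list) \<Rightarrow> hbss" where
  "mach B K n h rules = \<lparr>bss_nst = n, bss_d = Suc K, bss_w = 4, bss_start = 0, bss_halt = h,
     bss_rules = (\<lambda>q a. map (mkbr B) (rules q a))\<rparr>"

definition mkc :: "nat \<Rightarrow> regs \<Rightarrow> (int \<Rightarrow> nat) \<Rightarrow> int
    \<Rightarrow> hconf" where
  "mkc q v dt dh = \<lparr>hc_state = q, hc_rtape = (\<lambda>j. if 0 \<le> j then rg v (nat j)
      else 0), hc_rhead = 0,
     hc_dtape = dt, hc_dhead = dh\<rparr>"

lemma list4_eq: "length ys = 4 \<Longrightarrow> ys = [a, b, c, d] \<longleftrightarrow> ys ! 0 =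
    a \<and> ys ! 1 = b \<and> ys ! 2 = c \<and> ys ! 3 = d"
  by (auto simp: list_eq_iff_nth_eq less_Suc_eq numeral_eq_Suc)

lemma graph_unique:
  assumes "B > 0"
  shows "length ys = 4 \<and> sholds (br_graph (mkbr B (Spec g a b c d s y m))) (graph_env 4 x ys)
      \<longleftrightarrow>
    ys = [uval B a 0 x, uval B b 1 x, uval B c 2 x, uval B d 3 x]"
proof (cases "length ys = 4")
  case True
  then show ?thesis
    using sholds_uform[OF assms, of 0 a x ys] sholds_uform[OF assms, of 1 b x ys]
      sholds_uform[OF assms, of 2 c x ys] sholds_uform[OF assms, of 3 d x ys] list4_eq[OF True]
    by auto
qed auto

fun spec_ok :: "nat \<Rightarrow> nat \<Rightarrow> spec \<Rightarrow> bool" where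
  "spec_ok K n (Spec g a b c d s y m) \<longleftrightarrow> s < n \<and> y \<le> K \<and> m \<in>
      {-1, 0, 1} \<and>
     (case g of GTrue \<Rightarrow> True | GDig i d \<Rightarrow> i < 4 | GEnd i \<Rightarrow> i <
         4)"

lemma uform_vars: "i < 4 \<Longrightarrow> svars (uform B u i) \<subseteq> {..<8}" "sconsts (uform
    B u i) = {}"
  by (cases u; auto)+

lemma wf_mach:
  assumes "B > 0" "K \<ge> 1" "h < n"
    and ok: "\<And>q a sp. q < n \<Longrightarrow> a \<le> K \<Longrightarrow> sp \<in> set (rules
        q a) \<Longrightarrow> spec_ok K n sp"
  shows "wf_hbss (mach B K n h rules)"
proof -
  let ?P = "mach B K n h rules"
  have "br_state br < n \<and> br_sym br < Suc K \<and>
        br_rmove br \<in> {-1, 0, 1} \<and> br_dmove br \<in> {-1, 0, 1} \<and>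
        svars (br_guard br) \<subseteq> {..<4} \<and> svars (br_graph br) \<subseteq> {..<2 * 4}
            \<and>
        (\<forall>x. sholds (br_guard br) x \<longrightarrow>
           (\<exists>!ys. length ys = 4 \<and> sholds (br_graph br) (graph_env 4 x ys))) \<and>
        (\<forall>c \<in> sconsts (br_guard br) \<union> sconsts (br_graph br). computable_real c)"
    if qa: "q < n" "a < Suc K" and mem: "br \<in> set (map (mkbr B) (rules q a))" for q a br
  proof -
    obtain sp where sp0: "br = mkbr B sp" "sp \<in> set (rules q a)" using mem by auto
    obtain g u1 u2 u3 u4 s y m where sp1: "sp = Spec g u1 u2 u3 u4 s y m" by (cases sp)
    have br: "br = mkbr B (Spec g u1 u2 u3 u4 s y m)" using sp0(1) sp1 by simp
    have sp: "spec_ok K n (Spec g u1 u2 u3 u4 s y m)" using ok[OF qa(1) _ sp0(2)] qa(2) sp1 by simp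
    have "svars (gform B g) \<subseteq> {..<4}" "sconsts (gform B g) = {}"
      using sp by (cases g; auto simp: Let_def)+
    moreover have "\<exists>!ys. length ys = 4 \<and> sholds (br_graph br) (graph_env 4 x ys)" for x
      unfolding br graph_unique[OF assms(1)] by simp
    ultimately show ?thesis using sp uform_vars(1)[of 0 B u1] uform_vars(1)[of 1 B u2]
        uform_vars(1)[of 2 B u3] uform_vars(1)[of 3 B u4] by (simp add: br uform_vars(2))
  qed
  then show ?thesis using assms unfolding wf_hbss_def mach_def by simp
qed

fun apply_spec :: "nat \<Rightarrow> spec \<Rightarrow> regs \<Rightarrow> (int \<Rightarrow> nat)
    \<Rightarrow> int \<Rightarrow> hconf" where
  "apply_spec B (Spec g a b c d s y m) v dt dh =
     mkc s (uval B a 0 (rg v), uval B b 1 (rg v), uval B c 2 (rg v), uval B d 3 (rg v)) (dt(dh :=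
         y)) (dh + m)"

text \<open>The condition on the guards is met because the initial state, the only one entered
  before the unit register is set, has \<open>GTrue\<close> as its guard.\<close>

lemma mach_step:
  assumes B: "B > 0" and q: "q \<noteq> h" "q < n" "dt dh \<le> K"
    and g: "\<And>sp. sp \<in> set (rules q (dt dh)) \<Longrightarrow> sgd sp = GTrue \<or> rg v 3
        = 1"
  shows "hbss_step (mach B K n h rules) (mkc q v dt dh) =
    (case find (\<lambda>sp. gval B (sgd sp) (rg v)) (rules q (dt dh)) of
       None \<Rightarrow> mkc q v dt dh | Some sp \<Rightarrow> apply_spec B sp v dt dh)"
proof -
  have guard: "sholds (br_guard (mkbr B sp)) (rg v) \<longleftrightarrow> gval B (sgd sp) (rg v)"
      if "sp \<in> set (rules q (dt dh))" for sp
    using sholds_gform[of "sgd sp" "rg v" B] g[OF that] by (cases sp) simp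
  have "find (\<lambda>br. sholds (br_guard br) (rg v)) (map (mkbr B) sps) =
      map_option (mkbr B) (find (\<lambda>sp. gval B (sgd sp) (rg v)) sps)"
    if "set sps \<subseteq> set (rules q (dt dh))" for sps
    using that by (induction sps) (auto simp: guard)
  then have f: "find (\<lambda>br. sholds (br_guard br) (rg v)) (map (mkbr B) (rules q (dt dh))) =
      map_option (mkbr B) (find (\<lambda>sp. gval B (sgd sp) (rg v)) (rules q (dt dh)))" by simp
  show ?thesis
  proof (cases "find (\<lambda>sp. gval B (sgd sp) (rg v)) (rules q (dt dh))")
    case None
    then show ?thesis using q f by (simp add: hbss_step_def mach_def mkc_def Let_def)
  next
    case (Some sp)
    obtain gu a b c d s y m where sp: "sp = Spec gu a b c d s y m" by (cases sp)
    let ?ys = "[uval B a 0 (rg v), uval B b 1 (rg v), uval B c 2 (rg v), uval B d 3 (rg v)]"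
    have the: "(THE ys. length ys = 4 \<and> sholds (br_graph (mkbr B sp)) (graph_env 4 (rg v)
        ys)) = ?ys"
      unfolding sp graph_unique[OF B] by simp
    have tape: "(if 0 \<le> j \<and> j < 4 then ?ys ! nat j else if 0 \<le> j then rg v (nat j)
        else 0) =
        (if 0 \<le> j then rg (uval B a 0 (rg v), uval B b 1 (rg v), uval B c 2 (rg v), uval B d 3
            (rg v)) (nat j) else 0)" for j :: int
    proof -
      consider "j < 0" | "j = 0" | "j = 1" | "j = 2" | "j = 3" | "j > 3" by linarith
      then show ?thesis by cases (auto simp: rg_def numeral_eq_Suc split: prod.splits)
    qed
    have st: "br_state (mkbr B sp) = s" "br_sym (mkbr B sp) = y" "br_rmove (mkbr B sp) = 0"
        "br_dmove (mkbr B sp) = m"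
      by (simp_all add: sp)
    have "hbss_step (mach B K n h rules) (mkc q v dt dh) =
      \<lparr>hc_state = s, hc_rtape = (\<lambda>j. if 0 \<le> j \<and> j < 4 then ?ys ! nat j
          else if 0 \<le> j then rg v (nat j) else 0),
       hc_rhead = 0, hc_dtape = dt(dh := y), hc_dhead = dh + m\<rparr>"
      using q f Some the st by (simp add: hbss_step_def mach_def mkc_def Let_def) (rule ext, simp)
    then show ?thesis unfolding tape using Some by (simp add: sp mkc_def cong: if_cong)
  qed
qed

lemma hbss_run_add: "hbss_run P c (m + n) = hbss_run P (hbss_run P c m) n"
  by (simp add: hbss_run_def funpow_add add.commute[of m n])

lemma hbss_run_0: "hbss_run P c 0 = c"
  by (simp add: hbss_run_def)

lemma hbss_run_Suc: "hbss_run P c (Suc n) = hbss_run P (hbss_step P c) n"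
  by (simp add: hbss_run_def funpow_swap1)

lemma hbss_run_Suc2: "hbss_run P c (Suc n) = hbss_step P (hbss_run P c n)"
  by (simp add: hbss_run_def)

lemma hbss_run_halted: "hc_state c = bss_halt P \<Longrightarrow> hbss_run P c n = c"
  by (induction n) (simp_all add: hbss_run_def hbss_step_def Let_def)

lemma hbss_halts_run:
  assumes "hbss_halts P c"
  shows "hbss_halts P (hbss_run P c k)"
proof -
  obtain n where "hc_state (hbss_run P c n) = bss_halt P" using assms by (auto simp: hbss_halts_def)
  then have "hc_state (hbss_run P c (n + k)) = bss_halt P" using hbss_run_halted by (simp add:
      hbss_run_add)
  then show ?thesis unfolding hbss_halts_def by (auto simp: hbss_run_add[symmetric] add.commute[of
      n k])
qed

lemma hbss_final_eq:
  assumes "hc_state (hbss_run P c n) = bss_halt P"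
  shows "hbss_halts P c" "hbss_time P c \<le> n" "hbss_final P c = hbss_run P c n"
proof -
  show "hbss_halts P c" using assms by (auto simp: hbss_halts_def)
  show le: "hbss_time P c \<le> n" unfolding hbss_time_def using assms by (rule Least_le)
  have "hc_state (hbss_run P c (hbss_time P c)) = bss_halt P"
    unfolding hbss_time_def using assms by (rule LeastI)
  then have "hbss_run P c (hbss_time P c + (n - hbss_time P c)) = hbss_run P c (hbss_time P c)"
    unfolding hbss_run_add by (rule hbss_run_halted)
  then show "hbss_final P c = hbss_run P c n" using le by (simp add: hbss_final_def)
qed

lemma find_map_unique:
  assumes "d \<in> set ds" "P (f d)" "\<And>e. e \<in> set ds \<Longrightarrow> P (f e)
      \<Longrightarrow> e = d"
  shows "find P (map f ds) = Some (f d)"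
  using assms
proof (induction ds)
  case (Cons x xs)
  show ?case
  proof (cases "P (f x)")
    case True
    then have "x = d" by (intro Cons.prems(3)) simp
    then show ?thesis using True by simp
  next
    case False
    then have "x \<noteq> d" using Cons.prems(2) by blast
    then have "find P (map f xs) = Some (f d)" using Cons.prems by (intro Cons.IH) simp_all
    then show ?thesis using False by simp
  qed
qed simp

lemma find_map_none: "(\<And>e. e \<in> set ds \<Longrightarrow> \<not> P (f e)) \<Longrightarrow>
    find P (map f ds) = None"
  by (simp add: find_None_iff)

declare upt_Suc [simp del]

section \<open>The decoding machine\<close>

context
  fixes ns nq :: nat
begin

definition max_digit :: nat where "max_digit = ns + nq"
definition radix :: nat where "radix = 4 * max_digit + 4"

lemma radix_pos: "radix > 0" by (simp add: radix_def)

text \<open>States 1 and 2 move the state digit and then the left stack onto register 2, which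
  restores the left-to-right order; states 3 and 4 print registers 2 and 1. Where no rule applies
  the machine repeats its configuration forever, as it must outside the domain. The final
  \<open>Unit\<close> leaves 1 in register 0, so that the same machine also computes the
  slowdown.\<close>

definition dec_rules :: "nat \<Rightarrow> nat \<Rightarrow> spec list" where
  "dec_rules q a =
    (if q = 0 then [Spec GTrue Keep Keep Zero Unit 1 0 0]
     else if q = 1 then map (\<lambda>d. Spec (GDig 0 d) (Pop d) Keep (Push d) Keep 2 0 0) [ns +
         1..<max_digit + 1]
     else if q = 2 then Spec (GEnd 0) Keep Keep Keep Keep 3 0 0 #
       map (\<lambda>d. Spec (GDig 0 d) (Pop d) Keep (Push d) Keep 2 0 0) [1..<ns + 1]
     else if q = 3 then Spec (GEnd 2) Keep Keep Keep Keep 4 0 0 #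
       map (\<lambda>d. Spec (GDig 2 d) Keep Keep (Pop d) Keep 3 d 1) [1..<max_digit + 1]
     else if q = 4 then Spec (GEnd 1) Unit Keep Keep Keep 5 0 0 #
       map (\<lambda>d. Spec (GDig 1 d) Keep (Pop d) Keep Keep 4 d 1) [1..<ns + 1]
     else [])"

definition dec :: hbss where "dec = mach radix max_digit 6 5 dec_rules"

lemma wf_dec:
  assumes "0 < ns"
  shows "wf_hbss dec"
  unfolding dec_def
proof (rule wf_mach)
  fix q a sp assume "sp \<in> set (dec_rules q a)"
  note sp = this
  consider "q = 0" | "q = 1" | "q = 2" | "q = 3" | "q = 4" | "q > 4" by linarith
  then show "spec_ok max_digit 6 sp"
  proof cases
    case 1
    then show ?thesis using sp by (simp add: dec_rules_def)
  next
    case 2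
    then have "sp \<in> (\<lambda>d. Spec (GDig 0 d) (Pop d) Keep (Push d) Keep 2 0 0) ` {ns +
        1..<max_digit + 1}"
      using sp by (simp add: dec_rules_def)
    then show ?thesis by auto
  next
    case 3
    then have "sp \<in> insert (Spec (GEnd 0) Keep Keep Keep Keep 3 0 0)
        ((\<lambda>d. Spec (GDig 0 d) (Pop d) Keep (Push d) Keep 2 0 0) ` {1..<ns + 1})"
      using sp by (simp add: dec_rules_def)
    then show ?thesis by auto
  next
    case 4
    then have "sp \<in> insert (Spec (GEnd 2) Keep Keep Keep Keep 4 0 0)
        ((\<lambda>d. Spec (GDig 2 d) Keep Keep (Pop d) Keep 3 d 1) ` {1..<max_digit + 1})"
      using sp by (simp add: dec_rules_def)
    then show ?thesis by auto
  next
    case 5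
    then have "sp \<in> insert (Spec (GEnd 1) Unit Keep Keep Keep 5 0 0)
        ((\<lambda>d. Spec (GDig 1 d) Keep (Pop d) Keep Keep 4 d 1) ` {1..<ns + 1})"
      using sp by (simp add: dec_rules_def)
    then show ?thesis by (auto simp: max_digit_def)
  next
    case 6
    then show ?thesis using sp by (simp add: dec_rules_def)
  qed
qed (use assms radix_pos in \<open>simp_all add: max_digit_def\<close>)

lemma dec_step:
  assumes "q < 5" "dt dh = 0" "q \<noteq> 0 \<longrightarrow> u = 1"
  shows "hbss_step dec (mkc q (x, y, z, u) dt dh) =
    (case find (\<lambda>sp. gval radix (sgd sp) (rg (x, y, z, u))) (dec_rules q 0) of
       None \<Rightarrow> mkc q (x, y, z, u) dt dh | Some sp \<Rightarrow> apply_spec radix sp (x,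
           y, z, u) dt dh)"
  using mach_step[of radix q 5 6 dt dh max_digit dec_rules "(x, y, z, u)"] assms radix_pos
  unfolding dec_def by (auto simp: dec_rules_def split: if_splits)

lemma fun_upd_zero: "dt dh = 0 \<Longrightarrow> dt(dh := (0::nat)) = dt"
  by auto

lemma dec_step0: "hbss_step dec (mkc 0 (x, y, 0, 0) (\<lambda>_. 0) 0) = mkc 1 (x, y, 0, 1)
    (\<lambda>_. 0) 0"
  using dec_step[of 0 "\<lambda>_. 0" 0 0 x y 0] by (simp add: dec_rules_def fun_upd_zero)

lemma dec_step1:
  assumes "dt dh = 0"
  shows "pop_ok radix d x \<Longrightarrow> d \<in> {ns + 1..max_digit} \<Longrightarrow>
      hbss_step dec (mkc 1 (x, y, z, 1) dt dh) = mkc 2 (real radix * x - real d, y, (z + real d) /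
          real radix, 1) dt dh"
    and "(\<And>d. d \<in> {ns + 1..max_digit} \<Longrightarrow> \<not> pop_ok radix d x)
        \<Longrightarrow>
      hbss_step dec (mkc 1 (x, y, z, 1) dt dh) = mkc 1 (x, y, z, 1) dt dh"
proof -
  let ?f = "\<lambda>d. Spec (GDig 0 d) (Pop d) Keep (Push d) Keep 2 0 0"
  let ?P = "\<lambda>sp. gval radix (sgd sp) (rg (x, y, z, 1))"
  show "hbss_step dec (mkc 1 (x, y, z, 1) dt dh) = mkc 2 (real radix * x - real d, y, (z + real d)
      / real radix, 1) dt dh"
    if "pop_ok radix d x" "d \<in> {ns + 1..max_digit}"
  proof -
    have "find ?P (map ?f [ns + 1..<max_digit + 1]) = Some (?f d)"
      by (rule find_map_unique) (use that pop_ok_unique in auto)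
    then show ?thesis using dec_step[of 1 dt dh 1 x y z] assms by (simp add: dec_rules_def
        fun_upd_zero)
  qed
  show "hbss_step dec (mkc 1 (x, y, z, 1) dt dh) = mkc 1 (x, y, z, 1) dt dh"
    if "\<And>d. d \<in> {ns + 1..max_digit} \<Longrightarrow> \<not> pop_ok radix d x"
  proof -
    have "find ?P (map ?f [ns + 1..<max_digit + 1]) = None"
      by (rule find_map_none) (use that in auto)
    then show ?thesis using dec_step[of 1 dt dh 1 x y z] assms by (simp add: dec_rules_def)
  qed
qed

lemma dec_step2:
  assumes "dt dh = 0"
  shows "x \<in> stk radix [] \<Longrightarrow> hbss_step dec (mkc 2 (x, y, z, 1) dt dh) = mkc 3
      (x, y, z, 1) dt dh"
    and "pop_ok radix d x \<Longrightarrow> d \<in> {1..ns} \<Longrightarrow>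
      hbss_step dec (mkc 2 (x, y, z, 1) dt dh) = mkc 2 (real radix * x - real d, y, (z + real d) /
          real radix, 1) dt dh"
    and "x \<notin> stk radix [] \<Longrightarrow> (\<And>d. d \<in> {1..ns} \<Longrightarrow>
        \<not> pop_ok radix d x) \<Longrightarrow>
      hbss_step dec (mkc 2 (x, y, z, 1) dt dh) = mkc 2 (x, y, z, 1) dt dh"
proof -
  let ?f = "\<lambda>d. Spec (GDig 0 d) (Pop d) Keep (Push d) Keep 2 0 0"
  let ?P = "\<lambda>sp. gval radix (sgd sp) (rg (x, y, z, 1))"
  show "hbss_step dec (mkc 2 (x, y, z, 1) dt dh) = mkc 3 (x, y, z, 1) dt dh" if "x \<in> stk radix
      []"
    using dec_step[of 2 dt dh 1 x y z] assms that by (simp add: dec_rules_def fun_upd_zero del: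
        stk.simps)
  show "hbss_step dec (mkc 2 (x, y, z, 1) dt dh) = mkc 2 (real radix * x - real d, y, (z + real d)
      / real radix, 1) dt dh"
    if "pop_ok radix d x" "d \<in> {1..ns}"
  proof -
    have "find ?P (map ?f [1..<ns + 1]) = Some (?f d)"
      by (rule find_map_unique) (use that pop_ok_unique in auto)
    moreover have "x \<notin> stk radix []" using that pop_ok_nonempty by auto
    ultimately show ?thesis using dec_step[of 2 dt dh 1 x y z] assms
      by (simp add: dec_rules_def fun_upd_zero del: stk.simps)
  qed
  show "hbss_step dec (mkc 2 (x, y, z, 1) dt dh) = mkc 2 (x, y, z, 1) dt dh"
    if "x \<notin> stk radix []" "\<And>d. d \<in> {1..ns} \<Longrightarrow> \<not> pop_ok radix d
        x"
  proof -
    have "find ?P (map ?f [1..<ns + 1]) = None"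
      by (rule find_map_none) (use that in auto)
    then show ?thesis using dec_step[of 2 dt dh 1 x y z] assms that(1) by (simp add: dec_rules_def
        del: stk.simps)
  qed
qed

lemma dec_step3:
  assumes "dt dh = 0"
  shows "z \<in> stk radix [] \<Longrightarrow> hbss_step dec (mkc 3 (x, y, z, 1) dt dh) = mkc 4
      (x, y, z, 1) dt dh"
    and "pop_ok radix d z \<Longrightarrow> d \<in> {1..max_digit} \<Longrightarrow>
      hbss_step dec (mkc 3 (x, y, z, 1) dt dh) = mkc 3 (x, y, real radix * z - real d, 1) (dt(dh
          := d)) (dh + 1)"
proof -
  let ?f = "\<lambda>d. Spec (GDig 2 d) Keep Keep (Pop d) Keep 3 d 1"
  let ?P = "\<lambda>sp. gval radix (sgd sp) (rg (x, y, z, 1))"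
  show "hbss_step dec (mkc 3 (x, y, z, 1) dt dh) = mkc 4 (x, y, z, 1) dt dh" if "z \<in> stk radix
      []"
    using dec_step[of 3 dt dh 1 x y z] assms that by (simp add: dec_rules_def fun_upd_zero del:
        stk.simps)
  show "hbss_step dec (mkc 3 (x, y, z, 1) dt dh) = mkc 3 (x, y, real radix * z - real d, 1) (dt(dh
      := d)) (dh + 1)"
    if "pop_ok radix d z" "d \<in> {1..max_digit}"
  proof -
    have "find ?P (map ?f [1..<max_digit + 1]) = Some (?f d)"
      by (rule find_map_unique) (use that pop_ok_unique in auto)
    moreover have "z \<notin> stk radix []" using that pop_ok_nonempty by auto
    ultimately show ?thesis using dec_step[of 3 dt dh 1 x y z] assms
      by (simp add: dec_rules_def del: stk.simps)
  qed
qed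

lemma dec_step4:
  assumes "dt dh = 0"
  shows "y \<in> stk radix [] \<Longrightarrow> hbss_step dec (mkc 4 (x, y, z, 1) dt dh) = mkc 5
      (1, y, z, 1) dt dh"
    and "pop_ok radix d y \<Longrightarrow> d \<in> {1..ns} \<Longrightarrow>
      hbss_step dec (mkc 4 (x, y, z, 1) dt dh) = mkc 4 (x, real radix * y - real d, z, 1) (dt(dh
          := d)) (dh + 1)"
    and "y \<notin> stk radix [] \<Longrightarrow> (\<And>d. d \<in> {1..ns} \<Longrightarrow>
        \<not> pop_ok radix d y) \<Longrightarrow>
      hbss_step dec (mkc 4 (x, y, z, 1) dt dh) = mkc 4 (x, y, z, 1) dt dh"
proof -
  let ?f = "\<lambda>d. Spec (GDig 1 d) Keep (Pop d) Keep Keep 4 d 1"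
  let ?P = "\<lambda>sp. gval radix (sgd sp) (rg (x, y, z, 1))"
  show "hbss_step dec (mkc 4 (x, y, z, 1) dt dh) = mkc 5 (1, y, z, 1) dt dh" if "y \<in> stk radix
      []"
    using dec_step[of 4 dt dh 1 x y z] assms that by (simp add: dec_rules_def fun_upd_zero del:
        stk.simps)
  show "hbss_step dec (mkc 4 (x, y, z, 1) dt dh) = mkc 4 (x, real radix * y - real d, z, 1) (dt(dh
      := d)) (dh + 1)"
    if "pop_ok radix d y" "d \<in> {1..ns}"
  proof -
    have "find ?P (map ?f [1..<ns + 1]) = Some (?f d)"
      by (rule find_map_unique) (use that pop_ok_unique in auto)
    moreover have "y \<notin> stk radix []" using that pop_ok_nonempty by auto
    ultimately show ?thesis using dec_step[of 4 dt dh 1 x y z] assms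
      by (simp add: dec_rules_def del: stk.simps)
  qed
  show "hbss_step dec (mkc 4 (x, y, z, 1) dt dh) = mkc 4 (x, y, z, 1) dt dh"
    if "y \<notin> stk radix []" "\<And>d. d \<in> {1..ns} \<Longrightarrow> \<not> pop_ok radix d
        y"
  proof -
    have "find ?P (map ?f [1..<ns + 1]) = None"
      by (rule find_map_none) (use that in auto)
    then show ?thesis using dec_step[of 4 dt dh 1 x y z] assms that(1) by (simp add: dec_rules_def
        del: stk.simps)
  qed
qed

lemma pop_ok_max_digit: "set (d # ds) \<subseteq> {1..max_digit} \<Longrightarrow> t \<in> stk
    radix (d # ds) \<Longrightarrow> pop_ok radix d t"
  by (rule stk_pop_ok[of max_digit]) (simp_all add: radix_def)

text \<open>Popping leads from the interval of a stack to the interval of its rest. Therefore any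
  point of a box, not only its centre, is decoded correctly.\<close>

lemma dec_loop2:
  assumes "dt dh = 0" "set ds \<subseteq> {1..ns}" "x \<in> stk radix ds" "z \<in> stk radix zs"
  shows "\<exists>x' z'. z' \<in> stk radix (rev ds @ zs) \<and>
    hbss_run dec (mkc 2 (x, y, z, 1) dt dh) (length ds + 1) = mkc 3 (x', y, z', 1) dt dh"
  using assms(2-)
proof (induction ds arbitrary: x z zs)
  case Nil
  then show ?case using dec_step2(1)[of dt dh x y z] assms(1)
    by (auto simp: hbss_run_Suc hbss_run_0 simp del: stk.simps)
next
  case (Cons d ds)
  have "pop_ok radix d x" by (rule pop_ok_max_digit[OF _ Cons.prems(2)]) (use Cons.prems in
      \<open>auto simp: max_digit_def\<close>)
  moreover have "d \<in> {1..ns}" using Cons.prems by simp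
  ultimately have s: "hbss_step dec (mkc 2 (x, y, z, 1) dt dh) =
      mkc 2 (real radix * x - real d, y, (z + real d) / real radix, 1) dt dh"
    by (rule dec_step2(2)[of dt dh, OF assms(1)])
  have "(z + real d) / real radix \<in> stk radix (d # zs)" by (rule stk_push[OF radix_pos
      Cons.prems(3)])
  from Cons.IH[OF _ _ this, of "real radix * x - real d"] Cons.prems show ?case
    by (auto simp: hbss_run_Suc s)
qed

definition put :: "(int \<Rightarrow> nat) \<Rightarrow> int \<Rightarrow> nat list \<Rightarrow>
    int \<Rightarrow> nat" where
  "put dt h w = (\<lambda>j. if h \<le> j \<and> j < h + int (length w) then w ! nat (j - h) else
      dt j)"

lemma put_Nil: "put dt h [] = dt"
  by (auto simp: put_def)

lemma put_Cons: "put (dt(h := d)) (h + 1) w = put dt h (d # w)"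
proof
  fix j
  have "j > h \<Longrightarrow> nat (j - h) = Suc (nat (j - (h + 1)))" by simp
  then show "put (dt(h := d)) (h + 1) w j = put dt h (d # w) j" by (auto simp: put_def)
qed

lemma put_append: "put (put dt h v) (h + int (length v)) w = put dt h (v @ w)"
proof
  fix j
  have "nat (j - (h + int (length v))) = nat (j - h) - length v" by linarith
  then show "put (put dt h v) (h + int (length v)) w j = put dt h (v @ w) j"
    by (auto simp: put_def nth_append)
qed

lemma dec_loop3:
  assumes "\<And>j. j \<ge> dh \<Longrightarrow> dt j = 0" "set ds \<subseteq> {1..max_digit}" "z
      \<in> stk radix ds"
  shows "\<exists>z'. hbss_run dec (mkc 3 (x, y, z, 1) dt dh) (length ds + 1) =
    mkc 4 (x, y, z', 1) (put dt dh ds) (dh + int (length ds))"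
  using assms
proof (induction ds arbitrary: z dt dh)
  case Nil
  then show ?case using dec_step3(1)[of dt dh z x y]
    by (auto simp: hbss_run_Suc hbss_run_0 put_Nil simp del: stk.simps)
next
  case (Cons d ds)
  have "pop_ok radix d z" by (rule pop_ok_max_digit[OF Cons.prems(2,3)])
  moreover have "d \<in> {1..max_digit}" "dt dh = 0" using Cons.prems by auto
  ultimately have s: "hbss_step dec (mkc 3 (x, y, z, 1) dt dh) =
      mkc 3 (x, y, real radix * z - real d, 1) (dt(dh := d)) (dh + 1)"
    using dec_step3(2)[of dt dh] by blast
  have "\<exists>z'. hbss_run dec (mkc 3 (x, y, real radix * z - real d, 1) (dt(dh := d)) (dh +
      1)) (length ds + 1) =
      mkc 4 (x, y, z', 1) (put (dt(dh := d)) (dh + 1) ds) (dh + 1 + int (length ds))"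
    by (rule Cons.IH) (use Cons.prems in auto)
  then obtain z' where IH: "hbss_run dec (mkc 3 (x, y, real radix * z - real d, 1) (dt(dh := d))
      (dh + 1)) (length ds + 1) =
      mkc 4 (x, y, z', 1) (put dt dh (d # ds)) (dh + 1 + int (length ds))"
    unfolding put_Cons by blast
  have n: "length (d # ds) + 1 = Suc (length ds + 1)" "dh + int (length (d # ds)) = dh + 1 + int
      (length ds)"
    by simp_all
  show ?case unfolding n hbss_run_Suc s IH by blast
qed

lemma dec_loop4:
  assumes "\<And>j. j \<ge> dh \<Longrightarrow> dt j = 0" "set ds \<subseteq> {1..ns}" "y \<in>
      stk radix ds"
  shows "\<exists>y'. hbss_run dec (mkc 4 (x, y, z, 1) dt dh) (length ds + 1) =
    mkc 5 (1, y', z, 1) (put dt dh ds) (dh + int (length ds))"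
  using assms
proof (induction ds arbitrary: y dt dh)
  case Nil
  then show ?case using dec_step4(1)[of dt dh y x z]
    by (auto simp: hbss_run_Suc hbss_run_0 put_Nil simp del: stk.simps)
next
  case (Cons d ds)
  have "pop_ok radix d y" by (rule pop_ok_max_digit[OF _ Cons.prems(3)]) (use Cons.prems in
      \<open>auto simp: max_digit_def\<close>)
  moreover have "d \<in> {1..ns}" "dt dh = 0" using Cons.prems by auto
  ultimately have s: "hbss_step dec (mkc 4 (x, y, z, 1) dt dh) =
      mkc 4 (x, real radix * y - real d, z, 1) (dt(dh := d)) (dh + 1)"
    using dec_step4(2)[of dt dh] by blast
  have "\<exists>y'. hbss_run dec (mkc 4 (x, real radix * y - real d, z, 1) (dt(dh := d)) (dh +
      1)) (length ds + 1) =
      mkc 5 (1, y', z, 1) (put (dt(dh := d)) (dh + 1) ds) (dh + 1 + int (length ds))"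
    by (rule Cons.IH) (use Cons.prems in auto)
  then obtain y' where IH: "hbss_run dec (mkc 4 (x, real radix * y - real d, z, 1) (dt(dh := d))
      (dh + 1)) (length ds + 1) =
      mkc 5 (1, y', z, 1) (put dt dh (d # ds)) (dh + 1 + int (length ds))"
    unfolding put_Cons by blast
  have n: "length (d # ds) + 1 = Suc (length ds + 1)" "dh + int (length (d # ds)) = dh + 1 + int
      (length ds)"
    by simp_all
  show ?case unfolding n hbss_run_Suc s IH by blast
qed

lemma hc_state_mkc [simp]: "hc_state (mkc q v dt dh) = q"
  by (simp add: mkc_def)

lemma dec_halt [simp]: "bss_halt dec = 5"
  by (simp add: dec_def mach_def)

text \<open>The converse of \<open>dec_loop4\<close>: the digits popped until halting form the
  stack. No stack is known in advance, so the induction is on the running time.\<close>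

lemma dec_halts4:
  assumes "hc_state (hbss_run dec (mkc 4 (x, y, z, 1) dt dh) n) = 5" "\<And>j. j \<ge> dh
      \<Longrightarrow> dt j = 0"
  shows "\<exists>ds. set ds \<subseteq> {1..ns} \<and> y \<in> stk radix ds"
  using assms
proof (induction n arbitrary: y dt dh)
  case 0
  then show ?case by (simp add: hbss_run_0)
next
  case (Suc n)
  have z: "dt dh = 0" using Suc.prems(2) by simp
  consider "y \<in> stk radix []" | d where "pop_ok radix d y" "d \<in> {1..ns}"
    | "y \<notin> stk radix []" "\<And>d. d \<in> {1..ns} \<Longrightarrow> \<not> pop_ok radix d
        y" by blast
  then show ?case
  proof cases
    case 1
    then show ?thesis by (intro exI[of _ "[]"]) auto
  next
    case 2
    have h: "hc_state (hbss_run dec (mkc 4 (x, real radix * y - real d, z, 1) (dt(dh := d)) (dh +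
        1)) n) = 5"
      using Suc.prems(1) unfolding hbss_run_Suc dec_step4(2)[of dt dh, OF z 2, of x z] .
    have "\<exists>ds. set ds \<subseteq> {1..ns} \<and> real radix * y - real d \<in> stk radix ds"
      by (rule Suc.IH[OF h]) (use Suc.prems(2) in auto)
    then obtain ds where "set ds \<subseteq> {1..ns}" "real radix * y - real d \<in> stk radix ds"
        by blast
    then show ?thesis using 2 by (intro exI[of _ "d # ds"]) auto
  next
    case 3
    then show ?thesis using Suc dec_step4(3)[of dt dh, OF z 3, of x z] by (simp add: hbss_run_Suc)
  qed
qed

lemma dec_halts2:
  assumes "hc_state (hbss_run dec (mkc 2 (x, y, z, 1) (\<lambda>_. 0) 0) n) = 5"
    "z \<in> stk radix zs" "set zs \<subseteq> {1..max_digit}"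
  shows "\<exists>ds es. set ds \<subseteq> {1..ns} \<and> x \<in> stk radix ds \<and> set es
      \<subseteq> {1..ns} \<and> y \<in> stk radix es"
  using assms
proof (induction n arbitrary: x z zs)
  case 0
  then show ?case by (simp add: hbss_run_0)
next
  case (Suc n)
  let ?dt = "(\<lambda>_. 0) :: int \<Rightarrow> nat"
  have z: "?dt 0 = 0" by simp
  consider "x \<in> stk radix []" | d where "pop_ok radix d x" "d \<in> {1..ns}"
    | "x \<notin> stk radix []" "\<And>d. d \<in> {1..ns} \<Longrightarrow> \<not> pop_ok radix d
        x" by blast
  then show ?case
  proof cases
    case 1
    \<comment> \<open>Register 2 holds the digits pushed so far, so printing it succeeds. After
      that, halting can only depend on register 1.\<close>
    have "hbss_halts dec (mkc 3 (x, y, z, 1) ?dt 0)"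
      using Suc.prems(1) unfolding hbss_run_Suc dec_step2(1)[of ?dt 0, OF z 1, of y z]
      by (auto simp: hbss_halts_def)
    moreover obtain z' where "hbss_run dec (mkc 3 (x, y, z, 1) ?dt 0) (length zs + 1) =
        mkc 4 (x, y, z', 1) (put ?dt 0 zs) (0 + int (length zs))"
      using dec_loop3[of 0 ?dt zs z x y] Suc.prems by auto
    ultimately have "hbss_halts dec (mkc 4 (x, y, z', 1) (put ?dt 0 zs) (int (length zs)))"
      using hbss_halts_run[of dec _ "length zs + 1"] by (metis add_0)
    then obtain m where "hc_state (hbss_run dec (mkc 4 (x, y, z', 1) (put ?dt 0 zs) (int (length
        zs))) m) = 5"
      by (auto simp: hbss_halts_def)
    from dec_halts4[OF this] obtain es where "set es \<subseteq> {1..ns} \<and> y \<in> stk radix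
        es" by (auto simp: put_def)
    then show ?thesis using 1 by (intro exI[of _ "[]"] exI[of _ es]) auto
  next
    case 2
    have "(z + real d) / real radix \<in> stk radix (d # zs)" by (rule stk_push[OF radix_pos
        Suc.prems(2)])
    moreover have "set (d # zs) \<subseteq> {1..max_digit}" using 2 Suc.prems(3) by (auto simp:
        max_digit_def)
    moreover have "hc_state (hbss_run dec (mkc 2 (real radix * x - real d, y, (z + real d) / real
        radix, 1) ?dt 0) n) = 5"
      using Suc.prems(1) unfolding hbss_run_Suc dec_step2(2)[of ?dt 0, OF z 2, of y z] .
    ultimately obtain ds es where "set ds \<subseteq> {1..ns}" "real radix * x - real d \<in> stk
        radix ds" "set es \<subseteq> {1..ns}" "y \<in> stk radix es"
      using Suc.IH by blast
    then show ?thesis using 2 by (intro exI[of _ "d # ds"] exI[of _ es]) auto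
  next
    case 3
    then show ?thesis using Suc dec_step2(3)[of ?dt 0, OF z 3, of y z] by (simp add: hbss_run_Suc)
  qed
qed

lemma init_real_dec: "init_real dec [x, y] = mkc 0 (x, y, 0, 0) (\<lambda>_. 0) 0"
proof -
  have "(if 0 \<le> j \<and> j < int (length [x, y]) then [x, y] ! nat j else 0) =
      (if 0 \<le> j then rg (x, y, 0, 0) (nat j) else 0)" for j :: int
  proof -
    consider "j < 0" | "j = 0" | "j = 1" | "j > 1" by linarith
    then show ?thesis by cases (auto simp: rg_def)
  qed
  then show ?thesis by (simp add: init_real_def mkc_def dec_def mach_def)
qed

lemma dec_correct:
  assumes q: "q < nq" and L: "set L \<subseteq> {..<ns}" and R: "set R \<subseteq> {..<ns}"
    and x: "x \<in> stk radix ((Suc ns + q) # map Suc (rev L))" and y: "y \<in> stk radix (map Suc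
        R)"
  shows "\<exists>y' z' dh. hbss_run dec (init_real dec [x, y]) (2 * length L + length R + 6) =
    mkc 5 (1, y', z', 1) (put (\<lambda>_. 0) 0 (map Suc L @ [Suc ns + q] @ map Suc R)) dh"
proof -
  let ?dt = "(\<lambda>_. 0) :: int \<Rightarrow> nat" and ?s = "Suc ns + q"
  let ?zs = "map Suc L @ [?s]"
  have L': "set (map Suc (rev L)) \<subseteq> {1..ns}" and R': "set (map Suc R) \<subseteq>
      {1..ns}" using L R by auto
  have s: "?s \<in> {ns + 1..max_digit}" using q by (auto simp: max_digit_def)
  have "pop_ok radix ?s x" by (rule pop_ok_max_digit[OF _ x]) (use L' s in \<open>auto simp:
      max_digit_def\<close>)
  from dec_step1(1)[of ?dt 0, OF _ this s, of y 0]
  have 1: "hbss_step dec (mkc 1 (x, y, 0, 1) ?dt 0) =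
      mkc 2 (real radix * x - real ?s, y, (0 + real ?s) / real radix, 1) ?dt 0" by simp
  have "(0 + real ?s) / real radix \<in> stk radix [?s]" by (rule stk_push[OF radix_pos]) simp
  from dec_loop2[of ?dt 0, OF _ L' _ this, of "real radix * x - real ?s" y] x obtain x' z' where
    z': "z' \<in> stk radix ?zs"
    and 2: "hbss_run dec (mkc 2 (real radix * x - real ?s, y, (0 + real ?s) / real radix, 1) ?dt
        0) (length L + 1) =
      mkc 3 (x', y, z', 1) ?dt 0" by (auto simp: rev_map)
  have zs: "set ?zs \<subseteq> {1..max_digit}" using L' s by (auto simp: max_digit_def)
  obtain z'' where 3: "hbss_run dec (mkc 3 (x', y, z', 1) ?dt 0) (length L + 2) =
      mkc 4 (x', y, z'', 1) (put ?dt 0 ?zs) (0 + int (length ?zs))"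
    using dec_loop3[of 0 ?dt ?zs z' x' y, OF _ zs z'] by auto
  obtain y' where 4: "hbss_run dec (mkc 4 (x', y, z'', 1) (put ?dt 0 ?zs) (0 + int (length ?zs)))
      (length R + 1) =
      mkc 5 (1, y', z'', 1) (put (put ?dt 0 ?zs) (0 + int (length ?zs)) (map Suc R))
        (0 + int (length ?zs) + int (length R))"
    using dec_loop4[of "0 + int (length ?zs)" "put ?dt 0 ?zs" "map Suc R" y x' z'', OF _ R' y]
    by (auto simp: put_def)
  \<comment> \<open>Two initial steps, then three loops, each of which takes one step more than the
    digits it treats: \<open>length L\<close>, \<open>length L + 1\<close> and
    \<open>length R\<close> many.\<close>
  have n: "2 * length L + length R + 6 = Suc (Suc ((length L + 1) + ((length L + 2) + (length R +
      1))))" by simp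
  have "hbss_run dec (init_real dec [x, y]) (2 * length L + length R + 6) =
      mkc 5 (1, y', z'', 1) (put ?dt 0 (?zs @ map Suc R)) (0 + int (length ?zs) + int (length R))"
    unfolding n hbss_run_Suc init_real_dec dec_step0 1
      hbss_run_add[of _ _ "length L + 1" "length L + 2 + (length R + 1)"] 2
      hbss_run_add[of _ _ "length L + 2" "length R + 1"] 3 4 put_append ..
  then show ?thesis by auto
qed

text \<open>The digit ranges in the rules of states 1, 2 and 4 ensure that every halting run has
  read a well-formed configuration.\<close>

lemma dec_complete:
  assumes "hbss_halts dec (init_real dec [x, y])"
  shows "\<exists>q L R. q < nq \<and> set L \<subseteq> {..<ns} \<and> set R \<subseteq> {..<ns}
      \<and>
    x \<in> stk radix ((Suc ns + q) # map Suc (rev L)) \<and> y \<in> stk radix (map Suc R)"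
proof -
  let ?dt = "(\<lambda>_. 0) :: int \<Rightarrow> nat"
  have "hbss_halts dec (hbss_run dec (init_real dec [x, y]) 1)" by (rule hbss_halts_run[OF assms])
  then have h1: "hbss_halts dec (mkc 1 (x, y, 0, 1) ?dt 0)"
    by (simp add: hbss_run_Suc hbss_run_0 init_real_dec dec_step0)
  have "\<exists>d\<in>{ns + 1..max_digit}. pop_ok radix d x"
  proof (rule ccontr)
    assume "\<not> ?thesis"
    then have s: "hbss_step dec (mkc 1 (x, y, 0, 1) ?dt 0) = mkc 1 (x, y, 0, 1) ?dt 0"
      by (intro dec_step1(2)) auto
    have "hbss_run dec (mkc 1 (x, y, 0, 1) ?dt 0) n = mkc 1 (x, y, 0, 1) ?dt 0" for n
      by (induction n) (simp_all only: hbss_run_0 hbss_run_Suc s)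
    then show False using h1 by (auto simp: hbss_halts_def)
  qed
  then obtain d where d: "d \<in> {ns + 1..max_digit}" "pop_ok radix d x" by blast
  have "hbss_halts dec (hbss_run dec (mkc 1 (x, y, 0, 1) ?dt 0) 1)" by (rule hbss_halts_run[OF h1])
  then have "hbss_halts dec (mkc 2 (real radix * x - real d, y, (0 + real d) / real radix, 1) ?dt
      0)"
    using dec_step1(1)[of ?dt 0, OF _ d(2,1), of y 0] by (simp add: hbss_run_Suc hbss_run_0)
  then obtain n where n: "hc_state (hbss_run dec (mkc 2 (real radix * x - real d, y, (0 + real d)
      / real radix, 1) ?dt 0) n) = 5"
    by (auto simp: hbss_halts_def)
  have "(0 + real d) / real radix \<in> stk radix [d]" by (rule stk_push[OF radix_pos]) simp
  from dec_halts2[OF n this] d obtain ds es where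
    ds: "set ds \<subseteq> {1..ns}" "real radix * x - real d \<in> stk radix ds" and es: "set es
        \<subseteq> {1..ns}" "y \<in> stk radix es" by auto
  have pre: "map Suc (map (\<lambda>i. i - 1) xs) = xs" if "set xs \<subseteq> {1..ns}" for xs
    using that by (induction xs) auto
  define L R q where "L = rev (map (\<lambda>i. i - 1) ds)" and "R = map (\<lambda>i. i - 1) es"
      and "q = d - Suc ns"
  have "map Suc (rev L) = ds" "map Suc R = es" "Suc ns + q = d"
    using pre[OF ds(1)] pre[OF es(1)] d by (auto simp: L_def R_def q_def simp del: map_map)
  moreover have "set L \<subseteq> {..<ns}" "set R \<subseteq> {..<ns}" using ds es by (force
      simp: L_def R_def)+
  moreover have "q < nq" using d by (auto simp: q_def max_digit_def)
  ultimately show ?thesis using ds es by (intro exI[of _ q] exI[of _ L] exI[of _ R]) auto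
qed

end

section \<open>The encoding machine\<close>

definition enc_rules :: "nat \<Rightarrow> nat \<Rightarrow> nat \<Rightarrow> spec list" where
  "enc_rules ns q a =
    (if q = 0 then [Spec GTrue Zero Zero Zero Unit 1 a 0]
     else if q = 1 then
       (if a = 0 then [] else [Spec GTrue (Push a) Keep Keep Keep (if a \<le> ns then 1 else 2) a
           1])
     else if q = 2 then
       (if a = 0 then [Spec GTrue Keep Keep Keep Keep 3 a (-1)] else [Spec GTrue Keep Keep Keep
           Keep 2 a 1])
     else if q = 3 then
       (if 1 \<le> a \<and> a \<le> ns then [Spec GTrue Keep (Push a) Keep Keep 3 a (-1)]
        else [Spec GTrue Keep Keep Keep Keep 4 a 0])
     else [])"

definition enc :: "nat \<Rightarrow> nat \<Rightarrow> hbss" where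
  "enc ns nq = mach (radix ns nq) (max_digit ns nq) 5 4 (enc_rules ns)"

lemma wf_enc:
  assumes "0 < ns"
  shows "wf_hbss (enc ns nq)"
  unfolding enc_def
proof (rule wf_mach)
  fix q a sp assume "a \<le> max_digit ns nq" "sp \<in> set (enc_rules ns q a)"
  then show "spec_ok (max_digit ns nq) 5 sp" by (auto simp: enc_rules_def split: if_splits)
qed (use assms radix_pos in \<open>simp_all add: max_digit_def\<close>)

lemma enc_halt [simp]: "bss_halt (enc ns nq) = 4"
  by (simp add: enc_def mach_def)

lemma enc_step:
  assumes "q < 4" "dt dh \<le> max_digit ns nq"
    and r: "enc_rules ns q (dt dh) = [Spec GTrue a b c d s (dt dh) m]"
  shows "hbss_step (enc ns nq) (mkc q v dt dh) =
    mkc s (uval (radix ns nq) a 0 (rg v), uval (radix ns nq) b 1 (rg v), uval (radix ns nq) c 2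
        (rg v),
      uval (radix ns nq) d 3 (rg v)) dt (dh + m)"
proof -
  have "hbss_step (enc ns nq) (mkc q v dt dh) =
    (case find (\<lambda>sp. gval (radix ns nq) (sgd sp) (rg v)) (enc_rules ns q (dt dh)) of
       None \<Rightarrow> mkc q v dt dh | Some sp \<Rightarrow> apply_spec (radix ns nq) sp v dt
           dh)"
    unfolding enc_def by (rule mach_step) (use assms radix_pos in \<open>auto simp: r\<close>)
  then show ?thesis by (simp add: r)
qed

lemma init_disc_enc:
  "init_disc (enc ns nq) w = mkc 0 (0, 0, 0, 0) (\<lambda>j. if 0 \<le> j \<and> j < int (length
      w) then w ! nat j else 0) 0"
  by (simp add: init_disc_def mkc_def enc_def mach_def cong: if_cong)

text \<open>Both stacks need the cell closest to the head on top. So the left part, followed by the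
  state, is pushed on the way to the right, and the right part only on the way back; hence the term
  \<open>2 * length R\<close>.\<close>

lemma enc_correct:
  assumes q: "q < nq" and L: "set L \<subseteq> {..<ns}" and R: "set R \<subseteq> {..<ns}" and
      ns: "0 < ns"
    and w: "w = map Suc L @ [Suc ns + q] @ map Suc R"
  shows "\<exists>dt dh. hbss_run (enc ns nq) (init_disc (enc ns nq) w) (length L + 2 * length R +
      4) =
    mkc 4 (ctr (radix ns nq) ((Suc ns + q) # map Suc (rev L)), ctr (radix ns nq) (map Suc R), 0,
        1) dt dh"
proof -
  let ?E = "enc ns nq" and ?B = "radix ns nq" and ?s = "Suc ns + q"
  define dt where "dt = (\<lambda>j. if 0 \<le> j \<and> j < int (length w) then w ! nat j else 0)"
  define l where "l = length L"
  define r where "r = length R"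
  have lw: "length w = l + 1 + r" by (simp add: w l_def r_def)
  have Li: "Suc (L ! j) \<in> {1..ns}" if "j < l" for j
    using subsetD[OF L nth_mem[of j]] that by (auto simp: l_def Suc_le_eq)
  have Ri: "Suc (R ! j) \<in> {1..ns}" if "j < r" for j
    using subsetD[OF R nth_mem[of j]] that by (auto simp: r_def Suc_le_eq)
  have dtL: "dt (int j) = Suc (L ! j)" if "j < l" for j
    using that by (auto simp: dt_def lw) (simp add: w nth_append l_def)
  have dts: "dt (int l) = ?s"
    by (simp add: dt_def lw) (simp add: w nth_append l_def)
  have dtR: "dt (int (l + 1 + j)) = Suc (R ! j)" if "j < r" for j
    using that by (simp add: dt_def lw nat_add_distrib) (simp add: w nth_append l_def r_def)
  have dte: "dt (int (l + 1 + r)) = 0" by (simp add: dt_def lw)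
  have le: "?s \<le> max_digit ns nq" "ns \<le> max_digit ns nq" using q by (auto simp:
      max_digit_def)
  have s0: "hbss_step ?E (mkc 0 (0, 0, 0, 0) dt 0) = mkc 1 (0, 0, 0, 1) dt 0"
  proof -
    have "dt 0 \<le> max_digit ns nq"
    proof (cases "l = 0")
      case True
      then show ?thesis using dts le by simp
    next
      case False
      then show ?thesis using dtL[of 0] Li[of 0] le by simp
    qed
    then show ?thesis by (subst enc_step) (auto simp: enc_rules_def)
  qed
  have 1: "hbss_run ?E (mkc 1 (0, 0, 0, 1) dt 0) j = mkc 1 (ctr ?B (rev (take j (map Suc L))), 0,
      0, 1) dt (int j)"
    if "j \<le> l" for j
    using that
  proof (induction j)
    case (Suc j)
    have "dt (int j) = Suc (L ! j)" "Suc (L ! j) \<in> {1..ns}" using dtL Li Suc.prems by auto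
    then have "hbss_step ?E (mkc 1 (ctr ?B (rev (take j (map Suc L))), 0, 0, 1) dt (int j)) =
        mkc 1 ((ctr ?B (rev (take j (map Suc L))) + real (Suc (L ! j))) / real ?B, 0, 0, 1) dt
            (int j + 1)"
      by (subst enc_step) (use le in \<open>auto simp: enc_rules_def\<close>)
    moreover have "rev (take (Suc j) (map Suc L)) = Suc (L ! j) # rev (take j (map Suc L))"
      using Suc.prems by (simp add: take_Suc_conv_app_nth l_def)
    ultimately show ?case using Suc by (simp add: hbss_run_Suc2 add.commute)
  qed (simp add: hbss_run_0)
  let ?x = "ctr ?B (?s # map Suc (rev L))"
  have s1: "hbss_step ?E (mkc 1 (ctr ?B (rev (map Suc L)), 0, 0, 1) dt (int l)) = mkc 2 (?x, 0, 0,
      1) dt (int (l + 1))"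
    by (subst enc_step) (use le dts in \<open>auto simp: enc_rules_def rev_map
        algebra_simps\<close>)
  have 2: "hbss_run ?E (mkc 2 (?x, 0, 0, 1) dt (int (l + 1))) j = mkc 2 (?x, 0, 0, 1) dt (int (l +
      1 + j))"
    if "j \<le> r" for j
    using that
  proof (induction j)
    case (Suc j)
    have "dt (int (l + 1 + j)) = Suc (R ! j)" "Suc (R ! j) \<in> {1..ns}" using dtR Ri Suc.prems
        by auto
    then have "hbss_step ?E (mkc 2 (?x, 0, 0, 1) dt (int (l + 1 + j))) = mkc 2 (?x, 0, 0, 1) dt
        (int (l + 1 + j) + 1)"
      by (subst enc_step) (use le in \<open>auto simp: enc_rules_def\<close>)
    then show ?case using Suc by (simp add: hbss_run_Suc2 algebra_simps)
  qed (simp add: hbss_run_0)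
  have s2: "hbss_step ?E (mkc 2 (?x, 0, 0, 1) dt (int (l + 1 + r))) = mkc 3 (?x, 0, 0, 1) dt (int
      (l + r))"
    by (subst enc_step) (use dte in \<open>auto simp: enc_rules_def\<close>)
  have 3: "hbss_run ?E (mkc 3 (?x, 0, 0, 1) dt (int (l + r))) j =
      mkc 3 (?x, ctr ?B (drop (r - j) (map Suc R)), 0, 1) dt (int (l + r - j))" if "j \<le> r" for j
    using that
  proof (induction j)
    case (Suc j)
    define i where "i = r - Suc j"
    have i: "i < r" "r - j = Suc i" "l + r - j = l + 1 + i" "l + r - Suc j = l + i" using
        Suc.prems by (auto simp: i_def)
    have "dt (int (l + 1 + i)) = Suc (R ! i)" "Suc (R ! i) \<in> {1..ns}" using dtR Ri i by auto
    then have "hbss_step ?E (mkc 3 (?x, ctr ?B (drop (Suc i) (map Suc R)), 0, 1) dt (int (l + 1 +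
        i))) =
        mkc 3 (?x, (ctr ?B (drop (Suc i) (map Suc R)) + real (Suc (R ! i))) / real ?B, 0, 1) dt
            (int (l + 1 + i) - 1)"
      by (subst enc_step) (use le in \<open>auto simp: enc_rules_def\<close>)
    moreover have "drop i (map Suc R) = Suc (R ! i) # drop (Suc i) (map Suc R)"
      using i(1) by (simp add: Cons_nth_drop_Suc[symmetric] r_def)
    ultimately show ?case using Suc.IH Suc.prems unfolding hbss_run_Suc2 i i_def[symmetric]
      by simp
  qed (simp add: hbss_run_0 r_def)
  have s3: "hbss_step ?E (mkc 3 (?x, ctr ?B (map Suc R), 0, 1) dt (int l)) = mkc 4 (?x, ctr ?B
      (map Suc R), 0, 1) dt (int l)"
    by (subst enc_step) (use le dts in \<open>auto simp: enc_rules_def\<close>)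
  have n: "length L + 2 * length R + 4 = Suc (l + Suc (r + Suc (r + Suc 0)))" by (simp add: l_def
      r_def)
  have t: "take l (map Suc L) = map Suc L" by (simp add: l_def)
  have "hbss_run ?E (init_disc ?E w) (length L + 2 * length R + 4) = mkc 4 (?x, ctr ?B (map Suc
      R), 0, 1) dt (int l)"
    unfolding n init_disc_enc dt_def[symmetric] hbss_run_Suc[of _ "mkc 0 _ _ _"] s0
      hbss_run_add[of _ _ l "Suc (r + Suc (r + Suc 0))"] 1[OF order_refl] t
      hbss_run_Suc[of _ "mkc 1 _ _ _"] s1 hbss_run_add[of _ _ r "Suc (r + Suc 0)"] 2[OF order_refl]
      hbss_run_Suc[of _ "mkc 2 _ _ _"] s2 hbss_run_add[of _ _ r "Suc 0"] 3[OF order_refl]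
    using s3 by (simp add: hbss_run_Suc hbss_run_0)
  then show ?thesis by blast
qed

subsection \<open>Lower bounds on the running time\<close>

lemma hbss_step_dtape: "j \<noteq> hc_dhead c \<Longrightarrow> hc_dtape (hbss_step P c) j =
    hc_dtape c j"
  by (auto simp: hbss_step_def Let_def split: option.splits if_splits)

lemma hbss_run_dtape:
  "finite {j. hc_dtape (hbss_run P c n) j \<noteq> hc_dtape c j} \<and>
   card {j. hc_dtape (hbss_run P c n) j \<noteq> hc_dtape c j} \<le> n"
proof (induction n)
  case (Suc n)
  let ?A = "\<lambda>n. {j. hc_dtape (hbss_run P c n) j \<noteq> hc_dtape c j}"
  have "?A (Suc n) \<subseteq> insert (hc_dhead (hbss_run P c n)) (?A n)"
    by (auto simp: hbss_run_Suc2 hbss_step_dtape)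
  moreover have "card (insert (hc_dhead (hbss_run P c n)) (?A n)) \<le> Suc n" "finite (?A n)"
    using Suc card_insert_le_m1[of "Suc n" "?A n"] by auto
  ultimately show ?case by (meson card_mono finite_insert finite_subset order_trans)
qed (simp add: hbss_run_0)

lemma hbss_step_dhead:
  assumes "wf_hbss P"
  shows "hc_dhead (hbss_step P c) \<le> hc_dhead c + 1"
proof (cases "hc_state c = bss_halt P \<or> hc_state c \<ge> bss_nst P \<or> hc_dtape c (hc_dhead
    c) \<ge> bss_d P")
  case True
  then show ?thesis by (auto simp: hbss_step_def Let_def)
next
  case False
  let ?x = "\<lambda>i. hc_rtape c (hc_rhead c + int i)"
  let ?rs = "bss_rules P (hc_state c) (hc_dtape c (hc_dhead c))"
  show ?thesis
  proof (cases "find (\<lambda>br. sholds (br_guard br) ?x) ?rs")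
    case None
    then show ?thesis using False by (auto simp: hbss_step_def Let_def)
  next
    case (Some br)
    then have "br \<in> set ?rs" by (auto simp: find_Some_iff)
    then have "br_dmove br \<in> {-1, 0, 1}" using assms False unfolding wf_hbss_def by (meson
        not_le)
    then show ?thesis using False Some by (auto simp: hbss_step_def Let_def)
  qed
qed

lemma hbss_run_dhead:
  assumes "wf_hbss P"
  shows "hc_dhead (hbss_run P c n) \<le> hc_dhead c + int n"
proof (induction n)
  case (Suc n)
  then show ?case using hbss_step_dhead[OF assms, of "hbss_run P c n"] by (simp add: hbss_run_Suc2)
qed (simp add: hbss_run_0)

lemma hbss_step_unread:
  assumes "hc_dhead c \<noteq> p"
  shows "hbss_step P (c\<lparr>hc_dtape := (hc_dtape c)(p := a)\<rparr>) =
    (hbss_step P c)\<lparr>hc_dtape := (hc_dtape (hbss_step P c))(p := a)\<rparr>"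
  using assms by (auto simp: hbss_step_def Let_def fun_upd_twist split: option.splits)

text \<open>The head starts at 0 and advances at most one cell per step, so \<open>n\<close> steps
  only read cells below \<open>n\<close>. A change at \<open>p\<close> is carried along
  unnoticed.\<close>

lemma hbss_run_unread:
  assumes "wf_hbss P" "hc_dhead c = 0" "int n \<le> p"
  shows "hbss_run P (c\<lparr>hc_dtape := (hc_dtape c)(p := a)\<rparr>) n =
    (hbss_run P c n)\<lparr>hc_dtape := (hc_dtape (hbss_run P c n))(p := a)\<rparr>"
  using assms(3)
proof (induction n)
  case (Suc n)
  have "hc_dhead (hbss_run P c n) \<noteq> p" using hbss_run_dhead[OF assms(1), of c n] assms(2)
      Suc.prems by simp
  then show ?case using Suc by (simp add: hbss_run_Suc2 hbss_step_unread del: fun_upd_apply)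
qed (simp add: hbss_run_0)

subsection \<open>The disk map\<close>

text \<open>Digit 0 stands for an empty stack; leaving the value unchanged keeps it in the interval
  of the empty stack.\<close>

definition popv :: "nat \<Rightarrow> nat \<Rightarrow> real \<Rightarrow> real" where
  "popv B l v = (if l = 0 then v else real B * v - real l)"

definition pushv :: "nat \<Rightarrow> nat \<Rightarrow> real \<Rightarrow> real" where
  "pushv B d v = (v + real d) / real B"

lemma smooth1_popv: "smooth1 (popv B l)"
  using smooth1_affine[of "real B" "- real l"] smooth1_ident
  by (cases "l = 0") (simp_all add: popv_def[abs_def])

lemma smooth1_pushv: "smooth1 (pushv B d)"
  using smooth1_affine[of "1 / real B" "real d / real B"]
  by (simp add: pushv_def[abs_def] add_divide_distrib)

text \<open>The bump function may be nonzero only on the interval from -3/8 to 5/8.\<close>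

lemma pushv_range:
  assumes "4 * K + 4 \<le> B" "d \<le> K" "-3/8 \<le> v" "v \<le> 5/8"
  shows "-3/8 \<le> pushv B d v \<and> pushv B d v \<le> 5/8"
proof -
  have "real (4 * K + 4) \<le> real B" "real d \<le> real K" using assms by (simp_all only:
      of_nat_le_iff)
  then have B: "real B \<ge> 4 * real K + 4" "real d \<le> real K" "0 \<le> real K" "0 \<le> real
      d" by simp_all
  then have "-3/8 * real B \<le> v + real d" "v + real d \<le> 5/8 * real B" using assms by
      linarith+
  then show ?thesis using B by (simp add: pushv_def pos_le_divide_eq pos_divide_le_eq)
qed

lemma bump_digit_unique: "bump (t - real d) \<noteq> 0 \<Longrightarrow> bump (t - real e)
    \<noteq> 0 \<Longrightarrow> d = e"
  using bump_nonzeroD[of "t - real d"] bump_nonzeroD[of "t - real e"] by linarith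

text \<open>Tape symbols become the digits 1 to \<open>ns\<close> and states the digits above, so
  that all digits are positive and a state is never mistaken for a symbol.\<close>

definition xdigs :: "nat \<Rightarrow> tm_conf \<Rightarrow> nat list" where
  "xdigs ns s = (case s of (q, L, R) \<Rightarrow> (Suc ns + q) # map Suc (rev L))"

definition ydigs :: "tm_conf \<Rightarrow> nat list" where
  "ydigs s = (case s of (q, L, R) \<Rightarrow> map Suc R)"

lemma digs_inj: "xdigs ns s = xdigs ns s' \<Longrightarrow> ydigs s = ydigs s' \<Longrightarrow> s
    = s'"
  by (auto simp: xdigs_def ydigs_def inj_map_eq_map split: prod.splits)

context
  fixes T :: tm
  assumes T: "wf_tm T"
begin

definition base :: nat where "base = radix (tm_ns T) (tm_nq T)"

definition wx :: "nat \<Rightarrow> nat \<Rightarrow> real \<Rightarrow> real" where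
  "wx q l x = bump (real base * x - real (Suc (tm_ns T) + q)) *
     bump (real base * (real base * x - real (Suc (tm_ns T) + q)) - real l)"

definition wy :: "nat \<Rightarrow> real \<Rightarrow> real" where
  "wy r y = bump (real base * y - real r)"

text \<open>Digit \<open>r\<close> encodes symbol \<open>r - 1\<close>. For the empty stack
  \<open>r = 0\<close>, truncated subtraction yields the blank 0, as the machine model prescribes.
  Halted configurations are fixed points of the step, hence the identity for
  \<open>q = 0\<close>.\<close>

definition fx :: "nat \<Rightarrow> nat \<Rightarrow> nat \<Rightarrow> real \<Rightarrow> real"
    where
  "fx q l r x = (if q = 0 then x else case tm_delta T q (r - 1) of (q', b, m) \<Rightarrow>
     let x1 = popv base (Suc (tm_ns T) + q) x in
     pushv base (Suc (tm_ns T) + q')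
       (if m = 1 then pushv base (Suc b) x1 else if m = -1 then popv base l x1 else x1))"

text \<open>On a left move from an empty left stack the digit pushed is 1, the code of the blank
  entering from beyond the left end.\<close>

definition fy :: "nat \<Rightarrow> nat \<Rightarrow> nat \<Rightarrow> real \<Rightarrow> real"
    where
  "fy q l r y = (if q = 0 then y else case tm_delta T q (r - 1) of (q', b, m) \<Rightarrow>
     let y1 = popv base r y in
       if m = 1 then y1
       else if m = -1 then pushv base (if l = 0 then 1 else l) (pushv base (Suc b) y1)
       else pushv base (Suc b) y1)"

definition pieces :: "(nat \<times> nat \<times> nat) set" where
  "pieces = {..<tm_nq T} \<times> {..tm_ns T} \<times> {..tm_ns T}"

text \<open>The digit 0 stands for an empty stack. The weights single out the piece given by the
  state and the top digits of both stacks, on which the machine step is affine.\<close>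

definition dmap :: "real^2 \<Rightarrow> real^2" where
  "dmap v = (\<Sum>p\<in>pieces. case p of (q, l, r) \<Rightarrow>
     ((wx q l (v $ 1) * fx q l r (v $ 1)) * wy r (v $ 2)) *\<^sub>R axis 1 1 +
     (wx q l (v $ 1) * (wy r (v $ 2) * fy q l r (v $ 2))) *\<^sub>R axis 2 1)"

lemma finite_pieces: "finite pieces"
  by (simp add: pieces_def)

lemma smooth1_wx: "smooth1 (wx q l)"
proof -
  have "smooth1 (\<lambda>x. real base * (real base * x - real (Suc (tm_ns T) + q)) + - real l)"
    using smooth1_affine_compose[OF smooth1_affine[of "real base" "- real l"], of "real base" "-
        real (Suc (tm_ns T) + q)"]
    by (simp only: add_uminus_conv_diff)
  from smooth1_compose[OF smooth1_bump this]
  have "smooth1 (\<lambda>x. bump (real base * (real base * x - real (Suc (tm_ns T) + q)) - real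
      l))"
    by (simp only: add_uminus_conv_diff)
  from smooth1_mult[OF smooth1_affine_compose[OF smooth1_bump, of "real base" "- real (Suc (tm_ns
      T) + q)"] this]
  show ?thesis unfolding wx_def[abs_def] by (simp only: add_uminus_conv_diff)
qed

lemma smooth1_wy: "smooth1 (wy r)"
  using smooth1_affine_compose[OF smooth1_bump, of "real base" "- real r"] by (simp add:
      wy_def[abs_def])

lemma smooth1_fx: "smooth1 (fx q l r)"
proof -
  obtain q' b m where d: "tm_delta T q (r - 1) = (q', b, m)" by (metis prod_cases3)
  note s = smooth1_compose[OF smooth1_pushv] smooth1_compose[OF smooth1_popv]
  show ?thesis
    unfolding fx_def[abs_def] d prod.case Let_def
    by (cases "q = 0"; cases "m = 1"; cases "m = -1")
      (simp_all add: smooth1_ident s smooth1_popv smooth1_pushv)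
qed

lemma smooth1_fy: "smooth1 (fy q l r)"
proof -
  obtain q' b m where d: "tm_delta T q (r - 1) = (q', b, m)" by (metis prod_cases3)
  note s = smooth1_compose[OF smooth1_pushv] smooth1_compose[OF smooth1_popv]
  show ?thesis
    unfolding fy_def[abs_def] d prod.case Let_def
    by (cases "q = 0"; cases "m = 1"; cases "m = -1")
      (simp_all add: smooth1_ident s smooth1_popv smooth1_pushv)
qed

lemma dmap_smooth: "smooth_on UNIV dmap"
proof -
  have "(\<lambda>v. \<Sum>p\<in>pieces. case p of (q, l, r) \<Rightarrow>
     ((wx q l (v $ 1) * fx q l r (v $ 1)) * wy r (v $ 2)) *\<^sub>R axis 1 1 +
     (wx q l (v $ 1) * (wy r (v $ 2) * fy q l r (v $ 2))) *\<^sub>R axis 2 1) \<in> sep"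
  proof (rule sep_sum[OF finite_pieces])
    fix p :: "nat \<times> nat \<times> nat"
    obtain q l r where p: "p = (q, l, r)" by (cases p)
    show "(\<lambda>v. case p of (q, l, r) \<Rightarrow>
       ((wx q l (v $ 1) * fx q l r (v $ 1)) * wy r (v $ 2)) *\<^sub>R axis 1 1 +
       (wx q l (v $ 1) * (wy r (v $ 2) * fy q l r (v $ 2))) *\<^sub>R axis 2 1) \<in> sep"
      unfolding p prod.case
      by (rule sep_add; rule sep_base) (intro smooth1_mult smooth1_wx smooth1_wy smooth1_fx
          smooth1_fy)+
  qed
  then show ?thesis unfolding dmap_def[abs_def] by (rule sep_smooth)
qed

text \<open>A nonzero bump determines its digit. The state has to be identified first, because the
  bump for the left digit is applied to what remains after popping the state.\<close>

lemma weight_unique: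
  assumes "wx q l x * wy r y \<noteq> 0" "wx q' l' x * wy r' y \<noteq> 0"
  shows "(q', l', r') = (q, l, r)"
proof -
  have "wx q l x \<noteq> 0" "wx q' l' x \<noteq> 0" "wy r y \<noteq> 0" "wy r' y \<noteq> 0"
      using assms by auto
  then have "bump (real base * x - real (Suc (tm_ns T) + q)) \<noteq> 0" "bump (real base * x -
      real (Suc (tm_ns T) + q')) \<noteq> 0"
    and l: "bump (real base * (real base * x - real (Suc (tm_ns T) + q)) - real l) \<noteq> 0"
      "bump (real base * (real base * x - real (Suc (tm_ns T) + q')) - real l') \<noteq> 0"
    and r: "bump (real base * y - real r) \<noteq> 0" "bump (real base * y - real r') \<noteq> 0"
    unfolding wx_def wy_def mult_eq_0_iff de_Morgan_disj by blast+
  then have "Suc (tm_ns T) + q = Suc (tm_ns T) + q'" by (intro bump_digit_unique)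
  then have q: "q' = q" by simp
  show ?thesis using bump_digit_unique[OF l[unfolded q]] bump_digit_unique[OF r] q by simp
qed

lemma dmap_piece:
  assumes p: "(q, l, r) \<in> pieces" and w: "wx q l (v $ 1) * wy r (v $ 2) \<noteq> 0"
  shows "dmap v $ 1 = (wx q l (v $ 1) * wy r (v $ 2)) * fx q l r (v $ 1)"
    and "dmap v $ 2 = (wx q l (v $ 1) * wy r (v $ 2)) * fy q l r (v $ 2)"
proof -
  let ?g = "\<lambda>p. case p of (q, l, r) \<Rightarrow>
     ((wx q l (v $ 1) * fx q l r (v $ 1)) * wy r (v $ 2)) *\<^sub>R axis 1 1 +
     (wx q l (v $ 1) * (wy r (v $ 2) * fy q l r (v $ 2))) *\<^sub>R (axis 2 1 :: real^2)"
  have "?g p' = 0" if "p' \<in> pieces - {(q, l, r)}" for p'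
  proof -
    obtain q' l' r' where p': "p' = (q', l', r')" by (cases p')
    have "(q', l', r') \<noteq> (q, l, r)" using that p' by blast
    then have "wx q' l' (v $ 1) * wy r' (v $ 2) = 0" using weight_unique[OF w, of q' l' r'] by blast
    then have "wx q' l' (v $ 1) = 0 \<or> wy r' (v $ 2) = 0" by (simp only: mult_eq_0_iff)
    then show ?thesis unfolding p' prod.case
      by (elim disjE) (simp_all only: mult_zero_left mult_zero_right scaleR_zero_left add_0)
  qed
  then have "(\<Sum>p'\<in>pieces - {(q, l, r)}. ?g p') = 0" by (rule sum.neutral[rule_format])
  then have "dmap v = ?g (q, l, r)"
    unfolding dmap_def sum.remove[OF finite_pieces p] by simp
  then show "dmap v $ 1 = (wx q l (v $ 1) * wy r (v $ 2)) * fx q l r (v $ 1)"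
    "dmap v $ 2 = (wx q l (v $ 1) * wy r (v $ 2)) * fy q l r (v $ 2)"
    by (simp_all add: axis_def)
qed

lemma base_ge: "4 * max_digit (tm_ns T) (tm_nq T) + 4 \<le> base"
  by (simp add: base_def radix_def)

lemma base_pos: "0 < base" using base_ge by simp

lemma delta_ok:
  assumes "q < tm_nq T" "r \<le> tm_ns T" "tm_delta T q (r - 1) = (q', b, m)"
  shows "q' < tm_nq T" "b < tm_ns T" "m \<in> {-1, 0, 1}"
proof -
  have "r - 1 < tm_ns T" using assms(2) T by (auto simp: wf_tm_def)
  from T[unfolded wf_tm_def, THEN conjunct2, THEN conjunct2, rule_format, OF assms(1) this]
  show "q' < tm_nq T" "b < tm_ns T" "m \<in> {-1, 0, 1}" unfolding assms(3) by simp_all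
qed

text \<open>Where a weight is nonzero, the supports of the bumps bound all remainders by -3/8 and
  5/8, and pushes preserve these bounds. Both coordinates are then at most 5/8 in absolute value,
  and 2 * (5/8)^2 < 1. Everywhere else the value is 0.\<close>

lemma dmap_disk: "dmap ` cball 0 1 \<subseteq> cball 0 1"
proof (rule image_subsetI)
  fix v :: "real^2" assume "v \<in> cball 0 1"
  let ?K = "max_digit (tm_ns T) (tm_nq T)"
  show "dmap v \<in> cball 0 1"
  proof (cases "\<exists>p\<in>pieces. case p of (q, l, r) \<Rightarrow> wx q l (v $ 1) * wy r (v
      $ 2) \<noteq> 0")
    case False
    have "(case p of (q, l, r) \<Rightarrow>
        ((wx q l (v $ 1) * fx q l r (v $ 1)) * wy r (v $ 2)) *\<^sub>R axis 1 1 +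
        (wx q l (v $ 1) * (wy r (v $ 2) * fy q l r (v $ 2))) *\<^sub>R (axis 2 1 :: real^2)) = 0"
      if "p \<in> pieces" for p
    proof -
      obtain q l r where p: "p = (q, l, r)" by (cases p)
      have "wx q l (v $ 1) * wy r (v $ 2) = 0" using False \<open>p \<in> pieces\<close> p by blast
      then have "wx q l (v $ 1) = 0 \<or> wy r (v $ 2) = 0" by (simp only: mult_eq_0_iff)
      then show ?thesis unfolding p prod.case
        by (elim disjE) (simp_all only: mult_zero_left mult_zero_right scaleR_zero_left add_0)
    qed
    then have "dmap v = 0" unfolding dmap_def by (rule sum.neutral[rule_format])
    then show ?thesis by simp
  next
    case True
    then obtain q l r where p: "(q, l, r) \<in> pieces" and w: "wx q l (v $ 1) * wy r (v $ 2)
        \<noteq> 0" by auto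
    have qlr: "q < tm_nq T" "l \<le> tm_ns T" "r \<le> tm_ns T" using p by (auto simp: pieces_def)
    define x y where "x = v $ 1" and "y = v $ 2"
    define x1 where "x1 = popv base (Suc (tm_ns T) + q) x"
    have x1: "x1 = real base * x - real (Suc (tm_ns T) + q)" by (simp add: x1_def popv_def)
    have "bump x1 \<noteq> 0" "bump (real base * x1 - real l) \<noteq> 0" "bump (real base * y -
        real r) \<noteq> 0"
      using w unfolding wx_def wy_def mult_eq_0_iff de_Morgan_disj x1 x_def y_def by blast+
    from this[THEN bump_nonzeroD] have b: "-3/8 \<le> x1" "x1 \<le> 5/8" "-3/8 \<le> real base *
        x1 - real l"
      "real base * x1 - real l \<le> 5/8" "-3/8 \<le> real base * y - real r" "real base * y -
          real r \<le> 5/8"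
      by auto
    note push = pushv_range[OF base_ge]
    have "x = pushv base (Suc (tm_ns T) + q) x1" "y = pushv base r (real base * y - real r)"
      using base_pos by (simp_all add: pushv_def x1)
    then have xy: "-3/8 \<le> x \<and> x \<le> 5/8" "-3/8 \<le> y \<and> y \<le> 5/8"
      using push[of "Suc (tm_ns T) + q" x1] push[of r "real base * y - real r"] b qlr by (auto
          simp: max_digit_def)
    have pops: "-3/8 \<le> popv base l x1 \<and> popv base l x1 \<le> 5/8" "-3/8 \<le> popv base r
        y \<and> popv base r y \<le> 5/8"
      using b xy by (auto simp: popv_def)
    obtain q' b' m where d: "tm_delta T q (r - 1) = (q', b', m)" by (metis prod_cases3)
    note ok = delta_ok[OF qlr(1,3) d]
    have dig: "Suc (tm_ns T) + q' \<le> ?K" "Suc b' \<le> ?K" "l \<le> ?K" "1 \<le> ?K" using ok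
        qlr by (auto simp: max_digit_def)
    have "-3/8 \<le> fx q l r x \<and> fx q l r x \<le> 5/8"
      using xy pops b dig push unfolding fx_def d Let_def prod.case x1_def[symmetric] by simp
    moreover have "-3/8 \<le> fy q l r y \<and> fy q l r y \<le> 5/8"
      using xy pops dig push unfolding fy_def d Let_def prod.case by simp
    ultimately have f: "\<bar>fx q l r x\<bar> \<le> 5/8" "\<bar>fy q l r y\<bar> \<le> 5/8" by auto
    define W where "W = wx q l x * wy r y"
    have W: "\<bar>W\<bar> \<le> 1"
      by (auto simp: W_def wx_def wy_def abs_mult bump_nonneg bump_le_1 intro!: mult_le_one
          mult_nonneg_nonneg)
    have "\<bar>W * a\<bar> \<le> 5/8" if "\<bar>a\<bar> \<le> 5/8" for a
      using mult_mono[OF W that] by (simp add: abs_mult)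
    then have "\<bar>dmap v $ 1\<bar> \<le> 5/8" "\<bar>dmap v $ 2\<bar> \<le> 5/8"
      unfolding dmap_piece[OF p w] x_def[symmetric] y_def[symmetric] W_def[symmetric] using f by
          auto
    then have "(dmap v $ 1)\<^sup>2 \<le> (5/8)\<^sup>2" "(dmap v $ 2)\<^sup>2 \<le>
        (5/8)\<^sup>2" by (auto simp: abs_le_square_iff[symmetric])
    then have "(norm (dmap v))\<^sup>2 \<le> 1"
      by (simp add: norm_vec_def L2_set_def UNIV_2 power2_eq_square)
    then show ?thesis by (simp add: power2_le_imp_le power_le_one_iff abs_square_le_1)
  qed
qed

section \<open>Code boxes and the machine step on them\<close>

definition tbox :: "tm_conf \<Rightarrow> (real^2) set" where
  "tbox s = {v. v $ 1 \<in> stk base (xdigs (tm_ns T) s) \<and> v $ 2 \<in> stk base (ydigs s)}"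

lemma digs_range:
  assumes "s \<in> tm_configs T"
  shows "set (xdigs (tm_ns T) s) \<subseteq> {1..max_digit (tm_ns T) (tm_nq T)}" "set (ydigs s)
      \<subseteq> {1..max_digit (tm_ns T) (tm_nq T)}"
  using assms by (fastforce simp: tm_configs_def xdigs_def ydigs_def max_digit_def)+

lemma tbox_unique:
  assumes "s \<in> tm_configs T" "s' \<in> tm_configs T" "v \<in> tbox s" "v \<in> tbox s'"
  shows "s = s'"
proof (rule digs_inj)
  show "xdigs (tm_ns T) s = xdigs (tm_ns T) s'" "ydigs s = ydigs s'"
    using assms stk_unique[OF base_ge digs_range(1)[OF assms(1)] digs_range(1)[OF assms(2)]]
      stk_unique[OF base_ge digs_range(2)[OF assms(1)] digs_range(2)[OF assms(2)]] by (auto simp: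
          tbox_def)
qed

lemma stk_bump:
  assumes "set ds \<subseteq> {1..max_digit (tm_ns T) (tm_nq T)}" "t \<in> stk base ds"
  shows "bump t = 1" "bump (real base * t - real (case ds of [] \<Rightarrow> 0 | d # _
      \<Rightarrow> d)) = 1"
proof -
  show "bump t = 1" using stk_bounds[OF base_ge assms] by (intro bump_eq_1) auto
  show "bump (real base * t - real (case ds of [] \<Rightarrow> 0 | d # _ \<Rightarrow> d)) = 1"
  proof (cases ds)
    case Nil
    then show ?thesis using assms(2) by (intro bump_eq_1) auto
  next
    case (Cons d ds')
    then show ?thesis using stk_bounds[OF base_ge, of ds' "real base * t - real d"] assms
      by (intro bump_eq_1) auto
  qed
qed

lemma popv_stk: "t \<in> stk B ds \<Longrightarrow> 0 \<notin> set ds \<Longrightarrow> popv B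
    (case ds of [] \<Rightarrow> 0 | d # _ \<Rightarrow> d) t \<in> stk B (tl ds)"
  by (cases ds) (auto simp: popv_def)

lemma pushv_stk: "t \<in> stk base ds \<Longrightarrow> pushv base d t \<in> stk base (d # ds)"
  unfolding pushv_def by (rule stk_push[OF base_pos])

text \<open>All bumps of the relevant weight equal 1 on the whole box. The map is therefore the
  affine piece itself there, and its pops and pushes send stack intervals into stack
  intervals.\<close>

lemma dmap_step:
  assumes s: "s \<in> tm_configs T" and v: "v \<in> tbox s"
  shows "dmap v \<in> tbox (tm_step T s)"
proof -
  let ?ns = "tm_ns T"
  obtain q L R where s': "s = (q, L, R)" by (cases s)
  have qLR: "q < tm_nq T" "set L \<subseteq> {..<?ns}" "set R \<subseteq> {..<?ns}" using s by
      (auto simp: s' tm_configs_def)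
  define X Y where "X = map Suc (rev L)" and "Y = map Suc R"
  define l r where "l = (case X of [] \<Rightarrow> 0 | d # _ \<Rightarrow> d)" and "r = (case Y
      of [] \<Rightarrow> 0 | d # _ \<Rightarrow> d)"
  define x1 where "x1 = popv base (Suc ?ns + q) (v $ 1)"
  have x1: "x1 = real base * v $ 1 - real (Suc ?ns + q)" by (simp add: x1_def popv_def)
  have vx: "v $ 1 \<in> stk base ((Suc ?ns + q) # X)" and vy: "v $ 2 \<in> stk base Y"
    using v by (auto simp: tbox_def s' xdigs_def ydigs_def X_def Y_def)
  have x1s: "x1 \<in> stk base X" using vx by (simp add: x1)
  have XY: "set X \<subseteq> {1..max_digit ?ns (tm_nq T)}" "set Y \<subseteq> {1..max_digit ?ns
      (tm_nq T)}"
    using digs_range[OF s] by (auto simp: s' xdigs_def ydigs_def X_def Y_def)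
  have nz: "0 \<notin> set X" "0 \<notin> set Y" by (auto simp: X_def Y_def)
  have "l \<le> ?ns" "r \<le> ?ns" using qLR by (auto simp: l_def r_def X_def Y_def Suc_le_eq
      split: list.split)
  then have p: "(q, l, r) \<in> pieces" using qLR by (auto simp: pieces_def)
  have w: "wx q l (v $ 1) = 1" "wy r (v $ 2) = 1"
    using stk_bump[OF XY(1) x1s] stk_bump[OF XY(2) vy] by (simp_all add: wx_def wy_def x1 l_def
        r_def)
  have f: "dmap v $ 1 = fx q l r (v $ 1)" "dmap v $ 2 = fy q l r (v $ 2)"
    using dmap_piece[OF p] by (simp_all add: w)
  show ?thesis
  proof (cases "q = 0")
    case True
    then show ?thesis using v f by (simp add: tm_step_def s' tbox_def fx_def fy_def)
  next
    case False
    define a where "a = (case R of [] \<Rightarrow> 0 | x # _ \<Rightarrow> x)"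
    have a: "r - 1 = a" by (simp add: r_def Y_def a_def split: list.split)
    obtain q' b m where d: "tm_delta T q a = (q', b, m)" by (metis prod_cases3)
    have m: "m \<in> {-1, 0, 1}" using delta_ok[OF qLR(1) \<open>r \<le> ?ns\<close>] d a by blast
    define y1 where "y1 = popv base r (v $ 2)"
    have y1: "y1 \<in> stk base (map Suc (tl R))"
      using popv_stk[OF vy nz(2)] by (simp add: y1_def r_def Y_def map_tl)
    have xl: "popv base l x1 \<in> stk base (tl X)" using popv_stk[OF x1s nz(1)] by (simp add:
        l_def)
    have yb: "pushv base (Suc b) y1 \<in> stk base (map Suc (b # tl R))" using pushv_stk[OF y1, of
        "Suc b"] by simp
    have fx: "fx q l r (v $ 1) = pushv base (Suc ?ns + q')
        (if m = 1 then pushv base (Suc b) x1 else if m = -1 then popv base l x1 else x1)"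
      using False unfolding fx_def a d Let_def prod.case x1_def by simp
    have fy: "fy q l r (v $ 2) = (if m = 1 then y1
       else if m = -1 then pushv base (if l = 0 then 1 else l) (pushv base (Suc b) y1)
       else pushv base (Suc b) y1)"
      using False unfolding fy_def a d Let_def prod.case y1_def by simp
    note f = f(1)[unfolded fx] f(2)[unfolded fy]
    consider "m = 1" | "m = 0" | "m = -1" "L = []" | c L' where "m = -1" "L = L' @ [c]"
      using m by (cases L rule: rev_cases) auto
    then show ?thesis
    proof cases
      case 1
      have "tm_step T s = (q', L @ [b], tl R)" using False 1 by (simp add: tm_step_def s'
          a_def[symmetric] d Let_def)
      then show ?thesis using 1 pushv_stk[OF pushv_stk[OF x1s]] y1
        by (simp add: tbox_def f xdigs_def ydigs_def X_def del: stk.simps)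
    next
      case 2
      have "tm_step T s = (q', L, b # tl R)" using False 2 by (simp add: tm_step_def s'
          a_def[symmetric] d Let_def)
      then show ?thesis using 2 pushv_stk[OF x1s] yb
        by (simp add: tbox_def f xdigs_def ydigs_def X_def del: stk.simps)
    next
      case 3
      have "tm_step T s = (q', [], 0 # b # tl R)" using False 3 by (simp add: tm_step_def s'
          a_def[symmetric] d Let_def)
      moreover have "l = 0" "X = []" using 3 by (simp_all add: l_def X_def)
      ultimately show ?thesis using 3 pushv_stk[OF xl] pushv_stk[OF yb, of 1]
        by (simp add: tbox_def f xdigs_def ydigs_def del: stk.simps)
    next
      case 4
      have "tm_step T s = (q', L', c # b # tl R)" using False 4 by (simp add: tm_step_def s'
          a_def[symmetric] d Let_def)
      moreover have "l = Suc c" "tl X = map Suc (rev L')" using 4 by (simp_all add: l_def X_def)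
      ultimately show ?thesis using 4 pushv_stk[OF xl] pushv_stk[OF yb, of "Suc c"]
        by (simp add: tbox_def f xdigs_def ydigs_def del: stk.simps)
    qed
  qed
qed

end

subsection \<open>The computational dynamical system\<close>

definition conf_point :: "tm \<Rightarrow> tm_conf \<Rightarrow> real^2" where
  "conf_point T s = vector [ctr (base T) (xdigs (tm_ns T) s), ctr (base T) (ydigs s)]"

definition point_conf :: "tm \<Rightarrow> real^2 \<Rightarrow> tm_conf option" where
  "point_conf T v = (if \<exists>s\<in>tm_configs T. v \<in> tbox T s then Some (THE s. s \<in>
      tm_configs T \<and> v \<in> tbox T s) else None)"

lemma point_conf_eq:
  assumes T: "wf_tm T" and s: "s \<in> tm_configs T" "v \<in> tbox T s"
  shows "point_conf T v = Some s"
proof -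
  have "(THE s. s \<in> tm_configs T \<and> v \<in> tbox T s) = s"
    by (rule the_equality) (use s tbox_unique[OF T] in blast)+
  moreover have "\<exists>s\<in>tm_configs T. v \<in> tbox T s" using s by blast
  ultimately show ?thesis by (simp only: point_conf_def if_True)
qed

lemma point_conf_Some:
  assumes T: "wf_tm T"
  shows "point_conf T v = Some s \<longleftrightarrow> s \<in> tm_configs T \<and> v \<in> tbox T s"
proof
  assume a: "point_conf T v = Some s"
  then obtain s' where s': "s' \<in> tm_configs T" "v \<in> tbox T s'"
    unfolding point_conf_def by (metis option.distinct(1))
  then show "s \<in> tm_configs T \<and> v \<in> tbox T s" using a point_conf_eq[OF T s'] by simp
qed (use point_conf_eq[OF T] in blast)

lemma point_conf_None: "point_conf T v = None \<longleftrightarrow> (\<forall>s\<in>tm_configs T.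
    v \<notin> tbox T s)"
  by (simp add: point_conf_def)

lemma tbox_cball:
  assumes T: "wf_tm T" and s: "s \<in> tm_configs T"
  shows "tbox T s \<subseteq> cball 0 1"
proof
  fix v assume v: "v \<in> tbox T s"
  have "-1/4 \<le> v $ 1 \<and> v $ 1 \<le> 1/2" "-1/4 \<le> v $ 2 \<and> v $ 2 \<le> 1/2"
    using v stk_bounds[OF base_ge[OF T] digs_range(1)[OF T s]] stk_bounds[OF base_ge[OF T]
        digs_range(2)[OF T s]]
    by (auto simp: tbox_def[OF T])
  then have "\<bar>v $ 1\<bar> \<le> 1/2" "\<bar>v $ 2\<bar> \<le> 1/2" by auto
  then have "(v $ 1)\<^sup>2 \<le> (1/2)\<^sup>2" "(v $ 2)\<^sup>2 \<le> (1/2)\<^sup>2" by (auto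
      simp: abs_le_square_iff[symmetric])
  then have "(norm v)\<^sup>2 \<le> 1" by (simp add: norm_vec_def L2_set_def UNIV_2
      power2_eq_square)
  then show "v \<in> cball 0 1" by (simp add: abs_square_le_1)
qed

lemma code_set_point_conf:
  assumes T: "wf_tm T" and s: "s \<in> tm_configs T"
  shows "code_set (cball 0 1) (point_conf T) s = tbox T s"
  using tbox_cball[OF T s] s unfolding code_set_def point_conf_Some[OF T] by auto

lemma tbox_cbox:
  assumes T: "wf_tm T"
  shows "\<exists>a b. tbox T s = cbox a b \<and> conf_point T s \<in> box a b"
proof -
  let ?x = "xdigs (tm_ns T) s" and ?y = "ydigs s" and ?B = "base T"
  define w where "w = (\<lambda>ds :: nat list. 1 / (4 * real ?B ^ (length ds + 1)))"
  have B: "0 < ?B" by (rule base_pos[OF T])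
  have w: "w ds > 0" for ds using B by (simp add: w_def)
  define a :: "real^2" where "a = vector [ctr ?B ?x - w ?x, ctr ?B ?y - w ?y]"
  define b :: "real^2" where "b = vector [ctr ?B ?x + w ?x, ctr ?B ?y + w ?y]"
  have "tbox T s = cbox a b"
    by (auto simp: tbox_def[OF T] stk_interval[OF B] mem_box_cart forall_2 a_def b_def vector_2
        w_def)
  moreover have "conf_point T s \<in> box a b"
    using w by (simp add: mem_box_cart forall_2 a_def b_def vector_2 conf_point_def)
  ultimately show ?thesis by blast
qed

lemma conf_point_tbox: "wf_tm T \<Longrightarrow> conf_point T s \<in> tbox T s"
  using tbox_cbox[of T s] box_subset_cbox by blast

text \<open>This is the time bound for the slowdown machine. The Turing machine halts at once with
  its input; for \<open>n = 0\<close> it leaves a single blank, which the result drops.\<close>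

lemma computable_nat_fun_id: "computable_nat_fun (\<lambda>n. n)"
proof -
  define M where "M = \<lparr>tm_nq = 2, tm_ns = 2, tm_delta = (\<lambda>q a. (0, a, 0))\<rparr>"
  have "wf_tm M" by (simp add: wf_tm_def M_def)
  moreover have "tm_output M (tm_start (replicate n 1)) (replicate n 1)" for n
  proof -
    have s: "tm_step M (tm_start (replicate n 1)) = (0, [], if n = 0 then [0] else replicate n 1)"
      by (cases n) (simp_all add: tm_step_def tm_start_def M_def Let_def)
    have "dropWhile (\<lambda>x. x = 0) (replicate n (1::nat)) = replicate n 1" by (cases n)
        simp_all
    then have "tm_result (0, [], if n = 0 then [0] else replicate n 1) = replicate n 1"
      by (simp add: tm_result_def)
    then show ?thesis unfolding tm_output_def using s by (intro exI[of _ 1]) simp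
  qed
  ultimately show ?thesis unfolding computable_nat_fun_def by blast
qed

lemma vec2_coords_inj: "vec2_coords x = vec2_coords y \<Longrightarrow> x = y"
  by (simp add: vec2_coords_def vec_eq_iff forall_2)

lemma length_vec2_coords: "length (vec2_coords x) = 2"
  by (simp add: vec2_coords_def)

lemma wf_tm_ns: "wf_tm T \<Longrightarrow> 0 < tm_ns T"
  by (simp add: wf_tm_def)

lemma enc_computes:
  assumes T: "wf_tm T" and s: "s \<in> tm_configs T"
  defines "P \<equiv> enc (tm_ns T) (tm_nq T)"
  shows "hbss_halts P (init_disc P (tm_enc T s))"
    and "out_real 2 (hbss_final P (init_disc P (tm_enc T s))) = vec2_coords (conf_point T s)"
    and "hbss_time P (init_disc P (tm_enc T s)) \<le> 4 * tm_size s + 4"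
proof -
  obtain q L R where s': "s = (q, L, R)" by (cases s)
  have qLR: "q < tm_nq T" "set L \<subseteq> {..<tm_ns T}" "set R \<subseteq> {..<tm_ns T}" using
      s by (auto simp: s' tm_configs_def)
  have "tm_enc T s = map Suc L @ [Suc (tm_ns T) + q] @ map Suc R" by (simp add: tm_enc_def s')
  from enc_correct[OF qLR wf_tm_ns[OF T] this] obtain dt dh where
    run: "hbss_run P (init_disc P (tm_enc T s)) (length L + 2 * length R + 4) =
      mkc 4 (ctr (base T) (xdigs (tm_ns T) s), ctr (base T) (ydigs s), 0, 1) dt dh"
    unfolding base_def[OF T] s' xdigs_def ydigs_def prod.case P_def by blast
  have "hc_state (hbss_run P (init_disc P (tm_enc T s)) (length L + 2 * length R + 4)) = bss_halt P"
    unfolding run by (simp add: P_def)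
  note f = hbss_final_eq[OF this]
  show "hbss_halts P (init_disc P (tm_enc T s))" by (rule f)
  show "out_real 2 (hbss_final P (init_disc P (tm_enc T s))) = vec2_coords (conf_point T s)"
    unfolding f(3) run by (simp add: out_real_def vec2_coords_def conf_point_def mkc_def vector_2
        numeral_2_eq_2 upt_Suc)
  show "hbss_time P (init_disc P (tm_enc T s)) \<le> 4 * tm_size s + 4"
    using f(2) by (simp add: s' tm_size_def)
qed

lemma dec_computes:
  assumes T: "wf_tm T" and s: "point_conf T v = Some s"
  defines "P \<equiv> dec (tm_ns T) (tm_nq T)"
  shows "hbss_halts P (init_real P (vec2_coords v))"
    and "out_real 1 (hbss_final P (init_real P (vec2_coords v))) = [1]"
    and "out_disc_is (hbss_final P (init_real P (vec2_coords v))) (tm_enc T s)"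
    and "hbss_time P (init_real P (vec2_coords v)) \<le> 6 * tm_size s + 6"
proof -
  obtain q L R where s': "s = (q, L, R)" by (cases s)
  have sT: "s \<in> tm_configs T" "v \<in> tbox T s" using s by (simp_all add: point_conf_Some[OF
      T])
  have qLR: "q < tm_nq T" "set L \<subseteq> {..<tm_ns T}" "set R \<subseteq> {..<tm_ns T}" using
      sT by (auto simp: s' tm_configs_def)
  have v: "v $ 1 \<in> stk (base T) ((Suc (tm_ns T) + q) # map Suc (rev L))" "v $ 2 \<in> stk
      (base T) (map Suc R)"
    using sT(2) by (simp_all add: tbox_def[OF T] s' xdigs_def ydigs_def)
  let ?w = "map Suc L @ [Suc (tm_ns T) + q] @ map Suc R"
  have w: "tm_enc T s = ?w" by (simp add: tm_enc_def s')
  from dec_correct[OF qLR v[unfolded base_def[OF T]]] obtain y' z' dh where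
    run: "hbss_run P (init_real P (vec2_coords v)) (2 * length L + length R + 6) =
      mkc 5 (1, y', z', 1) (put (\<lambda>_. 0) 0 (tm_enc T s)) dh"
    unfolding vec2_coords_def w P_def by blast
  have "hc_state (hbss_run P (init_real P (vec2_coords v)) (2 * length L + length R + 6)) =
      bss_halt P"
    unfolding run by (simp add: P_def)
  note f = hbss_final_eq[OF this]
  show "hbss_halts P (init_real P (vec2_coords v))" by (rule f)
  show "out_real 1 (hbss_final P (init_real P (vec2_coords v))) = [1]"
    unfolding f(3) run by (simp add: out_real_def mkc_def upt_Suc)
  have "0 \<notin> set ?w" by auto
  then show "out_disc_is (hbss_final P (init_real P (vec2_coords v))) (tm_enc T s)"
    unfolding f(3) run by (simp add: out_disc_is_def mkc_def put_def w)
  show "hbss_time P (init_real P (vec2_coords v)) \<le> 6 * tm_size s + 6"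
    using f(2) by (simp add: s' tm_size_def)
qed

lemma dec_diverges:
  assumes T: "wf_tm T" and n: "point_conf T v = None"
  shows "\<not> hbss_halts (dec (tm_ns T) (tm_nq T)) (init_real (dec (tm_ns T) (tm_nq T))
      (vec2_coords v))"
proof
  assume "hbss_halts (dec (tm_ns T) (tm_nq T)) (init_real (dec (tm_ns T) (tm_nq T)) (vec2_coords
      v))"
  from dec_complete[OF this[unfolded vec2_coords_def]] obtain q L R where
    c: "q < tm_nq T" "set L \<subseteq> {..<tm_ns T}" "set R \<subseteq> {..<tm_ns T}"
    and v: "v $ 1 \<in> stk (base T) ((Suc (tm_ns T) + q) # map Suc (rev L))" "v $ 2 \<in> stk
        (base T) (map Suc R)"
    unfolding base_def[OF T] by blast
  have "(q, L, R) \<in> tm_configs T" using c by (simp add: tm_configs_def)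
  moreover have "v \<in> tbox T (q, L, R)" using v by (simp add: tbox_def[OF T] xdigs_def ydigs_def)
  ultimately show False using n by (auto simp: point_conf_None)
qed

lemma dmap_CDS:
  assumes T: "wf_tm T"
  shows "is_CDS vec2_coords (cball 0 1) (dmap T) (conf_point T) (point_conf T)
    (\<lambda>x. if point_conf T x = None then None else Some 1) T (\<lambda>n. n)"
proof -
  let ?\<tau> = "\<lambda>x. if point_conf T x = None then None else Some (1::nat)"
  let ?E = "enc (tm_ns T) (tm_nq T)" and ?D = "dec (tm_ns T) (tm_nq T)"
  note ns = wf_tm_ns[OF T]
  have E: "computes_encoding ?E vec2_coords T (conf_point T)"
    unfolding computes_encoding_def length_vec2_coords using enc_computes(1,2)[OF T] by blast
  have Et: "\<exists>C. \<forall>s\<in>tm_configs T. hbss_time ?E (init_disc ?E (tm_enc T s))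
      \<le> C * tm_size s + C"
    using enc_computes(3)[OF T] by blast
  have D: "computes_decoding ?D vec2_coords (cball 0 1) T (point_conf T)"
    unfolding computes_decoding_def
  proof
    fix x show "case point_conf T x of None \<Rightarrow> \<not> hbss_halts ?D (init_real ?D
        (vec2_coords x))
      | Some s \<Rightarrow> hbss_halts ?D (init_real ?D (vec2_coords x)) \<and>
        out_disc_is (hbss_final ?D (init_real ?D (vec2_coords x))) (tm_enc T s)"
      by (cases "point_conf T x") (use dec_diverges[OF T] dec_computes[OF T] in auto)
  qed
  have Dt: "\<exists>C. \<forall>x\<in>cball 0 1. \<forall>s. point_conf T x = Some s
      \<longrightarrow> hbss_time ?D (init_real ?D (vec2_coords x)) \<le> C * tm_size s + C"
    using dec_computes(4)[OF T] by blast
  \<comment> \<open>The decoder doubles as slowdown machine: it halts on the same points, and then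
    with 1 in register 0.\<close>
  have S: "computes_slowdown ?D vec2_coords (cball 0 1) ?\<tau>"
    unfolding computes_slowdown_def
  proof
    fix x show "case ?\<tau> x of None \<Rightarrow> \<not> hbss_halts ?D (init_real ?D
        (vec2_coords x))
      | Some n \<Rightarrow> hbss_halts ?D (init_real ?D (vec2_coords x)) \<and>
        out_real 1 (hbss_final ?D (init_real ?D (vec2_coords x))) = [real n]"
      by (cases "point_conf T x") (use dec_diverges[OF T] dec_computes[OF T] in auto)
  qed
  have tc: "conf_point T s \<in> code_set (cball 0 1) (point_conf T) s" if "s \<in> tm_configs T"
      for s
    using that conf_point_tbox[OF T] by (simp add: code_set_point_conf[OF T])
  have st: "tm_step T s \<in> tm_configs T" if "s \<in> tm_configs T" for s
  proof -
    obtain q L R where s: "s = (q, L, R)" by (cases s)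
    show ?thesis by (rule fconf_step(2)[OF T that, of "(q, \<lambda>j. cell L R (j - 0), 0)"])
        (simp add: fconf_def s)
  qed
  have dyn: "(\<lambda>x. point_conf T ((dmap T ^^ the (?\<tau> x)) x)) ` code_set (cball 0 1)
      (point_conf T) s = {Some (tm_step T s)}"
    if s: "s \<in> tm_configs T" for s
  proof -
    have "point_conf T ((dmap T ^^ the (?\<tau> x)) x) = Some (tm_step T s)" if "x \<in> code_set
        (cball 0 1) (point_conf T) s" for x
    proof -
      have x: "point_conf T x = Some s" "x \<in> tbox T s" using that s by (auto simp:
          code_set_def point_conf_Some[OF T])
      then have "point_conf T (dmap T x) = Some (tm_step T s)"
        using dmap_step[OF T s] st[OF s] by (simp add: point_conf_Some[OF T])
      then show ?thesis by (simp add: x(1))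
    qed
    then have "(\<lambda>x. point_conf T ((dmap T ^^ the (?\<tau> x)) x)) ` code_set (cball 0 1)
        (point_conf T) s =
        (\<lambda>_. Some (tm_step T s)) ` code_set (cball 0 1) (point_conf T) s"
      by (intro image_cong refl)
    also have "\<dots> = {Some (tm_step T s)}" using tc[OF s] by (rule image_constant)
    finally show ?thesis .
  qed
  show ?thesis
    unfolding is_CDS_def
  proof (intro conjI)
    show "\<exists>P. wf_hbss P \<and> computes_encoding P vec2_coords T (conf_point T) \<and>
        (\<exists>C. \<forall>s\<in>tm_configs T. hbss_time P (init_disc P (tm_enc T s)) \<le> C *
            tm_size s + C)"
      using wf_enc[OF ns] E Et by blast
    show "\<exists>P. wf_hbss P \<and> computes_decoding P vec2_coords (cball 0 1) T (point_conf
        T) \<and>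
        (\<exists>C. \<forall>x\<in>cball 0 1. \<forall>s. point_conf T x = Some s
            \<longrightarrow> hbss_time P (init_real P (vec2_coords x)) \<le> C * tm_size s + C)"
      using wf_dec[OF ns] D Dt by blast
    show "\<exists>u P. computable_nat_fun u \<and> wf_hbss P \<and> computes_slowdown P
        vec2_coords (cball 0 1) ?\<tau> \<and>
        (\<exists>C. \<forall>x\<in>cball 0 1. \<forall>s. point_conf T x = Some s \<longrightarrow>
          hbss_time P (init_real P (vec2_coords x)) \<le> C * u (tm_size s) + C)"
      by (rule exI[of _ "\<lambda>n. n"], rule exI[of _ ?D]) (use computable_nat_fun_id wf_dec[OF
          ns] S Dt in blast)
    show "\<forall>s. \<forall>x\<in>code_set (cball 0 1) (point_conf T) s.
        \<forall>y\<in>code_set (cball 0 1) (point_conf T) s.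
        connected_component (code_set (cball 0 1) (point_conf T) s) x y \<longrightarrow> ?\<tau>
            x = ?\<tau> y"
      by (auto simp: code_set_def)
    show "conf_point T ` tm_configs T \<subseteq> cball 0 1" using conf_point_tbox[OF T]
        tbox_cball[OF T] by blast
    show "\<forall>s\<in>tm_configs T. conf_point T s \<in> code_set (cball 0 1) (point_conf T) s
        \<and>
        (\<lambda>x. point_conf T ((dmap T ^^ the (?\<tau> x)) x)) ` code_set (cball 0 1)
            (point_conf T) s = {Some (tm_step T s)}"
      using tc dyn by blast
  qed (use T dmap_disk[OF T] point_conf_Some[OF T] in auto)
qed

lemma dmap_robust:
  assumes T: "wf_tm T"
  shows "robust_CDS (cball 0 1) (conf_point T) (point_conf T) T"
  unfolding robust_CDS_def
proof
  fix s assume s: "s \<in> tm_configs T"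
  obtain a b where ab: "tbox T s = cbox a b" "conf_point T s \<in> box a b" using tbox_cbox[OF T]
      by blast
  then have "box a b \<noteq> {}" by blast
  then show "code_set (cball 0 1) (point_conf T) s = closure (interior (code_set (cball 0 1)
      (point_conf T) s)) \<and>
      conf_point T s \<in> interior (code_set (cball 0 1) (point_conf T) s)"
    unfolding code_set_point_conf[OF T s] ab(1) using ab(2) by (simp add: interior_cbox closure_box)
qed

text \<open>A decoder writes at most one cell per step.\<close>

lemma decoding_lower_bound: "decoding_time_lower_linear crd M T D"
  unfolding decoding_time_lower_linear_def
proof (intro allI impI)
  fix P assume P: "wf_hbss P \<and> computes_decoding P crd M T D"
  have t: "tm_size s \<le> hbss_time P (init_real P (crd x))" if "x \<in> M" "D x = Some s" for x s
  proof -
    let ?c = "init_real P (crd x)" and ?e = "tm_enc T s"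
    have "case D x of None \<Rightarrow> \<not> hbss_halts P (init_real P (crd x))
      | Some s \<Rightarrow> hbss_halts P (init_real P (crd x)) \<and>
        out_disc_is (hbss_final P (init_real P (crd x))) (tm_enc T s)"
      using P that(1) unfolding computes_decoding_def by blast
    then have o: "out_disc_is (hbss_run P ?c (hbss_time P ?c)) ?e" by (simp add: that(2)
        hbss_final_def)
    let ?A = "{j. hc_dtape (hbss_run P ?c (hbss_time P ?c)) j \<noteq> hc_dtape ?c j}"
    \<comment> \<open>Output symbols are nonzero and the discrete tape is blank initially, so each
      output cell has been changed.\<close>
    have "int i \<in> ?A" if "i < length ?e" for i
    proof -
      have "?e ! i \<in> set ?e" using that by simp
      then have "?e ! i \<noteq> 0" using o unfolding out_disc_is_def by metis
      moreover have "hc_dtape (hbss_run P ?c (hbss_time P ?c)) (int i) = ?e ! i"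
        using o that by (simp add: out_disc_is_def)
      ultimately show ?thesis by (simp add: init_real_def)
    qed
    then have "int ` {..<length ?e} \<subseteq> ?A" by auto
    then have "card (int ` {..<length ?e}) \<le> card ?A" using hbss_run_dtape by (intro
        card_mono) auto
    also have "\<dots> \<le> hbss_time P ?c" using hbss_run_dtape by blast
    finally show ?thesis by (simp add: card_image tm_enc_def tm_size_def split: prod.splits)
  qed
  show "\<exists>c>0. \<exists>N. \<forall>n\<ge>N. (\<exists>x\<in>M. \<exists>s. D x = Some s
      \<and> tm_size s = n) \<longrightarrow>
        (\<exists>x\<in>M. \<exists>s. D x = Some s \<and> tm_size s = n \<and> real (hbss_time P
            (init_real P (crd x))) \<ge> c * real n)"
  proof (rule exI[of _ 1], intro conjI exI[of _ 0] allI impI)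
    fix n assume "\<exists>x\<in>M. \<exists>s. D x = Some s \<and> tm_size s = n"
    then obtain x s where x: "x \<in> M" "D x = Some s" "tm_size s = n" by blast
    have "1 * real n \<le> real (hbss_time P (init_real P (crd x)))"
      using t[OF x(1,2)] x(3) by simp
    then show "\<exists>x\<in>M. \<exists>s. D x = Some s \<and> tm_size s = n \<and> real
        (hbss_time P (init_real P (crd x))) \<ge> 1 * real n"
      using x by blast
  qed simp
qed

text \<open>An encoder that stops early does not see the last symbol of the configuration
    string.\<close>

lemma encoding_lower_bound:
  assumes T: "wf_tm T" and inj: "inj_on E (tm_configs T)"
  shows "encoding_time_lower_linear vec2_coords T E"
  unfolding encoding_time_lower_linear_def
proof (intro allI impI)
  fix P assume P: "wf_hbss P \<and> computes_encoding P vec2_coords T E"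
  have t: "n - 1 \<le> hbss_time P (init_disc P (tm_enc T (0, [], replicate (n - 1) 0)))"
    and conf: "(0, [], replicate (n - 1) 0) \<in> tm_configs T" if n: "n \<ge> 2" for n
  proof -
    define k where "k = n - 2"
    \<comment> \<open>With an empty left part the state marker is in cell 0 and the last symbol in
      cell \<open>k + 1\<close>, where the codes 1 and 2 of the symbols 0 and 1 differ. Both sizes
      are \<open>k + 2 = n\<close>.\<close>
    define s s' :: tm_conf where "s = (0, [], replicate k 0 @ [0])" and "s' = (0, [], replicate k
        0 @ [1])"
    have s_eq: "(0, [], replicate (n - 1) 0) = s"
      using n by (simp add: s_def k_def replicate_append_same Suc_diff_le numeral_2_eq_2 flip:
          replicate_Suc)
    have sT: "s \<in> tm_configs T" "s' \<in> tm_configs T" using T by (auto simp: s_def s'_def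
        tm_configs_def wf_tm_def)
    then show "(0, [], replicate (n - 1) 0) \<in> tm_configs T" unfolding s_eq by blast
    let ?c = "init_disc P (tm_enc T s)" and ?c' = "init_disc P (tm_enc T s')"
    have "(if 0 \<le> j \<and> j < int (length (tm_enc T s')) then tm_enc T s' ! nat j else 0) =
      ((\<lambda>j. if 0 \<le> j \<and> j < int (length (tm_enc T s)) then tm_enc T s ! nat j else
          0)(int (k + 1) := 2)) j" for j
      by (auto simp: tm_enc_def s_def s'_def nth_Cons' nth_append)
    then have c': "?c' = ?c\<lparr>hc_dtape := (hc_dtape ?c)(int (k + 1) := 2)\<rparr>"
      by (simp add: init_disc_def fun_eq_iff)
    have H: "hbss_halts P ?c" and O: "\<And>s. s \<in> tm_configs T \<Longrightarrow>
        out_real 2 (hbss_final P (init_disc P (tm_enc T s))) = vec2_coords (E s)"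
      using P sT unfolding computes_encoding_def length_vec2_coords by blast+
    have "k + 1 \<le> hbss_time P ?c"
    proof (rule ccontr)
      assume "\<not> k + 1 \<le> hbss_time P ?c"
      then have le: "int (hbss_time P ?c) \<le> int (k + 1)" by simp
      have "hc_dhead ?c = 0" by (simp add: init_disc_def)
      from hbss_run_unread[OF _ this le, of P 2] P
      have r: "hbss_run P ?c' (hbss_time P ?c) = (hbss_run P ?c (hbss_time P ?c))
          \<lparr>hc_dtape := (hc_dtape (hbss_run P ?c (hbss_time P ?c)))(int (k + 1) := 2)\<rparr>"
        unfolding c' by blast
      have "hc_state (hbss_run P ?c (hbss_time P ?c)) = bss_halt P"
        unfolding hbss_time_def using H unfolding hbss_halts_def by (rule LeastI_ex)
      then have "hc_state (hbss_run P ?c' (hbss_time P ?c)) = bss_halt P" unfolding r by simp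
      \<comment> \<open>The two runs differ in one discrete cell only, so their real outputs agree,
        contrary to injectivity.\<close>
      from hbss_final_eq(3)[OF this] have "out_real 2 (hbss_final P ?c') = out_real 2 (hbss_final
          P ?c)"
        unfolding r by (simp add: out_real_def hbss_final_def)
      then have "vec2_coords (E s') = vec2_coords (E s)" using O sT by simp
      then have "s' = s" using inj sT by (meson inj_onD vec2_coords_inj)
      then show False by (simp add: s_def s'_def)
    qed
    then show "n - 1 \<le> hbss_time P (init_disc P (tm_enc T (0, [], replicate (n - 1) 0)))"
      unfolding s_eq using n by (simp add: k_def)
  qed
  show "\<exists>c>0. \<exists>N. \<forall>n\<ge>N. (\<exists>s\<in>tm_configs T. tm_size s = n)
      \<longrightarrow>
        (\<exists>s\<in>tm_configs T. tm_size s = n \<and> real (hbss_time P (init_disc P (tm_enc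
            T s))) \<ge> c * real n)"
  proof (rule exI[of _ "1/2"], intro conjI exI[of _ 2] allI impI)
    fix n :: nat assume n: "2 \<le> n"
    \<comment> \<open>The bound n - 1 is at least n / 2 from n = 2 on, which explains both
      witnesses.\<close>
    have "1/2 * real n \<le> real (n - 1)" using n by (simp add: of_nat_diff)
    also have "\<dots> \<le> real (hbss_time P (init_disc P (tm_enc T (0, [], replicate (n - 1)
        0))))"
      using t[OF n] by (simp only: of_nat_le_iff)
    finally show "\<exists>s\<in>tm_configs T. tm_size s = n \<and> real (hbss_time P (init_disc P
        (tm_enc T s))) \<ge> 1/2 * real n"
      using conf[OF n] n by (intro bexI[of _ "(0, [], replicate (n - 1) 0)"]) (auto simp:
          tm_size_def)
  qed simp
qed

theorem theorem4p4:
  shows "\<exists>(T::tm) (f::real^2 \<Rightarrow> real^2) (E::tm_conf \<Rightarrow> real^2) (D::real^2 \<Rightarrow> tm_conf option)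
           (\<tau>::real^2 \<Rightarrow> nat option).
     universal_tm T \<and> smooth_disk_map f \<and>
     (\<forall>x. \<tau> x = (if D x = None then None else Some 1)) \<and>
     is_CDS vec2_coords (cball 0 1) f E D \<tau> T (\<lambda>n. n) \<and>
     robust_CDS (cball 0 1) E D T \<and>
     encoding_time_lower_linear vec2_coords T E \<and>
     decoding_time_lower_linear vec2_coords (cball 0 1) T D"
proof -
  obtain T where U: "universal_tm T" using ex_universal_tm by blast
  then have T: "wf_tm T" by (simp add: universal_tm_def)
  have "smooth_disk_map (dmap T)"
    unfolding smooth_disk_map_def using dmap_disk[OF T] dmap_smooth[OF T] by blast
  \<comment> \<open>Distinct configurations have disjoint boxes, and each encoded point lies in its
    own.\<close>
  moreover have "inj_on (conf_point T) (tm_configs T)"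
    using tbox_unique[OF T] conf_point_tbox[OF T] by (metis inj_onI)
  ultimately show ?thesis
    using U dmap_CDS[OF T] dmap_robust[OF T] encoding_lower_bound[OF T] decoding_lower_bound
    by (intro exI[of _ T] exI[of _ "dmap T"] exI[of _ "conf_point T"] exI[of _ "point_conf T"]
        exI[of _ "\<lambda>x. if point_conf T x = None then None else Some 1"] conjI) auto
qed

end
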